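(* Let $\varphi$ be an increasing concave function on $[0,\infty)$ such that $\lim_{t\to0^+}\varphi(t)=0$ and $q_\varphi<1$. Then the space $C(M_\varphi^0)$ on $[0,\infty)$ has the Dunford–Pettis property.
   Context: Convention: $\varphi(0)=0$, $\varphi>0$ on $(0,\infty)$. Marcinkiewicz space $M_\varphi$ on $[0,\infty)$: measurable $f$ with $\|f\|=\sup_{t>0}\frac{\varphi(t)}{t}\int_0^tf^*(s)\,ds<\infty$, $f^*$ the decreasing rearrangement. $M_\varphi^0$ is its subspace of elements with order continuous norm: $f$ such that $\|f\chi_{A_n}\|\to0$ for every decreasing sequence of measurable sets $A_n$ with $m(\bigcap A_n)=0$; it carries the norm of $M_\varphi$. With $Cf(x)=\frac1x\int_0^xf(t)\,dt$, $C(M_\varphi^0)=\{f:C|f|\in M_\varphi^0\}$, $\|f\|=\|C|f|\|_{M_\varphi}$. Index: $\overline\varphi(s)=\sup_{t>0}\varphi(st)/\varphi(t)$, $q_\varphi=\lim_{s\to\infty}\ln\overline\varphi(s)/\ln s$. Dunford–Pettis property: $x_n\to0$ weakly and $x_n^*\to0$ weakly in the dual imply $x_n^*(x_n)\to0$. *)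

theory Defs
  imports "HOL-Analysis.Analysis"
begin

definition bounded_lin_fun :: "('a \<Rightarrow> real) set \<Rightarrow> (('a \<Rightarrow> real) \<Rightarrow> real) \<Rightarrow> (('a \<Rightarrow> real) \<Rightarrow> real) \<Rightarrow> bool" where
  "bounded_lin_fun X N L \<longleftrightarrow>
     (\<forall>f\<in>X. \<forall>g\<in>X. L (\<lambda>x. f x + g x) = L f + L g) \<and>
     (\<forall>c. \<forall>f\<in>X. L (\<lambda>x. c * f x) = c * L f) \<and>
     (\<exists>C. \<forall>f\<in>X. \<bar>L f\<bar> \<le> C * N f)"

definition dual_sp :: "('a \<Rightarrow> real) set \<Rightarrow> (('a \<Rightarrow> real) \<Rightarrow> real) \<Rightarrow> (('a \<Rightarrow> real) \<Rightarrow> real) set" where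
  "dual_sp X N = {L. bounded_lin_fun X N L}"

definition dual_norm :: "('a \<Rightarrow> real) set \<Rightarrow> (('a \<Rightarrow> real) \<Rightarrow> real) \<Rightarrow> (('a \<Rightarrow> real) \<Rightarrow> real) \<Rightarrow> real" where
  "dual_norm X N L = Sup {\<bar>L f\<bar> | f. f \<in> X \<and> N f \<le> 1}"

definition weakly_null :: "('a \<Rightarrow> real) set \<Rightarrow> (('a \<Rightarrow> real) \<Rightarrow> real) \<Rightarrow> (nat \<Rightarrow> 'a \<Rightarrow> real) \<Rightarrow> bool" where
  "weakly_null X N x \<longleftrightarrow> (\<forall>n. x n \<in> X) \<and>
     (\<forall>L. bounded_lin_fun X N L \<longrightarrow> (\<lambda>n. L (x n)) \<longlonglongrightarrow> 0)"

definition dunford_pettis :: "('a \<Rightarrow> real) set \<Rightarrow> (('a \<Rightarrow> real) \<Rightarrow> real) \<Rightarrow> bool" where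
  "dunford_pettis X N \<longleftrightarrow>
     (\<forall>x xs. weakly_null X N x \<longrightarrow> weakly_null (dual_sp X N) (dual_norm X N) xs \<longrightarrow>
        (\<lambda>n. xs n (x n)) \<longlonglongrightarrow> 0)"

definition rearr :: "(real \<Rightarrow> real) \<Rightarrow> real \<Rightarrow> ennreal" where
  "rearr f t = Inf {l::ennreal. emeasure lebesgue {x. 0 \<le> x \<and> l < ennreal \<bar>f x\<bar>} \<le> ennreal t}"

definition marc_norm :: "(real \<Rightarrow> real) \<Rightarrow> (real \<Rightarrow> real) \<Rightarrow> ennreal" where
  "marc_norm \<phi> f = (SUP t\<in>{0<..}. ennreal (\<phi> t / t) * (\<integral>\<^sup>+ s. rearr f s * indicator {0..t} s \<partial>lborel))"

definition Marc :: "(real \<Rightarrow> real) \<Rightarrow> (real \<Rightarrow> real) set" where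
  "Marc \<phi> = {f. f \<in> borel_measurable lebesgue \<and> marc_norm \<phi> f < \<infinity>}"

text \<open>Subspace of elements with order continuous norm.\<close>
definition Marc0 :: "(real \<Rightarrow> real) \<Rightarrow> (real \<Rightarrow> real) set" where
  "Marc0 \<phi> = {f \<in> Marc \<phi>. \<forall>A :: nat \<Rightarrow> real set.
      (\<forall>n. A n \<in> sets lebesgue \<and> A n \<subseteq> {0..}) \<longrightarrow> decseq A \<longrightarrow>
      emeasure lebesgue (\<Inter>n. A n) = 0 \<longrightarrow>
      ((\<lambda>n. marc_norm \<phi> (\<lambda>x. f x * indicator (A n) x)) \<longlongrightarrow> 0) sequentially}"

definition cesaro :: "(real \<Rightarrow> real) \<Rightarrow> real \<Rightarrow> real" where
  "cesaro g x = (if 0 < x then (1 / x) * (LINT t:{0..x}|lebesgue. g t) else 0)"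

definition CesM0 :: "(real \<Rightarrow> real) \<Rightarrow> (real \<Rightarrow> real) set" where
  "CesM0 \<phi> = {f. f \<in> borel_measurable lebesgue \<and>
      (\<forall>x>0. set_integrable lebesgue {0..x} f) \<and>
      cesaro (\<lambda>t. \<bar>f t\<bar>) \<in> Marc0 \<phi>}"

definition ces_norm :: "(real \<Rightarrow> real) \<Rightarrow> (real \<Rightarrow> real) \<Rightarrow> real" where
  "ces_norm \<phi> f = enn2real (marc_norm \<phi> (cesaro (\<lambda>t. \<bar>f t\<bar>)))"

definition phibar :: "(real \<Rightarrow> real) \<Rightarrow> real \<Rightarrow> real" where
  "phibar \<phi> s = (SUP t\<in>{0<..}. \<phi> (s * t) / \<phi> t)"

definition q_index :: "(real \<Rightarrow> real) \<Rightarrow> real" where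
  "q_index \<phi> = Lim at_top (\<lambda>s. ln (phibar \<phi> s) / ln s)"

end

theory Submission
  imports Defs
begin

text \<open>
  Concavity and \<open>q_index \<phi> < 1\<close> give \<open>\<phi> t \<le> C (t / u)\<^sup>p \<phi> u\<close> for \<open>u \<le> t\<close> with some \<open>p < 1\<close>. Hence the norm
  of the Cesaro space is equivalent to the supremum over \<open>t\<close> of \<open>\<phi> t / t \<cdot> \<integral>\<^sub>0\<^sup>t \<bar>f\<bar>\<close>, and then, by geometric
  summation over dyadic intervals, to the supremum over \<open>k\<close> of the integral of \<open>\<bar>f x\<bar> \<phi> x / x\<close> over the
  \<open>k\<close>-th dyadic interval; order continuity means that these block integrals tend to zero. So the
  space is a \<open>c\<^sub>0\<close>-sum of \<open>L\<^sub>1\<close> spaces.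

  In such a sum, a diagonal form of Schur's theorem for \<open>\<ell>\<^sub>1\<close> shows three things: weakly null sequences are bounded; for weakly null \<open>x n\<close>
  and \<open>L n\<close> the tails of \<open>L n (x n)\<close> in the index of the block are small; and on finitely many blocks
  the functions \<open>x n\<close> are uniformly integrable along any sequence of sets decreasing to a null set.
  On finitely many blocks \<open>L n\<close> has a bounded density, and almost every point evaluation of these
  densities extends, by the Hahn--Banach theorem, to a functional on the dual space. Therefore the densities
  tend to zero almost everywhere, and the conclusion follows as in Egorov's theorem.
\<close>

section \<open>Weakly null sequences and the diagonal Schur theorem\<close>

text \<open>Neither dual nor bidual is described; weak nullness is exploited only through
  functionals built by hand. If the values \<open>\<psi> i f\<close> are absolutely summable with
  sum at most \<open>K * N f\<close>, every bounded multiplier sequence gives a bounded functional,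
  and a gliding hump forces \<open>\<psi> n (x n)\<close> to 0. The uses differ in the source of
  summability: damping factors for boundedness, disjoint groups of blocks on the dual side, disjoint
  subsets of finitely many blocks on the side of the space. The obstacle is the dual side: a density
  is defined only up to null sets, so evaluation at a point is not a functional on the dual. For one
  fixed sequence of densities, however, the rational combinations are bounded by the dual norm
  outside a single null set, and this is all that an extension theorem needs. The exponent
  \<open>p < 1\<close> enters twice: it makes \<open>1 / \<phi>\<close> integrable at 0, which
  removes the rearrangement from the norm, and it makes the influence of lower dyadic blocks decay
  geometrically. Functions are not identified almost everywhere and negative arguments do not count,
  so everything is phrased for seminorms on sets of functions.\<close>

lemma increasing_selection:
  fixes R :: "nat \<Rightarrow> nat \<Rightarrow> nat \<Rightarrow> bool"
  assumes "\<And>J. \<exists>n\<ge>J. \<exists>J'>n. R J n J'"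
  obtains J n where "\<And>i. J i \<le> n i" "\<And>i. n i < J (Suc i)" "\<And>i. R (J i) (n i) (J (Suc i))"
    "strict_mono n" "strict_mono J"
proof -
  obtain fn fJ where f: "\<And>J. J \<le> fn J \<and> fn J < fJ J \<and> R J (fn J) (fJ J)"
    using assms by metis
  \<comment> \<open>Each choice restarts at the outer bound of the previous one, so the windows from
    \<open>J i\<close> up to \<open>J (Suc i)\<close> are disjoint and each contains one chosen
    index \<open>n i\<close>. \<open>R\<close> sees both ends of its window: the lower one controls
    what comes before, the upper one what comes after.\<close>
  define J where "J = rec_nat 0 (\<lambda>_ j. fJ j)"
  have J: "J (Suc i) = fJ (J i)" for i by (simp add: J_def)
  define n where "n i = fn (J i)" for i
  have 1: "J i \<le> n i" "n i < J (Suc i)" "R (J i) (n i) (J (Suc i))" for i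
    using f[of "J i"] by (auto simp: J n_def)
  have 2: "strict_mono n"
    using 1 by (intro strict_monoI_Suc) (meson le_less_trans less_le_trans)
  have 3: "strict_mono J"
    using 1 by (intro strict_monoI_Suc) (meson le_less_trans)
  show ?thesis using that[of J n] 1 2 3 by blast
qed

text \<open>Gliding hump: in a selected row the part before the window is small because the columns
  tend to 0, the part after it because the row is summable, so multipliers supported on the selected
  indices leave essentially the diagonal entry.\<close>

lemma schur_diagonal:
  fixes c :: "nat \<Rightarrow> nat \<Rightarrow> real"
  assumes sm: "\<And>n. summable (\<lambda>i. \<bar>c n i\<bar>)"
    and lim: "\<And>e :: nat \<Rightarrow> real. (\<And>i. \<bar>e i\<bar> \<le> 1) \<Longrightarrow> (\<lambda>n. \<Sum>i. e i * c n i) \<longlonglongrightarrow> 0"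
  shows "(\<lambda>n. c n n) \<longlonglongrightarrow> 0"
proof (rule ccontr)
  assume "\<not> ?thesis"
  then obtain d where d: "d > 0" and freq: "\<And>N. \<exists>n\<ge>N. d \<le> \<bar>c n n\<bar>"
    unfolding LIMSEQ_iff by (auto simp: not_less)
  have col: "(\<lambda>n. c n i) \<longlonglongrightarrow> 0" for i
  proof -
    have "(\<Sum>j. indicator {i} j * c n j) = (\<Sum>j\<in>{i}. indicator {i} j * c n j)" for n
      by (rule suminf_finite) auto
    then have "(\<Sum>j. indicator {i} j * c n j) = c n i" for n by simp
    then show ?thesis using lim[of "indicator {i}"] by (simp add: indicator_def)
  qed
  define R where "R J n J' \<longleftrightarrow> d \<le> \<bar>c n n\<bar> \<and> (\<Sum>i<J. \<bar>c n i\<bar>) \<le> d/4 \<and> (\<Sum>i. \<bar>c n (i + J')\<bar>) \<le> d/4"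
    for J n J'
  have "\<exists>n\<ge>J. \<exists>J'>n. R J n J'" for J
  proof -
    have "(\<lambda>n. \<Sum>i<J. \<bar>c n i\<bar>) \<longlonglongrightarrow> (\<Sum>i<J. \<bar>0\<bar>)"
      by (intro tendsto_intros col)
    then have "eventually (\<lambda>n. (\<Sum>i<J. \<bar>c n i\<bar>) < d/4) sequentially"
      using d by (intro order_tendstoD) auto
    then obtain N where N: "\<And>n. n \<ge> N \<Longrightarrow> (\<Sum>i<J. \<bar>c n i\<bar>) < d/4"
      by (auto simp: eventually_sequentially)
    obtain n where n: "n \<ge> max N J" "d \<le> \<bar>c n n\<bar>" using freq by blast
    obtain K where K: "\<And>k. k \<ge> K \<Longrightarrow> norm (\<Sum>i. \<bar>c n (i + k)\<bar>) < d/4"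
      using suminf_exist_split[OF _ sm[of n], of "d/4"] d by auto
    have "(\<Sum>i. \<bar>c n (i + max K (Suc n))\<bar>) \<le> d/4"
      using K[of "max K (Suc n)"] by auto
    then show ?thesis
      using N[of n] n unfolding R_def
      by (intro exI[of _ n] conjI exI[of _ "max K (Suc n)"]) auto
  qed
  then obtain J n where sel: "\<And>i. J i \<le> n i" "\<And>i. n i < J (Suc i)" "\<And>i. R (J i) (n i) (J (Suc i))"
    "strict_mono n" "strict_mono J"
    by (rule increasing_selection) blast
  \<comment> \<open>One multiplier serves all selected rows: inside window \<open>m\<close> it keeps
    only column \<open>n m\<close>, and the other selected columns fall into the head or the tail,
    each at most \<open>d/4\<close>.\<close>
  define e :: "nat \<Rightarrow> real" where "e = indicator (range n)"
  have e1: "\<bar>e i\<bar> \<le> 1" for i by (simp add: e_def indicator_def)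
  have big: "d/2 \<le> \<bar>\<Sum>i. e i * c (n m) i\<bar>" for m
  proof -
    let ?N = "n m" and ?J = "J m" and ?J' = "J (Suc m)"
    have s: "summable (\<lambda>i. \<bar>e i * c ?N i\<bar>)"
      by (rule summable_comparison_test[OF _ sm[of ?N]])
         (use e1 in \<open>auto simp: abs_mult intro!: exI[of _ 0] mult_left_le_one_le\<close>)
    have s2: "summable (\<lambda>i. \<bar>e (i + ?J') * c ?N (i + ?J')\<bar>)"
      using summable_ignore_initial_segment[OF s] .
    have "(\<Sum>i. e i * c ?N i) = (\<Sum>i. e (i + ?J') * c ?N (i + ?J')) + (\<Sum>i<?J'. e i * c ?N i)"
      by (rule suminf_split_initial_segment) (rule summable_rabs_cancel[OF s])
    also have "(\<Sum>i<?J'. e i * c ?N i) = (\<Sum>i<?J. e i * c ?N i) + c ?N ?N"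
    proof -
      have z: "e i = 0" if i: "?J \<le> i" "i < ?J'" "i \<noteq> ?N" for i
      proof -
        have "i \<noteq> n l" for l
        proof (cases l m rule: linorder_cases)
          case less
          then have "J (Suc l) \<le> ?J" using sel(5) by (simp add: strict_mono_less_eq)
          then show ?thesis using sel(2)[of l] i by auto
        next
          case greater
          then have "?J' \<le> J l" using sel(5) by (simp add: strict_mono_less_eq)
          then show ?thesis using sel(1)[of l] i by auto
        qed (use i in auto)
        then have "i \<notin> range n" by blast
        then show ?thesis by (simp add: e_def)
      qed
      have "(\<Sum>i<?J'. e i * c ?N i) = (\<Sum>i\<in>insert ?N {..<?J}. e i * c ?N i)"
      proof (rule sum.mono_neutral_right)
        show "insert ?N {..<?J} \<subseteq> {..<?J'}"
          using sel(1)[of m] sel(2)[of m] by auto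
        show "\<forall>i\<in>{..<?J'} - insert ?N {..<?J}. e i * c ?N i = 0"
          using z by auto
      qed simp
      also have "\<dots> = (\<Sum>i<?J. e i * c ?N i) + c ?N ?N"
        using sel(1)[of m] by (subst sum.insert) (auto simp: e_def)
      finally show ?thesis .
    qed
    finally have eq: "(\<Sum>i. e i * c ?N i) =
        (\<Sum>i. e (i + ?J') * c ?N (i + ?J')) + ((\<Sum>i<?J. e i * c ?N i) + c ?N ?N)" .
    have le: "\<bar>e i * c ?N i\<bar> \<le> \<bar>c ?N i\<bar>" for i
      using e1 by (auto simp: abs_mult intro!: mult_left_le_one_le)
    have "\<bar>\<Sum>i. e (i + ?J') * c ?N (i + ?J')\<bar> \<le> (\<Sum>i. \<bar>e (i + ?J') * c ?N (i + ?J')\<bar>)"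
      by (rule summable_rabs[OF s2])
    also have "\<dots> \<le> (\<Sum>i. \<bar>c ?N (i + ?J')\<bar>)"
      by (rule suminf_le[OF le s2 summable_ignore_initial_segment[OF sm]])
    also have "\<dots> \<le> d/4" using sel(3)[of m] by (simp add: R_def)
    finally have 1: "\<bar>\<Sum>i. e (i + ?J') * c ?N (i + ?J')\<bar> \<le> d/4" .
    have "\<bar>\<Sum>i<?J. e i * c ?N i\<bar> \<le> (\<Sum>i<?J. \<bar>c ?N i\<bar>)"
      by (rule order_trans[OF sum_abs sum_mono[OF le]])
    also have "\<dots> \<le> d/4" using sel(3)[of m] by (simp add: R_def)
    finally have 2: "\<bar>\<Sum>i<?J. e i * c ?N i\<bar> \<le> d/4" .
    have "d \<le> \<bar>c ?N ?N\<bar>" using sel(3)[of m] by (simp add: R_def)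
    then show ?thesis using 1 2 unfolding eq by linarith
  qed
  have "(\<lambda>m. \<Sum>i. e i * c (n m) i) \<longlonglongrightarrow> 0"
    using LIMSEQ_subseq_LIMSEQ[OF lim[of e, OF e1] sel(4)] by (simp add: o_def)
  then have "eventually (\<lambda>m. \<bar>\<Sum>i. e i * c (n m) i\<bar> < d/2) sequentially"
    using d by (intro order_tendstoD(2)[OF tendsto_rabs_zero]) auto
  then obtain m where "\<bar>\<Sum>i. e i * c (n m) i\<bar> < d/2"
    using eventually_happens'[OF sequentially_bot] by blast
  then show False using big[of m] by linarith
qed

lemma weakly_null_subseq:
  assumes "weakly_null X N x" "strict_mono r"
  shows "weakly_null X N (\<lambda>n. x (r n))"
  unfolding weakly_null_def
proof (intro conjI allI impI)
  show "x (r n) \<in> X" for n using assms(1) by (simp add: weakly_null_def)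
  fix L assume "bounded_lin_fun X N L"
  then have "(\<lambda>n. L (x n)) \<longlonglongrightarrow> 0" using assms(1) by (simp add: weakly_null_def)
  from LIMSEQ_subseq_LIMSEQ[OF this assms(2)] show "(\<lambda>n. L (x (r n))) \<longlonglongrightarrow> 0"
    by (simp add: o_def)
qed

text \<open>Absolute summability makes the sum of \<open>e i * \<psi> i f\<close> a bounded
  functional for every \<open>e\<close> with values in [-1, 1]; testing \<open>x\<close> on all of
  these is what Schur's argument asks of the matrix \<open>\<psi> i (x n)\<close>. It is applied
  both with the space and with its dual as \<open>X\<close>.\<close>

lemma weakly_null_diagonal:
  fixes X :: "('a \<Rightarrow> real) set"
  assumes x: "weakly_null X N x"
    and add: "\<And>i f g. f \<in> X \<Longrightarrow> g \<in> X \<Longrightarrow> \<psi> i (\<lambda>t. f t + g t) = \<psi> i f + \<psi> i g"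
    and scale: "\<And>i c f. f \<in> X \<Longrightarrow> \<psi> i (\<lambda>t. c * f t) = c * \<psi> i f"
    and bd: "\<And>m f. f \<in> X \<Longrightarrow> (\<Sum>i<m. \<bar>\<psi> i f\<bar>) \<le> K * N f"
  shows "(\<lambda>n. \<psi> n (x n)) \<longlonglongrightarrow> 0"
proof (rule schur_diagonal[of "\<lambda>n i. \<psi> i (x n)"])
  have sm: "summable (\<lambda>i. \<bar>\<psi> i f\<bar>)" if "f \<in> X" for f
    by (rule summableI_nonneg_bounded[where x = "K * N f"]) (simp_all add: bd[OF that])
  have xX: "x n \<in> X" for n using x by (auto simp: weakly_null_def)
  show "summable (\<lambda>i. \<bar>\<psi> i (x n)\<bar>)" for n by (rule sm[OF xX])
  fix e :: "nat \<Rightarrow> real" assume e: "\<And>i. \<bar>e i\<bar> \<le> 1"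
  have le: "\<bar>e i * \<psi> i f\<bar> \<le> \<bar>\<psi> i f\<bar>" for i f
    using e by (auto simp: abs_mult intro!: mult_left_le_one_le)
  have sme: "summable (\<lambda>i. \<bar>e i * \<psi> i f\<bar>)" if "f \<in> X" for f
    by (rule summable_comparison_test[OF _ sm[OF that]]) (use le in auto)
  note sme' = summable_rabs_cancel[OF sme]
  have "bounded_lin_fun X N (\<lambda>f. \<Sum>i. e i * \<psi> i f)"
    unfolding bounded_lin_fun_def
  proof (intro conjI ballI allI)
    fix f g assume fg: "f \<in> X" "g \<in> X"
    then show "(\<Sum>i. e i * \<psi> i (\<lambda>x. f x + g x)) = (\<Sum>i. e i * \<psi> i f) + (\<Sum>i. e i * \<psi> i g)"
      by (subst suminf_add[OF sme' sme']) (auto simp: add algebra_simps)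
  next
    fix c f assume f: "f \<in> X"
    then show "(\<Sum>i. e i * \<psi> i (\<lambda>x. c * f x)) = c * (\<Sum>i. e i * \<psi> i f)"
      by (subst suminf_mult[symmetric, OF sme']) (auto simp: scale algebra_simps)
  next
    show "\<exists>C. \<forall>f\<in>X. \<bar>\<Sum>i. e i * \<psi> i f\<bar> \<le> C * N f"
    proof (intro exI ballI)
      fix f assume f: "f \<in> X"
      have "\<bar>\<Sum>i. e i * \<psi> i f\<bar> \<le> (\<Sum>i. \<bar>e i * \<psi> i f\<bar>)"
        by (rule summable_rabs[OF sme[OF f]])
      also have "\<dots> \<le> (\<Sum>i. \<bar>\<psi> i f\<bar>)"
        by (rule suminf_le[OF le sme[OF f] sm[OF f]])
      also have "\<dots> \<le> K * N f"
        by (rule suminf_le_const[OF sm[OF f] bd[OF f]])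
      finally show "\<bar>\<Sum>i. e i * \<psi> i f\<bar> \<le> K * N f" .
    qed
  qed
  then show "(\<lambda>n. \<Sum>i. e i * \<psi> i (x n)) \<longlonglongrightarrow> 0"
    using x by (auto simp: weakly_null_def)
qed

text \<open>A gliding-hump form of the uniform boundedness principle; norming functionals are a
  hypothesis because each application can write them down. If the terms grow like
  \<open>4 ^ i\<close>, the functionals damped by \<open>(1/2) ^ Suc i\<close> are absolutely
  summable, yet their diagonal values stay away from 0.\<close>

lemma weakly_null_bounded:
  fixes X :: "('a \<Rightarrow> real) set"
  assumes x: "weakly_null X N x"
    and norming: "\<And>n. \<exists>\<psi>. (\<forall>f\<in>X. \<forall>g\<in>X. \<psi> (\<lambda>t. f t + g t) = \<psi> f + \<psi> g) \<and>
      (\<forall>c. \<forall>f\<in>X. \<psi> (\<lambda>t. c * f t) = c * \<psi> f) \<and>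
      (\<forall>f\<in>X. \<bar>\<psi> f\<bar> \<le> N f) \<and> N (x n) \<le> 2 * \<bar>\<psi> (x n)\<bar>"
  obtains B where "\<And>n. N (x n) \<le> B"
proof -
  define good where "good n \<psi> \<longleftrightarrow> (\<forall>f\<in>X. \<forall>g\<in>X. \<psi> (\<lambda>t. f t + g t) = \<psi> f + \<psi> g) \<and>
      (\<forall>c. \<forall>f\<in>X. \<psi> (\<lambda>t. c * f t) = c * \<psi> f) \<and>
      (\<forall>f\<in>X. \<bar>\<psi> f\<bar> \<le> N f) \<and> N (x n) \<le> 2 * \<bar>\<psi> (x n)\<bar>" for n and \<psi> :: "('a \<Rightarrow> real) \<Rightarrow> real"
  obtain \<psi> where good: "\<And>n. good n (\<psi> n)"
    using norming unfolding good_def[symmetric] by metis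
  have \<psi>: "\<And>n f g. f \<in> X \<Longrightarrow> g \<in> X \<Longrightarrow> \<psi> n (\<lambda>t. f t + g t) = \<psi> n f + \<psi> n g"
     "\<And>n c f. f \<in> X \<Longrightarrow> \<psi> n (\<lambda>t. c * f t) = c * \<psi> n f"
     "\<And>n f. f \<in> X \<Longrightarrow> \<bar>\<psi> n f\<bar> \<le> N f"
     "\<And>n. N (x n) \<le> 2 * \<bar>\<psi> n (x n)\<bar>"
    using good unfolding good_def by simp_all
  have "\<exists>B. \<forall>n. N (x n) \<le> B"
  proof (rule ccontr)
    assume unb: "\<not> (\<exists>B. \<forall>n. N (x n) \<le> B)"
    \<comment> \<open>The growth is tied to the window start because the selection carries no
      counter; strict monotonicity of \<open>J\<close> later turns it into
      \<open>4 ^ i\<close>.\<close>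
    have "\<exists>n\<ge>J. 4 ^ J \<le> N (x n)" for J
    proof (rule ccontr)
      assume *: "\<not> (\<exists>n\<ge>J. 4 ^ J \<le> N (x n))"
      have "N (x n) \<le> max (Max ((\<lambda>n. N (x n)) ` {..J})) (4 ^ J)" for n
      proof (cases "n \<le> J")
        case True
        then have "N (x n) \<le> Max ((\<lambda>n. N (x n)) ` {..J})" by (intro Max_ge) auto
        then show ?thesis by (rule max.coboundedI1)
      next
        case False
        then have "\<not> 4 ^ J \<le> N (x n)" using * by auto
        then have "N (x n) \<le> 4 ^ J" by linarith
        then show ?thesis by (rule max.coboundedI2)
      qed
      then show False using unb by blast
    qed
    then have "\<exists>n\<ge>J. \<exists>J'>n. 4 ^ J \<le> N (x n)" for J by blast
    then obtain J n where sel0: "\<And>i. J i \<le> n i" "\<And>i. n i < J (Suc i)" "\<And>i. 4 ^ J i \<le> N (x (n i))"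
      "strict_mono n" "strict_mono J"
      by (rule increasing_selection[where R = "\<lambda>J n J'. 4 ^ J \<le> N (x n)"]) (rule that, assumption+)
    note sel = sel0(3-5)
    have "(\<lambda>i. (1/2) ^ Suc i * \<psi> (n i) (x (n i))) \<longlonglongrightarrow> 0"
    proof (rule weakly_null_diagonal[OF weakly_null_subseq[OF x sel(2)], where K = 1])
      fix m f assume f: "f \<in> X"
      have N0: "0 \<le> N f" using \<psi>(3)[OF f, of 0] by linarith
      have "(\<Sum>i<m. \<bar>(1/2) ^ Suc i * \<psi> (n i) f\<bar>) \<le> (\<Sum>i<m. (1/2) ^ Suc i * N f)"
        by (intro sum_mono) (auto simp: abs_mult \<psi>(3)[OF f])
      also have "\<dots> = (\<Sum>i<m. (1/2) ^ Suc i) * N f" by (rule sum_distrib_right[symmetric])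
      also have "(\<Sum>i<m. (1/2::real) ^ Suc i) = 1 - (1/2) ^ m"
        by (induction m) (auto simp: field_simps)
      finally show "(\<Sum>i<m. \<bar>(1/2) ^ Suc i * \<psi> (n i) f\<bar>) \<le> 1 * N f"
        using N0 mult_right_mono[of "1 - (1/2) ^ m" 1 "N f"] by simp
    qed (simp_all add: \<psi>(1,2) distrib_left)
    then have "eventually (\<lambda>i. \<bar>(1/2) ^ Suc i * \<psi> (n i) (x (n i))\<bar> < 1/4) sequentially"
      by (intro order_tendstoD(2)[OF tendsto_rabs_zero]) auto
    then obtain i where i: "\<bar>(1/2) ^ Suc i * \<psi> (n i) (x (n i))\<bar> < 1/4"
      by (auto simp: eventually_sequentially)
    have "(4::real) ^ i \<le> 4 ^ J i"
      using sel(3) by (intro power_increasing) (auto simp: strict_mono_imp_increasing)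
    also have "\<dots> \<le> 2 * \<bar>\<psi> (n i) (x (n i))\<bar>" using sel(1) \<psi>(4) by (rule order_trans)
    finally have "4 ^ i \<le> 2 * \<bar>\<psi> (n i) (x (n i))\<bar>" .
    then have le: "(1/2) ^ Suc i * (4::real) ^ i \<le> (1/2) ^ Suc i * (2 * \<bar>\<psi> (n i) (x (n i))\<bar>)"
      by (intro mult_left_mono) auto
    have "2 ^ i / 2 = (1/2::real) ^ Suc i * (4::real) ^ i" by (induction i) auto
    also note le
    also have "(1/2) ^ Suc i * (2 * \<bar>\<psi> (n i) (x (n i))\<bar>) = 2 * \<bar>(1/2) ^ Suc i * \<psi> (n i) (x (n i))\<bar>"
      by (simp add: abs_mult)
    finally have "2 ^ i / 2 \<le> 2 * \<bar>(1/2) ^ Suc i * \<psi> (n i) (x (n i))\<bar>" .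
    moreover have "(1::real) \<le> 2 ^ i" by simp
    ultimately show False using i by linarith
  qed
  then show ?thesis using that by blast
qed

section \<open>Hahn--Banach extension\<close>

text \<open>The partial functional is given as a graph, so it may be specified through coefficients
  without checking that they are determined by the function: domination by \<open>p\<close> already
  makes every admissible graph single-valued. Zorn's lemma is applied to graphs under
  inclusion.\<close>

lemma hahn_banach_graph:
  fixes E :: "('b \<Rightarrow> real) set" and p :: "('b \<Rightarrow> real) \<Rightarrow> real" and G0 :: "(('b \<Rightarrow> real) \<times> real) set"
  assumes E: "\<And>a b f g. f \<in> E \<Longrightarrow> g \<in> E \<Longrightarrow> (\<lambda>x. a * f x + b * g x) \<in> E"
    and p_add: "\<And>f g. f \<in> E \<Longrightarrow> g \<in> E \<Longrightarrow> p (\<lambda>x. f x + g x) \<le> p f + p g"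
    and p_scale: "\<And>c f. 0 \<le> c \<Longrightarrow> f \<in> E \<Longrightarrow> p (\<lambda>x. c * f x) = c * p f"
    and G0: "G0 \<noteq> {}" "\<And>f \<alpha>. (f, \<alpha>) \<in> G0 \<Longrightarrow> f \<in> E \<and> \<alpha> \<le> p f"
      "\<And>a b f g \<alpha> \<beta>. (f, \<alpha>) \<in> G0 \<Longrightarrow> (g, \<beta>) \<in> G0 \<Longrightarrow> (\<lambda>x. a * f x + b * g x, a * \<alpha> + b * \<beta>) \<in> G0"
  obtains \<Phi> where "\<And>a b f g. f \<in> E \<Longrightarrow> g \<in> E \<Longrightarrow> \<Phi> (\<lambda>x. a * f x + b * g x) = a * \<Phi> f + b * \<Phi> g"
    "\<And>f. f \<in> E \<Longrightarrow> \<Phi> f \<le> p f" "\<And>f \<alpha>. (f, \<alpha>) \<in> G0 \<Longrightarrow> \<Phi> f = \<alpha>"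
proof -
  define lin where "lin G \<longleftrightarrow> (\<forall>a b f g \<alpha> \<beta>. (f, \<alpha>) \<in> G \<longrightarrow> (g, \<beta>) \<in> G \<longrightarrow>
      (\<lambda>x. a * f x + b * g x, a * \<alpha> + b * \<beta>) \<in> G)" for G :: "(('b \<Rightarrow> real) \<times> real) set"
  define \<A> where "\<A> = {G. G0 \<subseteq> G \<and> lin G \<and> (\<forall>f \<alpha>. (f, \<alpha>) \<in> G \<longrightarrow> f \<in> E \<and> \<alpha> \<le> p f)}"
  have linD: "lin G \<Longrightarrow> (f, \<alpha>) \<in> G \<Longrightarrow> (g, \<beta>) \<in> G \<Longrightarrow>
      (\<lambda>x. a * f x + b * g x, a * \<alpha> + b * \<beta>) \<in> G" for G a b f g \<alpha> \<beta>
    unfolding lin_def by blast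
  have "\<exists>G\<in>\<A>. \<forall>H\<in>\<A>. G \<subseteq> H \<longrightarrow> H = G"
  proof (rule subset_Zorn_nonempty)
    have "lin G0" unfolding lin_def using G0(3) by blast
    then have "G0 \<in> \<A>" unfolding \<A>_def using G0(2) by blast
    then show "\<A> \<noteq> {}" by blast
    fix C assume C: "C \<noteq> {}" "subset.chain \<A> C"
    have CA: "H \<in> \<A>" if "H \<in> C" for H using C(2) that by (auto simp: subset_chain_def)
    have "lin (\<Union>C)"
      unfolding lin_def
    proof (intro allI impI)
      fix a b f g \<alpha> \<beta> assume "(f, \<alpha>) \<in> \<Union>C" "(g, \<beta>) \<in> \<Union>C"
      then obtain H1 H2 where H: "H1 \<in> C" "H2 \<in> C" "(f, \<alpha>) \<in> H1" "(g, \<beta>) \<in> H2" by blast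
      have "H1 \<subseteq> H2 \<or> H2 \<subseteq> H1" using C(2) H(1,2) by (auto simp: subset_chain_def)
      then obtain H where "H \<in> C" "(f, \<alpha>) \<in> H" "(g, \<beta>) \<in> H" using H by blast
      then show "(\<lambda>x. a * f x + b * g x, a * \<alpha> + b * \<beta>) \<in> \<Union>C"
        using CA[of H] by (intro UnionI[of H] linD) (auto simp: \<A>_def)
    qed
    moreover have "G0 \<subseteq> \<Union>C"
    proof -
      obtain H where "H \<in> C" using C(1) by blast
      then have "G0 \<subseteq> H" using CA[of H] by (simp add: \<A>_def)
      then show ?thesis using \<open>H \<in> C\<close> by blast
    qed
    moreover have "f \<in> E \<and> \<alpha> \<le> p f" if "(f, \<alpha>) \<in> \<Union>C" for f \<alpha>
    proof -
      obtain H where "H \<in> C" "(f, \<alpha>) \<in> H" using \<open>(f, \<alpha>) \<in> \<Union>C\<close> by blast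
      then show ?thesis using CA[of H] by (simp add: \<A>_def)
    qed
    ultimately show "\<Union>C \<in> \<A>" unfolding \<A>_def by blast
  qed
  then obtain G where GA: "G \<in> \<A>" and max: "\<And>H. H \<in> \<A> \<Longrightarrow> G \<subseteq> H \<Longrightarrow> H = G" by blast
  have G: "G0 \<subseteq> G" "lin G" "\<And>f \<alpha>. (f, \<alpha>) \<in> G \<Longrightarrow> f \<in> E" "\<And>f \<alpha>. (f, \<alpha>) \<in> G \<Longrightarrow> \<alpha> \<le> p f"
    using GA unfolding \<A>_def by blast+
  obtain f1 \<alpha>1 where f1: "(f1, \<alpha>1) \<in> G" using G(1) G0(1) by auto
  have zero: "((\<lambda>x. 0), 0) \<in> G" using linD[OF G(2) f1 f1, of 0 0] by simp
  have p0: "p (\<lambda>x. 0) = 0" using p_scale[of 0 "\<lambda>x. 0"] G(3)[OF zero] by simp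
  \<comment> \<open>The difference of two values at \<open>f\<close> is a value at 0, and so is its
    negative; both are at most \<open>p\<close> of 0, which is 0.\<close>
  have unique: "\<alpha> = \<beta>" if "(f, \<alpha>) \<in> G" "(f, \<beta>) \<in> G" for f \<alpha> \<beta>
    using G(4)[OF linD[OF G(2) that, of 1 "-1"]] G(4)[OF linD[OF G(2) that, of "-1" 1]]
    by (simp add: p0)
  have dom: "\<exists>\<alpha>. (f0, \<alpha>) \<in> G" if f0: "f0 \<in> E" for f0
  proof (rule ccontr)
    assume no: "\<nexists>\<alpha>. (f0, \<alpha>) \<in> G"
    \<comment> \<open>These inequalities leave room for a value at \<open>f0\<close>; the supremum
      \<open>c\<close> of the left sides is taken.\<close>
    have sep: "\<alpha> - p (\<lambda>x. f x - f0 x) \<le> p (\<lambda>x. g x + f0 x) - \<beta>"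
      if fg: "(f, \<alpha>) \<in> G" "(g, \<beta>) \<in> G" for f g \<alpha> \<beta>
    proof -
      have "\<alpha> + \<beta> \<le> p (\<lambda>x. f x + g x)" using G(4)[OF linD[OF G(2) fg, of 1 1]] by simp
      also have "\<dots> = p (\<lambda>x. (f x - f0 x) + (g x + f0 x))" by (simp add: algebra_simps)
      also have "\<dots> \<le> p (\<lambda>x. f x - f0 x) + p (\<lambda>x. g x + f0 x)"
        using E[OF G(3)[OF fg(1)] f0, of 1 "-1"] E[OF G(3)[OF fg(2)] f0, of 1 1]
        by (intro p_add) auto
      finally show ?thesis by linarith
    qed
    define S where "S = {\<alpha> - p (\<lambda>x. f x - f0 x) |f \<alpha>. (f, \<alpha>) \<in> G}"
    define c where "c = Sup S"
    have bdd: "bdd_above S"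
      by (rule bdd_aboveI[where M = "p (\<lambda>x. f1 x + f0 x) - \<alpha>1"])
         (use sep[OF _ f1] in \<open>auto simp: S_def\<close>)
    have c1: "\<alpha> - p (\<lambda>x. f x - f0 x) \<le> c" if "(f, \<alpha>) \<in> G" for f \<alpha>
      unfolding c_def by (rule cSup_upper[OF _ bdd]) (use that in \<open>auto simp: S_def\<close>)
    have c2: "c \<le> p (\<lambda>x. f x + f0 x) - \<alpha>" if "(f, \<alpha>) \<in> G" for f \<alpha>
      unfolding c_def by (rule cSup_least) (use f1 sep[OF _ that] in \<open>auto simp: S_def\<close>)
    define H where "H = {(\<lambda>x. f x + t * f0 x, \<alpha> + t * c) |f \<alpha> t. (f, \<alpha>) \<in> G}"
    have "G \<subseteq> H"
    proof
      fix y assume "y \<in> G"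
      moreover obtain f \<alpha> where "y = (f, \<alpha>)" by fastforce
      ultimately show "y \<in> H" unfolding H_def
        by (intro CollectI exI[of _ f] exI[of _ \<alpha>] exI[of _ 0]) simp
    qed
    have H_E: "f \<in> E" "\<alpha> \<le> p f" if "(f, \<alpha>) \<in> H" for f \<alpha>
    proof -
      obtain g \<beta> t where g: "(g, \<beta>) \<in> G" and f: "f = (\<lambda>x. g x + t * f0 x)" and \<alpha>: "\<alpha> = \<beta> + t * c"
        using \<open>(f, \<alpha>) \<in> H\<close> unfolding H_def by blast
      show "f \<in> E" using E[OF G(3)[OF g] f0, of 1 t] by (simp add: f)
      have sc: "((\<lambda>x. u * g x), u * \<beta>) \<in> G" for u using linD[OF G(2) g g, of u 0] by simp
      \<comment> \<open>Dividing by the absolute value of \<open>t\<close> reduces to the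
        coefficient 1 or -1 of \<open>f0\<close>, where the two bounds on \<open>c\<close>
        apply.\<close>
      consider "t = 0" | "t > 0" | "t < 0" by linarith
      then show "\<alpha> \<le> p f"
      proof cases
        case 1
        then show ?thesis using G(4)[OF g] by (simp add: f \<alpha>)
      next
        case 2
        let ?h = "\<lambda>x. inverse t * g x + f0 x"
        have hE: "?h \<in> E" using E[OF G(3)[OF g] f0, of "inverse t" 1] by simp
        have eq: "(\<lambda>x. t * ?h x) = f" using 2 by (auto simp: f field_simps)
        have "t * c \<le> t * (p ?h - inverse t * \<beta>)" using 2 by (intro mult_left_mono c2 sc) auto
        also have "\<dots> = p (\<lambda>x. t * ?h x) - \<beta>" using 2 p_scale[OF _ hE, of t] by (simp add: field_simps)
        finally show ?thesis unfolding eq by (simp add: \<alpha>)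
      next
        case 3
        let ?h = "\<lambda>x. inverse (-t) * g x - f0 x"
        have hE: "?h \<in> E" using E[OF G(3)[OF g] f0, of "inverse (-t)" "-1"] by simp
        have eq: "(\<lambda>x. (-t) * ?h x) = f" using 3 by (auto simp: f field_simps)
        have "(-t) * (inverse (-t) * \<beta> - p ?h) \<le> (-t) * c" using 3 by (intro mult_left_mono c1 sc) auto
        moreover have "(-t) * (inverse (-t) * \<beta> - p ?h) = \<beta> - p (\<lambda>x. (-t) * ?h x)"
          using 3 p_scale[OF _ hE, of "-t"] by (simp add: right_diff_distrib)
        ultimately show ?thesis unfolding eq by (simp add: \<alpha>)
      qed
    qed
    have "lin H"
      unfolding lin_def
    proof (intro allI impI)
      fix a b f g \<alpha> \<beta> assume "(f, \<alpha>) \<in> H" "(g, \<beta>) \<in> H"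
      then obtain f' \<alpha>' t g' \<beta>' u where *: "(f', \<alpha>') \<in> G" "(g', \<beta>') \<in> G"
        "f = (\<lambda>x. f' x + t * f0 x)" "\<alpha> = \<alpha>' + t * c" "g = (\<lambda>x. g' x + u * f0 x)" "\<beta> = \<beta>' + u * c"
        unfolding H_def by blast
      show "(\<lambda>x. a * f x + b * g x, a * \<alpha> + b * \<beta>) \<in> H"
        unfolding H_def using linD[OF G(2) *(1,2), of a b]
        by (intro CollectI exI[of _ "\<lambda>x. a * f' x + b * g' x"] exI[of _ "a * \<alpha>' + b * \<beta>'"]
              exI[of _ "a * t + b * u"]) (auto simp: * algebra_simps)
    qed
    then have "H \<in> \<A>" unfolding \<A>_def using H_E G(1) \<open>G \<subseteq> H\<close> by blast
    then have "H = G" using max \<open>G \<subseteq> H\<close> by blast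
    moreover have "(f0, c) \<in> H"
      unfolding H_def using zero by (intro CollectI exI[of _ "\<lambda>x. 0"] exI[of _ 0] exI[of _ 1]) auto
    ultimately show False using no by blast
  qed
  define \<Phi> where "\<Phi> f = (THE \<alpha>. (f, \<alpha>) \<in> G)" for f
  have \<Phi>_eq: "\<Phi> f = \<alpha>" if "(f, \<alpha>) \<in> G" for f \<alpha>
    unfolding \<Phi>_def using that unique by blast
  have \<Phi>_in: "(f, \<Phi> f) \<in> G" if "f \<in> E" for f
    using dom[OF that] \<Phi>_eq by auto
  show thesis
  proof (rule that[of \<Phi>])
    fix a b f g assume "f \<in> E" "g \<in> E"
    then show "\<Phi> (\<lambda>x. a * f x + b * g x) = a * \<Phi> f + b * \<Phi> g"
      by (intro \<Phi>_eq linD[OF G(2)] \<Phi>_in)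
  next
    show "\<Phi> f \<le> p f" if "f \<in> E" for f using G(4)[OF \<Phi>_in[OF that]] .
    show "\<Phi> f = \<alpha>" if "(f, \<alpha>) \<in> G0" for f \<alpha> using that G(1) \<Phi>_eq by blast
  qed
qed

section \<open>Functionals on an integrable function space over a finite measure\<close>

text \<open>Where \<open>h\<close> exceeds \<open>C\<close>, the integral of \<open>h - C\<close> is
  at most 0 by hypothesis while the integrand is positive, so that set is null; this is used for
  \<open>g\<close> and for \<open>- g\<close>.\<close>

lemma (in finite_measure) AE_abs_le_of_set_integral_le:
  fixes g :: "'a \<Rightarrow> real"
  assumes g: "integrable M g"
    and le: "\<And>A. A \<in> sets M \<Longrightarrow> \<bar>\<integral>x. indicator A x * g x \<partial>M\<bar> \<le> C * measure M A"
  shows "AE x in M. \<bar>g x\<bar> \<le> C"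
proof -
  have one: "AE x in M. h x \<le> C" if h: "integrable M h"
    and le: "\<And>A. A \<in> sets M \<Longrightarrow> (\<integral>x. indicator A x * h x \<partial>M) \<le> C * measure M A" for h :: "'a \<Rightarrow> real"
  proof -
    define A where "A = {x \<in> space M. C < h x}"
    have [measurable]: "h \<in> borel_measurable M" using h by auto
    have A[measurable]: "A \<in> sets M" unfolding A_def by measurable
    have i1: "integrable M (\<lambda>x. indicator A x * h x)"
      using integrable_mult_indicator[OF A h] by simp
    have i2: "integrable M (\<lambda>x. C * indicator A x)"
      by (intro integrable_mult_right) (simp add: integrable_indicator_iff fmeasurable_eq_sets emeasure_eq_measure)
    have "(\<integral>x. indicator A x * (h x - C) \<partial>M) = (\<integral>x. indicator A x * h x - C * indicator A x \<partial>M)"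
      by (intro Bochner_Integration.integral_cong) (auto simp: algebra_simps)
    also have "\<dots> = (\<integral>x. indicator A x * h x \<partial>M) - (\<integral>x. C * indicator A x \<partial>M)"
      by (rule Bochner_Integration.integral_diff[OF i1 i2])
    also have "(\<integral>x. C * indicator A x \<partial>M) = C * measure M A" by simp
    finally have "(\<integral>x. indicator A x * (h x - C) \<partial>M) \<le> 0" using le[OF A] by simp
    moreover have nn: "0 \<le> indicator A x * (h x - C)" for x by (auto simp: A_def indicator_def)
    ultimately have "(\<integral>x. indicator A x * (h x - C) \<partial>M) = 0"
      by (intro antisym integral_nonneg_AE) auto
    moreover have "integrable M (\<lambda>x. indicator A x * (h x - C))"
      using Bochner_Integration.integrable_diff[OF i1 i2] by (simp add: algebra_simps)
    ultimately have "AE x in M. indicator A x * (h x - C) = 0"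
      using nn by (subst (asm) integral_nonneg_eq_0_iff_AE) auto
    with AE_space show ?thesis
    proof eventually_elim
      case (elim x)
      then show ?case by (cases "x \<in> A") (auto simp: A_def not_less)
    qed
  qed
  have "AE x in M. g x \<le> C" by (rule one[OF g]) (use le in \<open>force simp: abs_le_iff\<close>)
  moreover have "AE x in M. - g x \<le> C"
    by (rule one) (use g le in \<open>force simp: abs_le_iff\<close>)+
  ultimately show ?thesis by eventually_elim auto
qed


text \<open>The duality of L1 and L-infinity, obtained from Radon-Nikodym. The bound on
  \<open>g\<close> holds at every point, so later estimates with the density carry no exceptional
  set.\<close>

lemma (in finite_measure) L1_functional_density:
  fixes \<Lambda> :: "('a \<Rightarrow> real) \<Rightarrow> real"
  assumes add: "\<And>f g. integrable M f \<Longrightarrow> integrable M g \<Longrightarrow> \<Lambda> (\<lambda>x. f x + g x) = \<Lambda> f + \<Lambda> g"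
    and scale: "\<And>c f. integrable M f \<Longrightarrow> \<Lambda> (\<lambda>x. c * f x) = c * \<Lambda> f"
    and bd: "\<And>f. integrable M f \<Longrightarrow> \<bar>\<Lambda> f\<bar> \<le> C * (\<integral>x. \<bar>f x\<bar> \<partial>M)"
    and C: "0 \<le> C"
  obtains g where "g \<in> borel_measurable M" "\<And>x. \<bar>g x\<bar> \<le> C"
    "\<And>f. integrable M f \<Longrightarrow> \<Lambda> f = (\<integral>x. f x * g x \<partial>M)"
proof -
  have ind: "integrable M (indicator A :: 'a \<Rightarrow> real)" if "A \<in> sets M" for A
    using that by (simp add: integrable_indicator_iff fmeasurable_eq_sets emeasure_eq_measure)
  have \<Lambda>_ind: "\<bar>\<Lambda> (indicator A)\<bar> \<le> C * measure M A" if "A \<in> sets M" for A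
    using bd[OF ind[OF that]] that by simp
  \<comment> \<open>Adding \<open>C\<close> times the measure makes the set function positive, so that no Hahn decomposition is needed.\<close>
  define \<nu> where "\<nu> A = \<Lambda> (indicator A) + C * measure M A" for A
  have \<nu>0: "0 \<le> \<nu> A" if "A \<in> sets M" for A using \<Lambda>_ind[OF that] by (auto simp: \<nu>_def)
  have \<nu>2: "\<nu> A \<le> 2 * C * measure M A" if "A \<in> sets M" for A
    using \<Lambda>_ind[OF that] by (auto simp: \<nu>_def)
  have pos: "positive (sets M) (\<lambda>A. ennreal (\<nu> A))"
    using \<nu>2[of "{}"] by (auto simp: positive_def ennreal_neg)
  have addi: "additive (sets M) (\<lambda>A. ennreal (\<nu> A))"
    unfolding additive_def
  proof (intro ballI impI)
    fix A B assume AB: "A \<in> sets M" "B \<in> sets M" "A \<inter> B = {}"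
    have "(indicator (A \<union> B) :: 'a \<Rightarrow> real) = (\<lambda>x. indicator A x + indicator B x)"
      using AB(3) by (auto simp: indicator_def fun_eq_iff)
    then have "\<nu> (A \<union> B) = \<nu> A + \<nu> B"
      using AB add[OF ind ind, of A B] by (simp add: \<nu>_def finite_measure_Union algebra_simps)
    then show "ennreal (\<nu> (A \<union> B)) = ennreal (\<nu> A) + ennreal (\<nu> B)"
      using AB \<nu>0 by (simp add: ennreal_plus)
  qed
  have ca: "countably_additive (sets M) (\<lambda>A. ennreal (\<nu> A))"
  proof (rule sets.empty_continuous_imp_countably_additive[OF pos addi])
    fix A :: "nat \<Rightarrow> 'a set" assume A: "range A \<subseteq> sets M" "decseq A" "(\<Inter>i. A i) = {}"
    have "(\<lambda>i. measure M (A i)) \<longlonglongrightarrow> 0"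
      using finite_Lim_measure_decseq[OF A(1,2)] unfolding A(3) measure_empty .
    then have "(\<lambda>i. 2 * C * measure M (A i)) \<longlonglongrightarrow> 0" by (rule tendsto_mult_right_zero)
    moreover have "norm (\<nu> (A i)) \<le> 2 * C * measure M (A i)" for i
    proof -
      have "A i \<in> sets M" using A(1) by (rule range_subsetD)
      then show ?thesis using \<nu>0[of "A i"] \<nu>2[of "A i"] by simp
    qed
    ultimately have "(\<lambda>i. \<nu> (A i)) \<longlonglongrightarrow> 0"
      by - (rule Lim_null_comparison[OF always_eventually], auto)
    then show "(\<lambda>i. ennreal (\<nu> (A i))) \<longlonglongrightarrow> 0"
      using tendsto_ennrealI[of "\<lambda>i. \<nu> (A i)" 0] by (simp only: ennreal_0)
  qed simp
  define N where "N = measure_of (space M) (sets M) (\<lambda>A. ennreal (\<nu> A))"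
  have sN: "sets N = sets M" "space N = space M"
    unfolding N_def by (rule sets.sets_measure_of_eq, rule sets.space_measure_of_eq)
  have eN: "emeasure N A = ennreal (\<nu> A)" if "A \<in> sets M" for A
    unfolding N_def using sets.sigma_algebra_axioms pos ca that by (rule emeasure_measure_of_sigma)
  have "absolutely_continuous M N"
    unfolding absolutely_continuous_def
  proof
    fix A assume A: "A \<in> null_sets M"
    then have "A \<in> sets M" "measure M A = 0" by (auto simp: null_sets_def measure_def)
    then have "A \<in> sets M" "ennreal (\<nu> A) = 0" using \<nu>2[of A] by (simp_all add: ennreal_neg)
    then show "A \<in> null_sets N" by (simp add: null_sets_def sN eN)
  qed
  then obtain h where h[measurable]: "h \<in> borel_measurable M" and hN: "density M h = N"
    using Radon_Nikodym[OF _ sN(1)] by blast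
  have eh: "(\<integral>\<^sup>+x. h x * indicator A x \<partial>M) = ennreal (\<nu> A)" if "A \<in> sets M" for A
    using emeasure_density[OF h that] eN[OF that] hN by simp
  have "(\<integral>\<^sup>+x. h x \<partial>M) = (\<integral>\<^sup>+x. h x * indicator (space M) x \<partial>M)"
    by (intro nn_integral_cong) auto
  then have "(\<integral>\<^sup>+x. h x \<partial>M) < \<infinity>" using eh[of "space M"] by simp
  then have hfin: "AE x in M. h x \<noteq> \<infinity>" by (intro nn_integral_noteq_infinite) auto
  define r where "r x = enn2real (h x)" for x
  have [measurable]: "r \<in> borel_measurable M" unfolding r_def by measurable
  have hr: "AE x in M. h x = ennreal (r x)"
    using hfin by eventually_elim (auto simp: r_def top.not_eq_extremum)
  have r0: "0 \<le> r x" for x by (simp add: r_def)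
  have nr: "(\<integral>\<^sup>+x. ennreal (indicator A x * r x) \<partial>M) = ennreal (\<nu> A)" if "A \<in> sets M" for A
    unfolding eh[OF that, symmetric]
    by (intro nn_integral_cong_AE eventually_mono[OF hr]) (auto simp: indicator_def)
  have ir: "integrable M (\<lambda>x. indicator A x * r x)" and vr: "(\<integral>x. indicator A x * r x \<partial>M) = \<nu> A"
    if "A \<in> sets M" for A
  proof -
    have "(\<lambda>x. indicator A x * r x) \<in> borel_measurable M" using that by measurable
    then show "integrable M (\<lambda>x. indicator A x * r x)"
      using nr[OF that] r0 by (intro integrableI_nonneg) auto
    show "(\<integral>x. indicator A x * r x \<partial>M) = \<nu> A"
      using nr[OF that] \<nu>0[OF that] r0 that by (subst integral_eq_nn_integral) auto
  qed
  define g0 where "g0 x = r x - C" for x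
  have ri: "integrable M r"
    by (rule Bochner_Integration.integrable_cong[THEN iffD1, OF refl _ ir[of "space M"]]) auto
  have g0i: "integrable M g0" unfolding g0_def using ri by (intro Bochner_Integration.integrable_diff) auto
  have g0A: "(\<integral>x. indicator A x * g0 x \<partial>M) = \<Lambda> (indicator A)" if "A \<in> sets M" for A
  proof -
    have "(\<integral>x. indicator A x * g0 x \<partial>M) = (\<integral>x. indicator A x * r x - C * indicator A x \<partial>M)"
      by (intro Bochner_Integration.integral_cong) (auto simp: g0_def algebra_simps)
    also have "\<dots> = (\<integral>x. indicator A x * r x \<partial>M) - (\<integral>x. C * indicator A x \<partial>M)"
      using ind that by (intro Bochner_Integration.integral_diff ir) auto
    also have "\<dots> = \<Lambda> (indicator A)" using that by (simp add: vr \<nu>_def)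
    finally show ?thesis .
  qed
  have g0C: "AE x in M. \<bar>g0 x\<bar> \<le> C"
    by (rule AE_abs_le_of_set_integral_le[OF g0i]) (simp add: g0A \<Lambda>_ind)
  \<comment> \<open>Clipping changes \<open>g0\<close> only on a null set and turns the almost
    everywhere bound into a pointwise one.\<close>
  define g where "g x = max (- C) (min C (g0 x))" for x
  have g0m[measurable]: "g0 \<in> borel_measurable M" using g0i by auto
  have gm[measurable]: "g \<in> borel_measurable M" unfolding g_def by measurable
  have gC: "\<bar>g x\<bar> \<le> C" for x using C by (auto simp: g_def)
  have gg0: "AE x in M. g x = g0 x" using g0C by eventually_elim (auto simp: g_def)
  have fg: "integrable M (\<lambda>x. f x * g x)" if f: "integrable M f" for f
  proof (rule Bochner_Integration.integrable_bound[of M "\<lambda>x. C * f x"])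
    show "AE x in M. norm (f x * g x) \<le> norm (C * f x)"
      using mult_right_mono[OF gC, of "\<bar>f _\<bar>"] C by (intro AE_I2) (simp add: abs_mult mult.commute)
  qed (use f in auto)
  have rep: "\<Lambda> f = (\<integral>x. f x * g x \<partial>M)" if "integrable M f" for f
    using that
  proof (induction rule: integrable_induct)
    case (base A c)
    have "(\<integral>x. indicator A x * g x \<partial>M) = (\<integral>x. indicator A x * g0 x \<partial>M)"
      using base(1) by (intro integral_cong_AE borel_measurable_times borel_measurable_indicator gm g0m
          eventually_mono[OF gg0]) auto
    then have "\<Lambda> (indicator A) = (\<integral>x. indicator A x * g x \<partial>M)" using g0A[OF base(1)] by simp
    moreover have "(\<integral>x. indicator A x *\<^sub>R c * g x \<partial>M) = (\<integral>x. c * (indicator A x * g x) \<partial>M)"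
      by (intro Bochner_Integration.integral_cong) auto
    moreover have "\<Lambda> (\<lambda>x. indicator A x *\<^sub>R c) = c * \<Lambda> (indicator A)"
      using scale[OF ind[OF base(1)], of c] by (simp add: mult.commute)
    ultimately show ?case by simp
  next
    case (add f h)
    have "(\<integral>x. (f x + h x) * g x \<partial>M) = (\<integral>x. f x * g x \<partial>M) + (\<integral>x. h x * g x \<partial>M)"
      using fg add.hyps by (simp add: distrib_right)
    then show ?case using add.IH assms(1)[OF add.hyps(1,2)] by simp
  next
    case (lim f s)
    have fi: "integrable M f" by fact
    have si: "integrable M (s i)" for i by fact
    \<comment> \<open>Convergence in L1; both sides of the representation are Lipschitz for this
      distance with constant \<open>C\<close>. The factor 3 comes from
      \<open>\<bar>s i x\<bar> \<le> 2 * \<bar>f x\<bar>\<close>.\<close>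
    have to0: "(\<lambda>i. \<integral>x. \<bar>s i x - f x\<bar> \<partial>M) \<longlonglongrightarrow> (\<integral>x. 0 \<partial>M)"
    proof (rule integral_dominated_convergence[where w = "\<lambda>x. 3 * \<bar>f x\<bar>"])
      show "AE x in M. (\<lambda>i. \<bar>s i x - f x\<bar>) \<longlonglongrightarrow> 0"
      proof (rule AE_I2)
        fix x assume "x \<in> space M"
        then have "(\<lambda>i. s i x - f x) \<longlonglongrightarrow> 0" using lim.hyps(2) by (simp add: LIM_zero_iff)
        then show "(\<lambda>i. \<bar>s i x - f x\<bar>) \<longlonglongrightarrow> 0" by (rule tendsto_rabs_zero)
      qed
      show "AE x in M. norm \<bar>s i x - f x\<bar> \<le> 3 * \<bar>f x\<bar>" for i
      proof (rule AE_I2)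
        fix x assume "x \<in> space M"
        then have "\<bar>s i x\<bar> \<le> 2 * \<bar>f x\<bar>" using lim.hyps(3) by simp
        then show "norm \<bar>s i x - f x\<bar> \<le> 3 * \<bar>f x\<bar>" by simp
      qed
    qed (use fi si in auto)
    have D: "\<bar>\<Lambda> (s i) - \<Lambda> f\<bar> \<le> C * (\<integral>x. \<bar>s i x - f x\<bar> \<partial>M)" for i
    proof -
      have "\<Lambda> (\<lambda>x. s i x - f x) = \<Lambda> (s i) - \<Lambda> f"
        using assms(1)[OF si[of i], of "\<lambda>x. -1 * f x"] scale[OF fi, of "-1"] fi by simp
      then show ?thesis using bd[of "\<lambda>x. s i x - f x"] si fi by simp
    qed
    have D2: "\<bar>\<Lambda> (s i) - (\<integral>x. f x * g x \<partial>M)\<bar> \<le> C * (\<integral>x. \<bar>s i x - f x\<bar> \<partial>M)" for i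
    proof -
      have "\<Lambda> (s i) - (\<integral>x. f x * g x \<partial>M) = (\<integral>x. s i x * g x - f x * g x \<partial>M)"
        using fg[OF si[of i]] fg[OF fi] lim.IH[of i] by simp
      also have "\<bar>\<dots>\<bar> \<le> (\<integral>x. \<bar>s i x * g x - f x * g x\<bar> \<partial>M)" by (rule integral_abs_bound)
      also have "\<dots> \<le> (\<integral>x. C * \<bar>s i x - f x\<bar> \<partial>M)"
      proof (rule integral_mono)
        show "integrable M (\<lambda>x. \<bar>s i x * g x - f x * g x\<bar>)" using fg si fi by auto
        show "\<bar>s i x * g x - f x * g x\<bar> \<le> C * \<bar>s i x - f x\<bar>" for x
          using mult_right_mono[OF gC[of x], of "\<bar>s i x - f x\<bar>"]
          by (simp only: left_diff_distrib[symmetric] abs_mult mult.commute[of _ "\<bar>g x\<bar>"])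
      qed (use si fi in auto)
      also have "\<dots> = C * (\<integral>x. \<bar>s i x - f x\<bar> \<partial>M)" by simp
      finally show ?thesis .
    qed
    have z: "(\<lambda>i. C * (\<integral>x. \<bar>s i x - f x\<bar> \<partial>M)) \<longlonglongrightarrow> 0"
      using tendsto_mult_right_zero[of _ _ C] to0 by simp
    have "(\<lambda>i. \<Lambda> (s i) - \<Lambda> f) \<longlonglongrightarrow> 0"
      by (rule Lim_null_comparison[OF _ z]) (use D in auto)
    moreover have "(\<lambda>i. \<Lambda> (s i) - (\<integral>x. f x * g x \<partial>M)) \<longlonglongrightarrow> 0"
      by (rule Lim_null_comparison[OF _ z]) (use D2 in auto)
    ultimately show ?case by (intro LIMSEQ_unique[OF LIM_zero_cancel LIM_zero_cancel])
  qed
  show thesis by (rule that[OF gm gC rep])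
qed

section \<open>Duals of seminormed function spaces\<close>

locale function_seminorm =
  fixes X :: "('a \<Rightarrow> real) set" and N :: "('a \<Rightarrow> real) \<Rightarrow> real"
  assumes lin: "f \<in> X \<Longrightarrow> g \<in> X \<Longrightarrow> (\<lambda>x. a * f x + b * g x) \<in> X"
    and nonempty: "X \<noteq> {}"
    and nonneg: "f \<in> X \<Longrightarrow> 0 \<le> N f"
    and scale: "f \<in> X \<Longrightarrow> N (\<lambda>x. c * f x) = \<bar>c\<bar> * N f"
begin

abbreviation "E \<equiv> dual_sp X N"
abbreviation "D \<equiv> dual_norm X N"

lemma zero_mem: "(\<lambda>x. 0) \<in> X"
  using nonempty lin[of _ _ 0 0] by auto

lemma N_zero: "N (\<lambda>x. 0) = 0"
  using scale[OF zero_mem, of 0] by simp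

lemma scale_mem: "f \<in> X \<Longrightarrow> (\<lambda>x. c * f x) \<in> X"
  using lin[of f f c 0] by simp

lemma add_mem: "f \<in> X \<Longrightarrow> g \<in> X \<Longrightarrow> (\<lambda>x. f x + g x) \<in> X"
  using lin[of f g 1 1] by simp

lemma diff_mem: "f \<in> X \<Longrightarrow> g \<in> X \<Longrightarrow> (\<lambda>x. f x - g x) \<in> X"
  using lin[of f g 1 "-1"] by simp

lemma sum_mem: "(\<And>i. i < m \<Longrightarrow> z i \<in> X) \<Longrightarrow> (\<lambda>x. \<Sum>i<m. z i x) \<in> X" for m :: nat
  by (induction m) (auto simp: zero_mem add_mem)

lemma dual_add: "L \<in> E \<Longrightarrow> f \<in> X \<Longrightarrow> g \<in> X \<Longrightarrow> L (\<lambda>x. f x + g x) = L f + L g"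
  by (simp add: dual_sp_def bounded_lin_fun_def)

lemma dual_scale: "L \<in> E \<Longrightarrow> f \<in> X \<Longrightarrow> L (\<lambda>x. c * f x) = c * L f"
  by (simp add: dual_sp_def bounded_lin_fun_def)

lemma dual_zero: "L \<in> E \<Longrightarrow> L (\<lambda>x. 0) = 0"
  using dual_scale[OF _ zero_mem, of L 0] by simp

lemma dual_diff: "L \<in> E \<Longrightarrow> f \<in> X \<Longrightarrow> g \<in> X \<Longrightarrow> L (\<lambda>x. f x - g x) = L f - L g"
  using dual_add[of L f "\<lambda>x. -1 * g x"] dual_scale[of L g "-1"] scale_mem[of g "-1"] by simp

lemma dual_sum: "L \<in> E \<Longrightarrow> (\<And>i. i < m \<Longrightarrow> z i \<in> X) \<Longrightarrow> L (\<lambda>x. \<Sum>i<m. z i x) = (\<Sum>i<m. L (z i))" for m :: nat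
proof (induction m)
  case (Suc m)
  then have "L (\<lambda>x. (\<Sum>i<m. z i x) + z m x) = L (\<lambda>x. \<Sum>i<m. z i x) + L (z m)"
    by (intro dual_add sum_mem) auto
  with Suc show ?case by simp
qed (simp add: dual_zero)

lemma dual_bdd: 
  assumes "L \<in> E"
  shows "bdd_above {\<bar>L f\<bar> |f. f \<in> X \<and> N f \<le> 1}"
proof -
  obtain C where C: "\<And>f. f \<in> X \<Longrightarrow> \<bar>L f\<bar> \<le> C * N f"
    using assms unfolding dual_sp_def bounded_lin_fun_def by blast
  have "\<bar>L f\<bar> \<le> \<bar>C\<bar>" if "f \<in> X" "N f \<le> 1" for f
  proof -
    have "C * N f \<le> \<bar>C\<bar> * 1" using that nonneg[of f] by (intro mult_mono) auto
    then show ?thesis using C[OF that(1)] by simp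
  qed
  then show ?thesis by (intro bdd_aboveI[where M = "\<bar>C\<bar>"]) auto
qed

lemma dual_norm_ge1: "L \<in> E \<Longrightarrow> f \<in> X \<Longrightarrow> N f \<le> 1 \<Longrightarrow> \<bar>L f\<bar> \<le> D L"
  unfolding dual_norm_def by (rule cSup_upper[OF _ dual_bdd]) auto

lemma dual_norm_nonneg: "L \<in> E \<Longrightarrow> 0 \<le> D L"
  using dual_norm_ge1[OF _ zero_mem] N_zero by fastforce

lemma dual_norm_ge:
  assumes L: "L \<in> E" and f: "f \<in> X"
  shows "\<bar>L f\<bar> \<le> D L * N f"
proof (cases "N f = 0")
  case True
  obtain C where "\<bar>L f\<bar> \<le> C * N f"
    using L f unfolding dual_sp_def bounded_lin_fun_def by blast
  then show ?thesis using True by simp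
next
  case False
  then have p: "N f > 0" using nonneg[OF f] by simp
  have "\<bar>L (\<lambda>x. inverse (N f) * f x)\<bar> \<le> D L"
    using p f by (intro dual_norm_ge1[OF L] scale_mem) (auto simp: scale)
  then have "inverse (N f) * \<bar>L f\<bar> \<le> D L" using p by (simp only: dual_scale[OF L f] abs_mult abs_inverse abs_of_pos)
  then show ?thesis using p by (simp add: field_simps)
qed

lemma dual_norm_le: "(\<And>f. f \<in> X \<Longrightarrow> N f \<le> 1 \<Longrightarrow> \<bar>L f\<bar> \<le> c) \<Longrightarrow> D L \<le> c"
  unfolding dual_norm_def
  by (rule cSup_least) (use zero_mem N_zero in \<open>auto intro!: exI[of _ "\<lambda>x. 0"]\<close>)

lemma dual_lin:
  assumes L: "L \<in> E" "L' \<in> E"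
  shows "(\<lambda>f. a * L f + b * L' f) \<in> E"
proof -
  have "\<bar>a * L f + b * L' f\<bar> \<le> (\<bar>a\<bar> * D L + \<bar>b\<bar> * D L') * N f" if "f \<in> X" for f
  proof -
    have "\<bar>a * L f + b * L' f\<bar> \<le> \<bar>a\<bar> * \<bar>L f\<bar> + \<bar>b\<bar> * \<bar>L' f\<bar>"
      by (metis abs_mult abs_triangle_ineq)
    also have "\<dots> \<le> \<bar>a\<bar> * (D L * N f) + \<bar>b\<bar> * (D L' * N f)"
      using that L by (intro add_mono mult_left_mono dual_norm_ge) auto
    finally show ?thesis by (simp add: algebra_simps)
  qed
  moreover have "a * L (\<lambda>x. f x + g x) + b * L' (\<lambda>x. f x + g x) = (a * L f + b * L' f) + (a * L g + b * L' g)"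
    if "f \<in> X" "g \<in> X" for f g
    using that L by (simp add: dual_add algebra_simps)
  moreover have "a * L (\<lambda>x. c * f x) + b * L' (\<lambda>x. c * f x) = c * (a * L f + b * L' f)" if "f \<in> X" for f c
    using that L by (simp add: dual_scale algebra_simps)
  ultimately show ?thesis unfolding dual_sp_def bounded_lin_fun_def mem_Collect_eq by blast
qed

lemma dual_norm_add:
  assumes L: "L \<in> E" "L' \<in> E"
  shows "D (\<lambda>f. L f + L' f) \<le> D L + D L'"
proof (rule dual_norm_le)
  fix f assume "f \<in> X" "N f \<le> 1"
  then have "\<bar>L f\<bar> \<le> D L" "\<bar>L' f\<bar> \<le> D L'" using L dual_norm_ge1 by auto
  then show "\<bar>L f + L' f\<bar> \<le> D L + D L'" by linarith
qed

lemma dual_norm_scale_le: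
  assumes L: "L \<in> E"
  shows "D (\<lambda>f. c * L f) \<le> \<bar>c\<bar> * D L"
  using dual_norm_ge1[OF L] by (intro dual_norm_le) (auto simp: abs_mult intro!: mult_left_mono)

lemma dual_norm_scale:
  assumes L: "L \<in> E"
  shows "D (\<lambda>f. c * L f) = \<bar>c\<bar> * D L"
proof (cases "c = 0")
  case True
  then show ?thesis using dual_norm_scale_le[OF L, of 0] dual_norm_nonneg[OF dual_lin[OF L L, of 0 0]] by simp
next
  case False
  have "(\<lambda>f. c * L f) \<in> E" using dual_lin[OF L L, of c 0] by simp
  from dual_norm_scale_le[OF this, of "inverse c"]
  have "D L \<le> \<bar>inverse c\<bar> * D (\<lambda>f. c * L f)" using False by (simp add: mult.assoc[symmetric])
  then have "\<bar>c\<bar> * D L \<le> D (\<lambda>f. c * L f)" using False by (simp add: field_simps)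
  then show ?thesis using dual_norm_scale_le[OF L, of c] by simp
qed

lemma dual_comb: "(\<And>i. i < m \<Longrightarrow> L i \<in> E) \<Longrightarrow> (\<lambda>f. \<Sum>i<m. a i * L i f) \<in> E" for m :: nat
proof (induction m)
  case 0
  show ?case by (auto simp: dual_sp_def bounded_lin_fun_def nonneg intro!: exI[of _ 0])
next
  case (Suc m)
  then show ?case using dual_lin[of "\<lambda>f. \<Sum>i<m. a i * L i f" "L m" 1 "a m"] by simp
qed

lemma dual_norm_comb_le:
  "(\<And>i. i < m \<Longrightarrow> L i \<in> E) \<Longrightarrow> D (\<lambda>f. \<Sum>i<m. a i * L i f) \<le> (\<Sum>i<m. \<bar>a i\<bar> * D (L i))" for m :: nat
proof (induction m)
  case 0
  show ?case by (intro dual_norm_le) auto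
next
  case (Suc m)
  have L: "L m \<in> E" "(\<lambda>f. a m * L m f) \<in> E" using Suc(2) dual_lin[of "L m" "L m" "a m" 0] by auto
  have "D (\<lambda>f. (\<Sum>i<m. a i * L i f) + a m * L m f) \<le> D (\<lambda>f. \<Sum>i<m. a i * L i f) + D (\<lambda>f. a m * L m f)"
    using Suc(2) L(2) by (intro dual_norm_add dual_comb) auto
  also have "\<dots> \<le> (\<Sum>i<m. \<bar>a i\<bar> * D (L i)) + \<bar>a m\<bar> * D (L m)"
    using Suc by (intro add_mono dual_norm_scale_le) auto
  finally show ?case by simp
qed

text \<open>Evaluation at a vector of the unit ball where \<open>L n\<close> reaches half of its
  dual norm is a norming functional on the dual.\<close>

lemma weakly_null_dual_bounded:
  assumes L: "weakly_null E D L"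
  obtains B where "\<And>n. D (L n) \<le> B"
proof (rule weakly_null_bounded[OF L])
  fix n
  have LE: "L n \<in> E" using L by (simp add: weakly_null_def)
  obtain f where f: "f \<in> X" "N f \<le> 1" "D (L n) \<le> 2 * \<bar>L n f\<bar>"
  proof (cases "D (L n) = 0")
    case True
    then show ?thesis using that[OF zero_mem] N_zero by simp
  next
    case False
    then have "D (L n) / 2 < D (L n)" using dual_norm_nonneg[OF LE] by simp
    then have "\<exists>y\<in>{\<bar>L n f\<bar> |f. f \<in> X \<and> N f \<le> 1}. D (L n) / 2 < y"
      unfolding dual_norm_def using zero_mem N_zero
      by (subst (asm) less_cSup_iff[OF _ dual_bdd[OF LE]]) (auto intro!: exI[of _ "\<lambda>x. 0"])
    then obtain f where "f \<in> X" "N f \<le> 1" "D (L n) / 2 < \<bar>L n f\<bar>" by blast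
    then show ?thesis using that[of f] by simp
  qed
  have "\<bar>L' f\<bar> \<le> D L'" if "L' \<in> E" for L' using dual_norm_ge1[OF that f(1,2)] .
  then show "\<exists>\<psi>. (\<forall>f\<in>E. \<forall>g\<in>E. \<psi> (\<lambda>t. f t + g t) = \<psi> f + \<psi> g) \<and>
          (\<forall>c. \<forall>f\<in>E. \<psi> (\<lambda>t. c * f t) = c * \<psi> f) \<and>
          (\<forall>f\<in>E. \<bar>\<psi> f\<bar> \<le> D f) \<and> D (L n) \<le> 2 * \<bar>\<psi> (L n)\<bar>"
    using f(3) by (intro exI[of _ "\<lambda>L'. L' f"]) auto
qed (use that in blast)

text \<open>Rational coefficients suffice in the hypothesis, so that it can be verified almost everywhere
  when the numbers \<open>\<gamma> i\<close> are values of measurable functions at a point.\<close>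

lemma dual_interpolation:
  fixes L :: "nat \<Rightarrow> ('a \<Rightarrow> real) \<Rightarrow> real" and \<gamma> :: "nat \<Rightarrow> real"
  assumes L: "\<And>i. L i \<in> E"
    and rat: "\<And>as :: rat list. \<bar>\<Sum>i<length as. of_rat (as ! i) * \<gamma> i\<bar> \<le> D (\<lambda>f. \<Sum>i<length as. of_rat (as ! i) * L i f)"
  obtains \<Phi> where "bounded_lin_fun E D \<Phi>" "\<And>n. \<Phi> (L n) = \<gamma> n"
proof -
  \<comment> \<open>Both sides are continuous in the coefficients, so the rational hypothesis
    extends to real ones; \<open>K\<close> collects the error of both sides per unit of
    perturbation.\<close>
  have real: "(\<Sum>i<m. a i * \<gamma> i) \<le> D (\<lambda>f. \<Sum>i<m. a i * L i f)" for m and a :: "nat \<Rightarrow> real"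
  proof (rule field_le_epsilon)
    fix e :: real assume e: "e > 0"
    define K where "K = (\<Sum>i<m. D (L i) + \<bar>\<gamma> i\<bar>)"
    have K0: "0 \<le> K" unfolding K_def using dual_norm_nonneg[OF L] by (intro sum_nonneg) (simp add: add_nonneg_nonneg)
    define d where "d = e / (K + 1)"
    have d: "d > 0" "d * K \<le> e" using e K0 by (auto simp: d_def field_simps)
    have "\<exists>r :: rat. \<bar>of_rat r - a i\<bar> < d" for i
    proof -
      obtain r where "a i < real_of_rat r" "real_of_rat r < a i + d"
        using of_rat_dense[of "a i" "a i + d"] d by auto
      then show ?thesis by (intro exI[of _ r]) auto
    qed
    then obtain r :: "nat \<Rightarrow> rat" where r: "\<And>i. \<bar>of_rat (r i) - a i\<bar> < d" by metis
    have "(\<Sum>i<m. a i * \<gamma> i) = (\<Sum>i<m. of_rat (r i) * \<gamma> i) + (\<Sum>i<m. (a i - of_rat (r i)) * \<gamma> i)"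
      by (simp add: sum.distrib[symmetric] algebra_simps)
    also have "(\<Sum>i<m. of_rat (r i) * \<gamma> i) \<le> D (\<lambda>f. \<Sum>i<m. of_rat (r i) * L i f)"
      using rat[of "map r [0..<m]"] by simp
    also have "(\<lambda>f. \<Sum>i<m. of_rat (r i) * L i f) =
        (\<lambda>f. (\<Sum>i<m. a i * L i f) + (\<Sum>i<m. (of_rat (r i) - a i) * L i f))"
      by (simp add: sum.distrib[symmetric] algebra_simps)
    also have "D \<dots> \<le> D (\<lambda>f. \<Sum>i<m. a i * L i f) + D (\<lambda>f. \<Sum>i<m. (of_rat (r i) - a i) * L i f)"
      using L by (intro dual_norm_add dual_comb) auto
    also have "D (\<lambda>f. \<Sum>i<m. (of_rat (r i) - a i) * L i f) \<le> (\<Sum>i<m. \<bar>of_rat (r i) - a i\<bar> * D (L i))"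
      using L by (intro dual_norm_comb_le) auto
    also have "\<dots> \<le> (\<Sum>i<m. d * D (L i))"
      using r dual_norm_nonneg[OF L] by (intro sum_mono mult_right_mono) (auto intro: less_imp_le)
    also have "(\<Sum>i<m. (a i - of_rat (r i)) * \<gamma> i) \<le> (\<Sum>i<m. d * \<bar>\<gamma> i\<bar>)"
    proof (rule sum_mono)
      fix i
      have "(a i - of_rat (r i)) * \<gamma> i \<le> \<bar>of_rat (r i) - a i\<bar> * \<bar>\<gamma> i\<bar>"
        by (metis abs_ge_self abs_minus_commute abs_mult)
      also have "\<dots> \<le> d * \<bar>\<gamma> i\<bar>" using r[of i] by (intro mult_right_mono) auto
      finally show "(a i - of_rat (r i)) * \<gamma> i \<le> d * \<bar>\<gamma> i\<bar>" .
    qed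
    finally have "(\<Sum>i<m. a i * \<gamma> i) \<le> D (\<lambda>f. \<Sum>i<m. a i * L i f) + (\<Sum>i<m. d * D (L i)) + (\<Sum>i<m. d * \<bar>\<gamma> i\<bar>)"
      by simp
    also have "\<dots> = D (\<lambda>f. \<Sum>i<m. a i * L i f) + d * K"
      by (simp add: K_def sum.distrib sum_distrib_left distrib_left)
    finally show "(\<Sum>i<m. a i * \<gamma> i) \<le> D (\<lambda>f. \<Sum>i<m. a i * L i f) + e" using d by linarith
  qed
  \<comment> \<open>Pairs are indexed by coefficients. A functional with two representations
    contributes two pairs, which the graph form of the extension theorem permits.\<close>
  define G where "G = {(\<lambda>f. \<Sum>i<m. a i * L i f, \<Sum>i<m. a i * \<gamma> i) |m a. True}"
  have GI: "(\<lambda>f. \<Sum>i<m. a i * L i f, \<Sum>i<m. a i * \<gamma> i) \<in> G" for m :: nat and a by (auto simp: G_def)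
  \<comment> \<open>Coefficients of different lengths are padded by zeros so that two pairs can be
    combined.\<close>
  have pad: "(\<Sum>i<max m k. (if i < m then a i else 0) * z i) = (\<Sum>i<m. a i * z i)" for m k :: nat and a z :: "nat \<Rightarrow> real"
    by (intro sum.mono_neutral_cong_right) auto
  have pad': "(\<Sum>i<max k m. (if i < m then a i else 0) * z i) = (\<Sum>i<m. a i * z i)" for m k :: nat and a z :: "nat \<Rightarrow> real"
    by (intro sum.mono_neutral_cong_right) auto
  obtain \<Phi> where \<Phi>: "\<And>a b f g. f \<in> E \<Longrightarrow> g \<in> E \<Longrightarrow> \<Phi> (\<lambda>x. a * f x + b * g x) = a * \<Phi> f + b * \<Phi> g"
    "\<And>f. f \<in> E \<Longrightarrow> \<Phi> f \<le> D f" "\<And>f \<alpha>. (f, \<alpha>) \<in> G \<Longrightarrow> \<Phi> f = \<alpha>"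
  proof (rule hahn_banach_graph[of E D G])
    show "(\<lambda>f. a * L f + b * L' f) \<in> E" if "L \<in> E" "L' \<in> E" for a b L L' using that by (rule dual_lin)
    show "D (\<lambda>f. L f + L' f) \<le> D L + D L'" if "L \<in> E" "L' \<in> E" for L L' using that by (rule dual_norm_add)
    show "D (\<lambda>f. c * L f) = c * D L" if "0 \<le> c" "L \<in> E" for c L using that by (simp add: dual_norm_scale)
    show "G \<noteq> {}" using GI by blast
    show "f \<in> E \<and> \<alpha> \<le> D f" if "(f, \<alpha>) \<in> G" for f \<alpha>
      using that real L unfolding G_def by (auto intro!: dual_comb)
    fix a b f g \<alpha> \<beta> assume "(f, \<alpha>) \<in> G" "(g, \<beta>) \<in> G"
    then obtain m u k v where *: "f = (\<lambda>f. \<Sum>i<m. u i * L i f)" "\<alpha> = (\<Sum>i<m. u i * \<gamma> i)"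
      "g = (\<lambda>f. \<Sum>i<k. v i * L i f)" "\<beta> = (\<Sum>i<k. v i * \<gamma> i)"
      unfolding G_def by blast
    define w where "w i = a * (if i < m then u i else 0) + b * (if i < k then v i else 0)" for i
    have w: "(\<Sum>i<max m k. w i * z i) = a * (\<Sum>i<m. u i * z i) + b * (\<Sum>i<k. v i * z i)" for z
    proof -
      have "(\<Sum>i<max m k. w i * z i) = a * (\<Sum>i<max m k. (if i < m then u i else 0) * z i)
         + b * (\<Sum>i<max m k. (if i < k then v i else 0) * z i)"
        unfolding w_def sum_distrib_left sum.distrib[symmetric]
        by (intro sum.cong) (simp_all add: distrib_right mult.assoc)
      then show ?thesis unfolding pad pad' .
    qed
    show "(\<lambda>x. a * f x + b * g x, a * \<alpha> + b * \<beta>) \<in> G"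
      using GI[where m = "max m k" and a = w] unfolding w * .
  qed (rule that, assumption+)
  show thesis
  proof (rule that)
    have "\<Phi> (\<lambda>x. - f x) = - \<Phi> f" "D (\<lambda>x. - f x) = D f" "(\<lambda>x. - f x) \<in> E" if "f \<in> E" for f
      using \<Phi>(1)[OF that that, of "-1" 0] dual_norm_scale[OF that, of "-1"] dual_lin[OF that that, of "-1" 0]
      by simp_all
    then have "\<bar>\<Phi> f\<bar> \<le> 1 * D f" if "f \<in> E" for f
      using that \<Phi>(2)[of f] \<Phi>(2)[of "\<lambda>x. - f x"] by simp
    moreover have "\<Phi> (\<lambda>x. f x + g x) = \<Phi> f + \<Phi> g" if "f \<in> E" "g \<in> E" for f g
      using \<Phi>(1)[OF that, of 1 1] by simp
    moreover have "\<Phi> (\<lambda>x. c * f x) = c * \<Phi> f" if "f \<in> E" for f c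
      using \<Phi>(1)[OF that that, of c 0] by simp
    ultimately show "bounded_lin_fun E D \<Phi>" unfolding bounded_lin_fun_def by blast
    fix n
    have "(\<Sum>i<Suc n. (if i = n then 1 else 0) * z i) = z n" for z :: "nat \<Rightarrow> real"
    proof -
      have "(\<Sum>i<Suc n. (if i = n then 1 else 0) * z i) = (\<Sum>i<Suc n. if i = n then z i else 0)"
        by (intro sum.cong) auto
      then show ?thesis by simp
    qed
    then show "\<Phi> (L n) = \<gamma> n"
      using \<Phi>(3)[OF GI[where m = "Suc n" and a = "\<lambda>i. if i = n then 1 else 0"]] by simp
  qed
qed

end

lemma bounded_lin_fun_equivalent:
  assumes le: "\<And>f. f \<in> X \<Longrightarrow> Q f \<le> K * N f" and nn: "\<And>f. f \<in> X \<Longrightarrow> 0 \<le> Q f"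
    and L: "bounded_lin_fun X Q L"
  shows "bounded_lin_fun X N L"
proof -
  obtain C where C: "\<And>f. f \<in> X \<Longrightarrow> \<bar>L f\<bar> \<le> C * Q f"
    using L unfolding bounded_lin_fun_def by blast
  have "\<bar>L f\<bar> \<le> (\<bar>C\<bar> * K) * N f" if f: "f \<in> X" for f
  proof -
    have "\<bar>L f\<bar> \<le> \<bar>C\<bar> * Q f"
      using C[OF f] mult_right_mono[OF abs_ge_self[of C] nn[OF f]] by simp
    also have "\<dots> \<le> \<bar>C\<bar> * (K * N f)" by (intro mult_left_mono le f) simp
    finally show ?thesis by (simp add: mult.assoc)
  qed
  then have "\<exists>C. \<forall>f\<in>X. \<bar>L f\<bar> \<le> C * N f" by blast
  then show ?thesis using L unfolding bounded_lin_fun_def by (elim conjE) (intro conjI)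
qed

lemma weakly_null_equivalent:
  assumes "\<And>f. f \<in> X \<Longrightarrow> Q f \<le> K * N f" "\<And>f. f \<in> X \<Longrightarrow> 0 \<le> Q f" "weakly_null X N x"
  shows "weakly_null X Q x"
  unfolding weakly_null_def
proof (intro conjI allI impI)
  show "x n \<in> X" for n using assms(3) by (simp add: weakly_null_def)
  fix L assume "bounded_lin_fun X Q L"
  with assms(1,2) have "bounded_lin_fun X N L" by (rule bounded_lin_fun_equivalent)
  then show "(\<lambda>n. L (x n)) \<longlonglongrightarrow> 0" using assms(3) by (simp add: weakly_null_def)
qed

text \<open>Equivalent norms have the same bounded functionals and comparable dual norms, so weak
  nullness passes from \<open>N\<close> to \<open>Q\<close> on both levels. Homogeneity is taken
  from \<open>Q\<close>; about \<open>N\<close> only nonnegativity and the two comparisons enter,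
  which is what the estimates for the rearrangement norm provide.\<close>

lemma dunford_pettis_equivalent:
  assumes sn: "function_seminorm X Q" and N0: "\<And>f. f \<in> X \<Longrightarrow> 0 \<le> N f"
    and K: "K1 > 0" "K2 > 0"
    and le1: "\<And>f. f \<in> X \<Longrightarrow> Q f \<le> K1 * N f" and le2: "\<And>f. f \<in> X \<Longrightarrow> N f \<le> K2 * Q f"
    and dp: "dunford_pettis X Q"
  shows "dunford_pettis X N"
proof -
  interpret function_seminorm X Q by fact
  have E_eq: "dual_sp X N = E"
    unfolding dual_sp_def
  proof (intro Collect_cong iffI)
    fix L assume "bounded_lin_fun X N L"
    with le2 N0 show "bounded_lin_fun X Q L" by (rule bounded_lin_fun_equivalent)
  next
    fix L assume "bounded_lin_fun X Q L"
    with le1 nonneg show "bounded_lin_fun X N L" by (rule bounded_lin_fun_equivalent)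
  qed
  have 0: "\<bar>L f\<bar> \<le> K1 * D L" if "L \<in> E" "f \<in> X" "N f \<le> 1" for L f
  proof -
    have "K1 * N f \<le> K1 * 1" using K that(3) by (intro mult_left_mono) auto
    then have "Q f \<le> K1" using le1[OF that(2)] by simp
    then have "D L * Q f \<le> D L * K1" using dual_norm_nonneg[OF that(1)] by (rule mult_left_mono)
    then show ?thesis using dual_norm_ge[OF that(1,2)] by (simp add: mult.commute)
  qed
  have bdd: "bdd_above {\<bar>L f\<bar> |f. f \<in> X \<and> N f \<le> 1}" if "L \<in> E" for L
    using 0[OF that] by (intro bdd_aboveI[where M = "K1 * D L"]) auto
  have ge: "\<bar>L f\<bar> \<le> dual_norm X N L" if "L \<in> E" "f \<in> X" "N f \<le> 1" for L f
    unfolding dual_norm_def by (rule cSup_upper[OF _ bdd]) (use that in auto)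
  have "D L \<le> K2 * dual_norm X N L" if L: "L \<in> E" for L
  proof (rule dual_norm_le)
    fix f assume f: "f \<in> X" "Q f \<le> 1"
    have g: "(\<lambda>x. inverse K2 * f x) \<in> X" by (rule scale_mem[OF f(1)])
    have "N (\<lambda>x. inverse K2 * f x) \<le> K2 * (\<bar>inverse K2\<bar> * Q f)"
      using le2[OF g] unfolding scale[OF f(1)] .
    also have "\<dots> = Q f" using K by simp
    finally have "\<bar>L (\<lambda>x. inverse K2 * f x)\<bar> \<le> dual_norm X N L" using f by (intro ge L g) simp
    then have "inverse K2 * \<bar>L f\<bar> \<le> dual_norm X N L"
      using K by (simp only: dual_scale[OF L f(1)] abs_mult abs_inverse abs_of_pos)
    then show "\<bar>L f\<bar> \<le> K2 * dual_norm X N L" using K by (simp add: field_simps)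
  qed
  note D_le = this
  show ?thesis
    unfolding dunford_pettis_def E_eq
  proof (intro allI impI)
    fix x L assume x: "weakly_null X N x" and L: "weakly_null E (dual_norm X N) L"
    have "weakly_null X Q x" using le1 nonneg x by (rule weakly_null_equivalent)
    moreover have "weakly_null E D L" using D_le dual_norm_nonneg L by (rule weakly_null_equivalent)
    ultimately show "(\<lambda>n. L n (x n)) \<longlonglongrightarrow> 0" using dp unfolding dunford_pettis_def by blast
  qed
qed

section \<open>The Dunford--Pettis property of a c0-sum of L1 spaces\<close>

text \<open>Weights are absorbed into \<open>M\<close>, so each block is an L1 space over a finite
  measure. Points outside all blocks do not contribute.\<close>

locale c0_sum_L1 =
  fixes M :: "'a measure" and I :: "nat \<Rightarrow> 'a set"
  assumes sets_I [measurable]: "\<And>k. I k \<in> sets M"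
    and disj: "disjoint_family I"
    and fin: "\<And>k. emeasure M (I k) \<noteq> \<infinity>"
begin

definition block :: "nat \<Rightarrow> ('a \<Rightarrow> real) \<Rightarrow> real" where
  "block k f = (\<integral>x. indicator (I k) x * \<bar>f x\<bar> \<partial>M)"

definition X :: "('a \<Rightarrow> real) set" where
  "X = {f \<in> borel_measurable M. (\<forall>k. integrable M (\<lambda>x. indicator (I k) x * f x)) \<and> (\<lambda>k. block k f) \<longlonglongrightarrow> 0}"

definition Q :: "('a \<Rightarrow> real) \<Rightarrow> real" where
  "Q f = (SUP k. block k f)"

lemma X_meas [measurable_dest]: "f \<in> X \<Longrightarrow> f \<in> borel_measurable M"
  by (simp add: X_def)

lemma X_int: "f \<in> X \<Longrightarrow> integrable M (\<lambda>x. indicator (I k) x * f x)"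
  by (simp add: X_def)

lemma X_int_abs: "f \<in> X \<Longrightarrow> integrable M (\<lambda>x. indicator (I k) x * \<bar>f x\<bar>)"
  using integrable_abs[OF X_int, of f k] by (simp add: abs_mult)

lemma block_tendsto: "f \<in> X \<Longrightarrow> (\<lambda>k. block k f) \<longlonglongrightarrow> 0"
  by (simp add: X_def)

lemma block_nonneg: "0 \<le> block k f"
  unfolding block_def by (intro integral_nonneg_AE AE_I2) auto

lemma block_dominated:
  assumes f: "f \<in> X" and g: "g \<in> borel_measurable M"
    and le: "\<And>x. x \<in> I k \<Longrightarrow> \<bar>g x\<bar> \<le> c * \<bar>f x\<bar>"
  shows "integrable M (\<lambda>x. indicator (I k) x * g x)" "block k g \<le> c * block k f"
proof -
  have le': "\<bar>indicator (I k) x * g x\<bar> \<le> c * (indicator (I k) x * \<bar>f x\<bar>)" for x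
    using le[of x] by (auto simp: indicator_def)
  show i: "integrable M (\<lambda>x. indicator (I k) x * g x)"
  proof (rule Bochner_Integration.integrable_bound)
    show "integrable M (\<lambda>x. c * (indicator (I k) x * \<bar>f x\<bar>))" using X_int_abs[OF f] by simp
    show "AE x in M. norm (indicator (I k) x * g x) \<le> norm (c * (indicator (I k) x * \<bar>f x\<bar>))"
      using le' by (intro AE_I2) (metis abs_ge_self order_trans real_norm_def)
  qed (use g in measurable)
  have "block k g \<le> (\<integral>x. c * (indicator (I k) x * \<bar>f x\<bar>) \<partial>M)"
    unfolding block_def
  proof (rule integral_mono)
    show "integrable M (\<lambda>x. indicator (I k) x * \<bar>g x\<bar>)"
      using integrable_abs[OF i] by (simp add: abs_mult)
    show "integrable M (\<lambda>x. c * (indicator (I k) x * \<bar>f x\<bar>))" using X_int_abs[OF f] by simp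
    show "indicator (I k) x * \<bar>g x\<bar> \<le> c * (indicator (I k) x * \<bar>f x\<bar>)" for x
      using le'[of x] by (simp add: abs_mult)
  qed
  then show "block k g \<le> c * block k f" by (simp add: block_def)
qed

lemma X_dominated:
  assumes f: "f \<in> X" and g: "g \<in> borel_measurable M"
    and le: "\<And>x. \<bar>g x\<bar> \<le> c * \<bar>f x\<bar>"
  shows "g \<in> X"
proof -
  have "(\<lambda>k. c * block k f) \<longlonglongrightarrow> 0" using tendsto_mult_right_zero[OF block_tendsto[OF f]] .
  moreover have "\<forall>k. norm (block k g) \<le> c * block k f"
    using block_dominated(2)[OF f g le] block_nonneg[of _ g] by simp
  ultimately have "(\<lambda>k. block k g) \<longlonglongrightarrow> 0"
    by - (rule Lim_null_comparison[OF always_eventually])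
  then show ?thesis using block_dominated(1)[OF f g le] g by (simp add: X_def)
qed

lemma block_bdd: "f \<in> X \<Longrightarrow> bdd_above (range (\<lambda>k. block k f))"
  using convergent_imp_Bseq[OF convergentI[OF block_tendsto]] by (rule Bseq_bdd_above)

lemma block_le_Q: "f \<in> X \<Longrightarrow> block k f \<le> Q f"
  unfolding Q_def by (rule cSUP_upper[OF _ block_bdd]) auto

lemma Q_le: "(\<And>k. block k f \<le> c) \<Longrightarrow> Q f \<le> c"
  unfolding Q_def by (rule cSUP_least) auto

lemma Q_nonneg: "f \<in> X \<Longrightarrow> 0 \<le> Q f"
  using block_le_Q block_nonneg by (rule order_trans[rotated])

lemma block_scale: "block k (\<lambda>x. c * f x) = \<bar>c\<bar> * block k f"
proof -
  have "block k (\<lambda>x. c * f x) = (\<integral>x. \<bar>c\<bar> * (indicator (I k) x * \<bar>f x\<bar>) \<partial>M)"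
    unfolding block_def by (intro Bochner_Integration.integral_cong) (auto simp: abs_mult)
  then show ?thesis by (simp add: block_def)
qed

lemma scale_X: "f \<in> X \<Longrightarrow> (\<lambda>x. c * f x) \<in> X"
  by (rule X_dominated[of f _ "\<bar>c\<bar>"]) (auto simp: abs_mult)

lemma add_X: "f \<in> X \<Longrightarrow> g \<in> X \<Longrightarrow> (\<lambda>x. f x + g x) \<in> X"
proof -
  assume fg: "f \<in> X" "g \<in> X"
  have i: "integrable M (\<lambda>x. indicator (I k) x * (f x + g x))" for k
    using X_int[OF fg(1), of k] X_int[OF fg(2), of k] by (simp add: distrib_left)
  have "block k (\<lambda>x. f x + g x) \<le> (\<integral>x. indicator (I k) x * \<bar>f x\<bar> + indicator (I k) x * \<bar>g x\<bar> \<partial>M)" for k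
    unfolding block_def
  proof (rule integral_mono)
    show "integrable M (\<lambda>x. indicator (I k) x * \<bar>f x + g x\<bar>)"
      using integrable_abs[OF i[of k]] by (simp add: abs_mult)
    show "integrable M (\<lambda>x. indicator (I k) x * \<bar>f x\<bar> + indicator (I k) x * \<bar>g x\<bar>)"
      using X_int_abs fg by (intro Bochner_Integration.integrable_add) auto
    show "indicator (I k) x * \<bar>f x + g x\<bar> \<le> indicator (I k) x * \<bar>f x\<bar> + indicator (I k) x * \<bar>g x\<bar>" for x
      by (auto simp: indicator_def)
  qed
  also have "(\<integral>x. indicator (I k) x * \<bar>f x\<bar> + indicator (I k) x * \<bar>g x\<bar> \<partial>M) = block k f + block k g" for k
    using X_int_abs fg by (simp add: block_def)
  finally have "\<forall>k. norm (block k (\<lambda>x. f x + g x)) \<le> block k f + block k g"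
    using block_nonneg by simp
  moreover have "(\<lambda>k. block k f + block k g) \<longlonglongrightarrow> 0"
    using tendsto_add[OF block_tendsto[OF fg(1)] block_tendsto[OF fg(2)]] by simp
  ultimately have "(\<lambda>k. block k (\<lambda>x. f x + g x)) \<longlonglongrightarrow> 0"
    by - (rule Lim_null_comparison[OF always_eventually])
  moreover have "(\<lambda>x. f x + g x) \<in> borel_measurable M" using fg by measurable
  ultimately show ?thesis using i by (simp add: X_def)
qed

lemma Q_scale: "f \<in> X \<Longrightarrow> Q (\<lambda>x. c * f x) = \<bar>c\<bar> * Q f"
proof -
  have le: "Q (\<lambda>x. c * f x) \<le> \<bar>c\<bar> * Q f" if "f \<in> X" for c f
    using block_le_Q[OF that] by (intro Q_le) (auto simp: block_scale intro!: mult_left_mono)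
  assume f: "f \<in> X"
  show ?thesis
  proof (cases "c = 0")
    case True
    then show ?thesis using le[OF f, of 0] Q_nonneg[OF scale_X[OF f, of 0]] by simp
  next
    case False
    have "Q f \<le> \<bar>inverse c\<bar> * Q (\<lambda>x. c * f x)"
      using le[OF scale_X[OF f, of c], of "inverse c"] False by (simp add: mult.assoc[symmetric])
    then have "\<bar>c\<bar> * Q f \<le> Q (\<lambda>x. c * f x)" using False by (simp add: field_simps)
    then show ?thesis using le[OF f, of c] by simp
  qed
qed

sublocale function_seminorm X Q
proof
  show "(\<lambda>x. a * f x + b * g x) \<in> X" if "f \<in> X" "g \<in> X" for a b f g
    using that by (intro add_X scale_X)
  have "(\<lambda>x. 0) \<in> X" by (simp add: X_def block_def)
  then show "X \<noteq> {}" by blast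
qed (auto simp: Q_nonneg Q_scale)

section \<open>Truncation to finitely many blocks\<close>

definition V :: "nat \<Rightarrow> 'a set" where
  "V J = (\<Union>k<J. I k)"

lemma V_sets [measurable]: "V J \<in> sets M"
  unfolding V_def by measurable

lemma V_fin: "emeasure M (V J) < \<infinity>"
proof -
  have "emeasure M (V J) \<le> (\<Sum>k<J. emeasure M (I k))"
    unfolding V_def by (rule emeasure_subadditive_finite) auto
  also have "\<dots> < \<infinity>" using fin by (simp add: top.not_eq_extremum)
  finally show ?thesis .
qed

lemma I_unique: "x \<in> I j \<Longrightarrow> x \<in> I k \<Longrightarrow> j = k"
  using disjoint_family_onD[OF disj, of j k] by auto

lemma I_V_iff: "x \<in> I k \<Longrightarrow> x \<in> V J \<longleftrightarrow> k < J"
  unfolding V_def using I_unique by auto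

lemma indicator_V: "indicator (V J) x = (\<Sum>k<J. indicator (I k) x :: real)"
proof (cases "x \<in> V J")
  case True
  then obtain k where k: "k < J" "x \<in> I k" by (auto simp: V_def)
  have "(\<Sum>k<J. indicator (I k) x :: real) = (\<Sum>j\<in>{k}. indicator (I j) x)"
  proof (rule sum.mono_neutral_right)
    show "\<forall>i\<in>{..<J} - {k}. indicator (I i) x = (0::real)"
      using I_unique[OF k(2)] by (auto simp: indicator_def)
  qed (use k in auto)
  then show ?thesis using True k by simp
qed (auto simp: V_def)

lemma V_int: "f \<in> X \<Longrightarrow> integrable M (\<lambda>x. indicator (V J) x * f x)"
  unfolding indicator_V sum_distrib_right by (intro Bochner_Integration.integrable_sum X_int)

lemma V_int_abs: "f \<in> X \<Longrightarrow> integrable M (\<lambda>x. indicator (V J) x * \<bar>f x\<bar>)"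
  unfolding indicator_V sum_distrib_right by (intro Bochner_Integration.integrable_sum X_int_abs)

lemma integral_V_le: 
  assumes "f \<in> X" shows "(\<integral>x. indicator (V J) x * \<bar>f x\<bar> \<partial>M) \<le> real J * Q f"
proof -
  have "(\<integral>x. indicator (V J) x * \<bar>f x\<bar> \<partial>M) = (\<Sum>k<J. block k f)"
    unfolding indicator_V sum_distrib_right block_def
    using X_int_abs[OF assms] by (intro Bochner_Integration.integral_sum) auto
  also have "\<dots> \<le> (\<Sum>k<J. Q f)" by (intro sum_mono block_le_Q assms)
  finally show ?thesis by simp
qed

lemma cut_X: 
  assumes "f \<in> X" "A \<in> sets M" shows "(\<lambda>x. indicator A x * f x) \<in> X"
  using assms by (intro X_dominated[OF assms(1), of _ 1]) (auto simp: indicator_def)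

text \<open>Only finitely many blocks of the cut function are nonzero, and each block integral is at
  most the full integral over \<open>V J\<close>. Thus L1 of \<open>V J\<close> embeds into the
  space, which lets functionals be restricted to it.\<close>

lemma V_cut_X:
  assumes f: "f \<in> borel_measurable M" and i: "integrable M (\<lambda>x. indicator (V J) x * f x)"
  shows "(\<lambda>x. indicator (V J) x * f x) \<in> X" "Q (\<lambda>x. indicator (V J) x * f x) \<le> (\<integral>x. indicator (V J) x * \<bar>f x\<bar> \<partial>M)"
proof -
  let ?g = "\<lambda>x. indicator (V J) x * f x"
  have z: "block k ?g = 0" if "k \<ge> J" for k
  proof -
    have "indicator (I k) x * \<bar>?g x\<bar> = 0" for x using I_V_iff[of x k J] that by (auto simp: indicator_def)
    then show ?thesis by (simp only: block_def) simp
  qed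
  have "(\<lambda>k. block k ?g) \<longlonglongrightarrow> 0"
    by (rule tendsto_eventually) (use z in \<open>auto simp: eventually_sequentially\<close>)
  moreover have "integrable M (\<lambda>x. indicator (I k) x * ?g x)" for k
    using integrable_mult_indicator[OF sets_I i, of k] by simp
  ultimately show "?g \<in> X" using f by (simp add: X_def)
  show "Q ?g \<le> (\<integral>x. indicator (V J) x * \<bar>f x\<bar> \<partial>M)"
  proof (rule Q_le)
    fix k
    have ia: "integrable M (\<lambda>x. indicator (V J) x * \<bar>f x\<bar>)"
      using integrable_abs[OF i] by (simp add: abs_mult)
    show "block k ?g \<le> (\<integral>x. indicator (V J) x * \<bar>f x\<bar> \<partial>M)"
      unfolding block_def
    proof (rule integral_mono[OF _ ia])
      show "integrable M (\<lambda>x. indicator (I k) x * \<bar>?g x\<bar>)"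
        using integrable_mult_indicator[OF sets_I ia, of k] by (simp add: abs_mult)
    qed (auto simp: indicator_def)
  qed
qed

text \<open>Some block \<open>k\<close> carries at least half of the supremum; integration against
  the sign of \<open>x n\<close> on that block is a norming functional.\<close>

lemma weakly_null_X_bounded:
  assumes x: "weakly_null X Q x"
  obtains B where "\<And>n. Q (x n) \<le> B"
proof (rule weakly_null_bounded[OF x])
  fix n
  have xX: "x n \<in> X" using x by (simp add: weakly_null_def)
  obtain k where k: "Q (x n) \<le> 2 * block k (x n)"
  proof (cases "Q (x n) = 0")
    case True
    then show ?thesis using that[of 0] block_nonneg[of 0 "x n"] by simp
  next
    case False
    then have "Q (x n) / 2 < Q (x n)" using Q_nonneg[OF xX] by simp
    then have "\<exists>k\<in>UNIV. Q (x n) / 2 < block k (x n)"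
      unfolding Q_def by (subst (asm) less_cSUP_iff[OF _ block_bdd[OF xX]]) auto
    then obtain k where "Q (x n) / 2 < block k (x n)" by blast
    then show ?thesis using that[of k] by simp
  qed
  define s where "s t = indicator (I k) t * sgn (x n t)" for t
  have [measurable]: "s \<in> borel_measurable M" unfolding s_def using xX by measurable
  have i: "integrable M (\<lambda>t. s t * f t)" and le: "\<bar>\<integral>t. s t * f t \<partial>M\<bar> \<le> Q f" if f: "f \<in> X" for f
  proof -
    have [measurable]: "f \<in> borel_measurable M" using f by (rule X_meas)
    have b: "\<bar>s t * f t\<bar> \<le> indicator (I k) t * \<bar>f t\<bar>" for t
      by (auto simp: s_def indicator_def abs_mult sgn_real_def)
    show i: "integrable M (\<lambda>t. s t * f t)"
      by (rule Bochner_Integration.integrable_bound[OF X_int_abs[OF f, of k]]) (use b in auto)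
    have "\<bar>\<integral>t. s t * f t \<partial>M\<bar> \<le> (\<integral>t. \<bar>s t * f t\<bar> \<partial>M)" by (rule integral_abs_bound)
    also have "\<dots> \<le> block k f"
      unfolding block_def by (rule integral_mono[OF integrable_abs[OF i] X_int_abs[OF f] b])
    also have "\<dots> \<le> Q f" by (rule block_le_Q[OF f])
    finally show "\<bar>\<integral>t. s t * f t \<partial>M\<bar> \<le> Q f" .
  qed
  have "(\<integral>t. s t * x n t \<partial>M) = block k (x n)"
    unfolding block_def s_def by (intro Bochner_Integration.integral_cong) (auto simp: sgn_real_def)
  then have "Q (x n) \<le> 2 * \<bar>\<integral>t. s t * x n t \<partial>M\<bar>" using k by simp
  moreover have "(\<integral>t. s t * (f t + g t) \<partial>M) = (\<integral>t. s t * f t \<partial>M) + (\<integral>t. s t * g t \<partial>M)"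
    if "f \<in> X" "g \<in> X" for f g
    using i that by (simp add: distrib_left)
  moreover have "(\<integral>t. s t * (c * f t) \<partial>M) = c * (\<integral>t. s t * f t \<partial>M)" for c f
    by (simp add: mult.left_commute)
  ultimately show "\<exists>\<psi>. (\<forall>f\<in>X. \<forall>g\<in>X. \<psi> (\<lambda>t. f t + g t) = \<psi> f + \<psi> g) \<and>
          (\<forall>c. \<forall>f\<in>X. \<psi> (\<lambda>t. c * f t) = c * \<psi> f) \<and>
          (\<forall>f\<in>X. \<bar>\<psi> f\<bar> \<le> Q f) \<and> Q (x n) \<le> 2 * \<bar>\<psi> (x n)\<bar>"
    using le by (intro exI[of _ "\<lambda>f. \<integral>t. s t * f t \<partial>M"]) simp
qed (use that in blast)

text \<open>What is cut off has norm at most the supremum of the block integrals from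
  \<open>J\<close> on. Here it matters that block integrals tend to 0 and are not merely
  bounded.\<close>

lemma dual_cut_tendsto:
  assumes L: "L \<in> E" and f: "f \<in> X"
  shows "(\<lambda>J. L (\<lambda>t. indicator (V J) t * f t)) \<longlonglongrightarrow> L f"
proof (rule LIMSEQ_I)
  fix r :: real assume r: "r > 0"
  define e where "e = r / (D L + 1)"
  have D0: "0 \<le> D L" using dual_norm_nonneg[OF L] .
  have e: "e > 0" "D L * e < r" using r D0 by (auto simp: e_def field_simps)
  obtain K where K: "\<And>k. k \<ge> K \<Longrightarrow> block k f < e"
    using order_tendstoD(2)[OF block_tendsto[OF f] e(1)] by (auto simp: eventually_sequentially)
  have "norm (L (\<lambda>t. indicator (V J) t * f t) - L f) < r" if J: "J \<ge> K" for J
  proof -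
    let ?h = "\<lambda>t. indicator (V J) t * f t - f t"
    have hX: "?h \<in> X" by (intro diff_mem cut_X f V_sets)
    have "Q ?h \<le> e"
    proof (rule Q_le)
      fix k
      show "block k ?h \<le> e"
      proof (cases "k < J")
        case True
        have "indicator (I k) x * \<bar>?h x\<bar> = 0" for x using I_V_iff[of x k J] True by (auto simp: indicator_def)
        then show ?thesis using e by (simp only: block_def) simp
      next
        case False
        have "block k ?h \<le> 1 * block k f"
          by (rule block_dominated[OF f X_meas[OF hX]]) (auto simp: indicator_def)
        then show ?thesis using K[of k] J False by simp
      qed
    qed
    have "\<bar>L ?h\<bar> \<le> D L * Q ?h" by (rule dual_norm_ge[OF L hX])
    also have "\<dots> \<le> D L * e" using D0 \<open>Q ?h \<le> e\<close> by (rule mult_left_mono[rotated])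
    finally show ?thesis using e dual_diff[OF L cut_X[OF f V_sets[of J]] f] by simp
  qed
  then show "\<exists>no. \<forall>n\<ge>no. norm (L (\<lambda>t. indicator (V n) t * f t) - L f) < r" by blast
qed

text \<open>Otherwise a selection gives pieces \<open>z i\<close> of \<open>x (n i)\<close> on
  disjoint groups of blocks with \<open>L (n i) (z i)\<close> bounded away from 0. Evaluations at
  the \<open>z i\<close> are absolutely summable on the dual, so the diagonal lemma for the weakly
  null sequence \<open>L\<close> is contradicted. One \<open>J\<close> bounds both blocks and
  indices, matching the shape of the selection.\<close>

lemma dual_tail_small:
  assumes x: "weakly_null X Q x" and L: "weakly_null E D L" and e: "e > 0"
  obtains J where "\<And>n. n \<ge> J \<Longrightarrow> \<bar>L n (x n) - L n (\<lambda>t. indicator (V J) t * x n t)\<bar> \<le> e"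
proof -
  obtain B where B: "\<And>n. Q (x n) \<le> B" using weakly_null_X_bounded[OF x] by blast
  have xX: "x n \<in> X" for n using x by (simp add: weakly_null_def)
  have LE: "L n \<in> E" for n using L by (simp add: weakly_null_def)
  define cut where "cut J f = (\<lambda>t. indicator (V J) t * f t)" for J and f :: "'a \<Rightarrow> real"
  have cutX: "cut J f \<in> X" if "f \<in> X" for J f unfolding cut_def using that by (intro cut_X V_sets)
  have "\<exists>J. \<forall>n\<ge>J. \<bar>L n (x n) - L n (cut J (x n))\<bar> \<le> e"
  proof (rule ccontr)
    assume neg: "\<not> ?thesis"
    define R where "R J n J' \<longleftrightarrow> e < \<bar>L n (cut J' (x n)) - L n (cut J (x n))\<bar>" for J n J'
    have "\<exists>n\<ge>J. \<exists>J'>n. R J n J'" for J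
    proof -
      obtain n where n: "n \<ge> J" "e < \<bar>L n (x n) - L n (cut J (x n))\<bar>"
        using neg by (auto simp: not_le)
      have "(\<lambda>J'. \<bar>L n (cut J' (x n)) - L n (cut J (x n))\<bar>) \<longlonglongrightarrow> \<bar>L n (x n) - L n (cut J (x n))\<bar>"
        using dual_cut_tendsto[OF LE xX] unfolding cut_def by (intro tendsto_rabs tendsto_diff tendsto_const)
      from order_tendstoD(1)[OF this n(2)]
      obtain J' where "\<And>k. k \<ge> J' \<Longrightarrow> R J n k" by (auto simp: eventually_sequentially R_def)
      then have "R J n (max J' (Suc n))" by simp
      then show ?thesis using n(1) by (intro exI[of _ n] conjI exI[of _ "max J' (Suc n)"]) auto
    qed
    then obtain J n where sel: "\<And>i. J i \<le> n i" "\<And>i. n i < J (Suc i)" "\<And>i. R (J i) (n i) (J (Suc i))"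
      "strict_mono n" "strict_mono J"
      by (rule increasing_selection) blast
    define z where "z i = (\<lambda>t. cut (J (Suc i)) (x (n i)) t - cut (J i) (x (n i)) t)" for i
    have zX: "z i \<in> X" for i unfolding z_def by (intro diff_mem cutX xX)
    have z_eq: "z i t = (if J i \<le> k \<and> k < J (Suc i) then x (n i) t else 0)" if t: "t \<in> I k" for i k t
    proof -
      have "J i \<le> J (Suc i)" using sel(5) by (simp add: strict_mono_less_eq)
      then show ?thesis using I_V_iff[OF t] by (auto simp: z_def cut_def indicator_def)
    qed
    have "(\<lambda>i. L (n i) (z i)) \<longlonglongrightarrow> 0"
    proof (rule weakly_null_diagonal[OF weakly_null_subseq[OF L sel(4)], where K = B])
      fix m L' assume L': "L' \<in> E"
      \<comment> \<open>The signs turn the sum of absolute values into one value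
        \<open>L' y\<close>, so only the norm of \<open>y\<close> has to be controlled.\<close>
      define s where "s i = sgn (L' (z i))" for i
      define y where "y = (\<lambda>t. \<Sum>i<m. s i * z i t)"
      have yX: "y \<in> X" unfolding y_def by (intro sum_mem scale_mem zX)
      \<comment> \<open>On each block at most one piece is nonzero, and there it equals
        \<open>x (n i)\<close>; in a supremum over blocks the signed sum is no larger than a single
        term.\<close>
      have "Q y \<le> B"
      proof (rule Q_le)
        fix k
        show "block k y \<le> B"
        proof (cases "\<exists>i<m. J i \<le> k \<and> k < J (Suc i)")
          case True
          then obtain i where i: "i < m" "J i \<le> k" "k < J (Suc i)" by blast
          have other: "\<not> (J j \<le> k \<and> k < J (Suc j))" if "j \<noteq> i" for j
          proof (cases "j < i")
            case True
            then have "J (Suc j) \<le> J i" using sel(5) by (simp add: strict_mono_less_eq)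
            then show ?thesis using i by auto
          next
            case False
            then have "J (Suc i) \<le> J j" using sel(5) that by (simp add: strict_mono_less_eq)
            then show ?thesis using i by auto
          qed
          have y_eq: "y t = s i * x (n i) t" if t: "t \<in> I k" for t
          proof -
            have "y t = (\<Sum>j\<in>{i}. s j * z j t)"
              unfolding y_def using i(1) other by (intro sum.mono_neutral_right) (auto simp: z_eq[OF t])
            then show ?thesis using i by (simp add: z_eq[OF t])
          qed
          have "block k y \<le> 1 * block k (x (n i))"
          proof (rule block_dominated[OF xX X_meas[OF yX]])
            fix t assume "t \<in> I k"
            then show "\<bar>y t\<bar> \<le> 1 * \<bar>x (n i) t\<bar>" by (auto simp: y_eq abs_mult s_def sgn_real_def)
          qed
          also have "\<dots> \<le> B" using block_le_Q[OF xX, of k "n i"] B[of "n i"] by simp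
          finally show ?thesis .
        next
          case False
          have "y t = 0" if "t \<in> I k" for t
            unfolding y_def using False by (intro sum.neutral) (auto simp: z_eq[OF that])
          then have "indicator (I k) t * \<bar>y t\<bar> = 0" for t by (auto simp: indicator_def)
          then have "block k y = 0" by (simp only: block_def) simp
          then show ?thesis using order_trans[OF Q_nonneg[OF xX] B] by simp
        qed
      qed
      have "(\<Sum>i<m. \<bar>L' (z i)\<bar>) = (\<Sum>i<m. L' (\<lambda>t. s i * z i t))"
        by (intro sum.cong) (auto simp: dual_scale[OF L' zX] s_def sgn_real_def)
      also have "\<dots> = L' y"
        unfolding y_def by (rule dual_sum[OF L', symmetric]) (intro scale_mem zX)
      also have "\<dots> \<le> D L' * Q y" using dual_norm_ge[OF L' yX] by simp
      also have "\<dots> \<le> D L' * B" using \<open>Q y \<le> B\<close> dual_norm_nonneg[OF L'] by (rule mult_left_mono)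
      finally show "(\<Sum>i<m. \<bar>L' (z i)\<bar>) \<le> B * D L'" by (simp add: mult.commute)
    qed auto
    then have "eventually (\<lambda>i. \<bar>L (n i) (z i)\<bar> < e) sequentially"
      by (intro order_tendstoD(2)[OF tendsto_rabs_zero] e)
    then obtain i where i: "\<bar>L (n i) (z i)\<bar> < e"
      using eventually_happens'[OF sequentially_bot] by blast
    have "L (n i) (z i) = L (n i) (cut (J (Suc i)) (x (n i))) - L (n i) (cut (J i) (x (n i)))"
      unfolding z_def by (rule dual_diff[OF LE cutX[OF xX] cutX[OF xX]])
    then show False using i sel(3)[of i] by (simp add: R_def)
  qed
  then show thesis using that unfolding cut_def by blast
qed

text \<open>If this failed, there would be disjoint sets \<open>S i\<close> inside
  \<open>V J\<close> on which \<open>x (n i)\<close> keeps mass more than \<open>e\<close>.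
  Integration against signs on these sets gives functionals whose absolute values sum to at most the
  integral of \<open>\<bar>f\<bar>\<close> over the \<open>J\<close> blocks, hence to at most
  \<open>real J * Q f\<close>.\<close>

lemma weakly_null_absolutely_continuous:
  assumes x: "weakly_null X Q x" and A: "\<And>n. A n \<in> sets M" "decseq A" "A 0 \<subseteq> V J"
    and null: "AE t in M. t \<notin> (\<Inter>n. A n)" and e: "e > 0"
  obtains N where "\<And>n. n \<ge> N \<Longrightarrow> (\<integral>t. indicator (A N) t * \<bar>x n t\<bar> \<partial>M) \<le> e"
proof -
  have xX: "x n \<in> X" for n using x by (simp add: weakly_null_def)
  note [measurable] = A(1) X_meas[OF xX]
  have A_mono: "A m \<subseteq> A n" if "n \<le> m" for n m using A(2) that by (auto simp: decseq_def)
  have AV: "A n \<subseteq> V J" for n using A_mono[of 0 n] A(3) by auto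
  have dom: "integrable M (\<lambda>t. s t * f t)" "\<bar>\<integral>t. s t * f t \<partial>M\<bar> \<le> (\<integral>t. indicator S t * \<bar>f t\<bar> \<partial>M)"
    "integrable M (\<lambda>t. indicator S t * \<bar>f t\<bar>)"
    if f: "f \<in> X" and s: "s \<in> borel_measurable M" "\<And>t. \<bar>s t\<bar> \<le> indicator S t" and S: "S \<in> sets M" "S \<subseteq> V J" for f s S
  proof -
    have [measurable]: "f \<in> borel_measurable M" using f by (rule X_meas)
    note [measurable] = s(1) S(1)
    have b: "\<bar>s t * f t\<bar> \<le> indicator S t * \<bar>f t\<bar>" for t
      using s(2)[of t] by (simp add: abs_mult mult_right_mono)
    show i: "integrable M (\<lambda>t. indicator S t * \<bar>f t\<bar>)"
      by (rule Bochner_Integration.integrable_bound[OF V_int_abs[OF f, of J]]) (use S(2) in \<open>auto simp: indicator_def\<close>)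
    show i2: "integrable M (\<lambda>t. s t * f t)"
      by (rule Bochner_Integration.integrable_bound[OF i]) (use b in auto)
    have "\<bar>\<integral>t. s t * f t \<partial>M\<bar> \<le> (\<integral>t. \<bar>s t * f t\<bar> \<partial>M)" by (rule integral_abs_bound)
    also have "\<dots> \<le> (\<integral>t. indicator S t * \<bar>f t\<bar> \<partial>M)" by (rule integral_mono[OF integrable_abs[OF i2] i b])
    finally show "\<bar>\<integral>t. s t * f t \<partial>M\<bar> \<le> (\<integral>t. indicator S t * \<bar>f t\<bar> \<partial>M)" .
  qed
  have "\<exists>N. \<forall>n\<ge>N. (\<integral>t. indicator (A N) t * \<bar>x n t\<bar> \<partial>M) \<le> e"
  proof (rule ccontr)
    assume neg: "\<not> ?thesis"
    define R where "R N n N' \<longleftrightarrow> e < (\<integral>t. indicator (A N - A N') t * \<bar>x n t\<bar> \<partial>M)" for N n N'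
    have "\<exists>n\<ge>N. \<exists>N'>n. R N n N'" for N
    proof -
      obtain n where n: "n \<ge> N" "e < (\<integral>t. indicator (A N) t * \<bar>x n t\<bar> \<partial>M)"
        using neg by (auto simp: not_le)
      \<comment> \<open>For fixed \<open>n\<close> the removed sets shrink to a null set, so some
        \<open>A N'\<close> can be removed while more than \<open>e\<close> remains.\<close>
      have "(\<lambda>N'. \<integral>t. indicator (A N - A N') t * \<bar>x n t\<bar> \<partial>M) \<longlonglongrightarrow> (\<integral>t. indicator (A N) t * \<bar>x n t\<bar> \<partial>M)"
      proof (rule integral_dominated_convergence[where w = "\<lambda>t. indicator (V J) t * \<bar>x n t\<bar>"])
        show "AE t in M. (\<lambda>N'. indicator (A N - A N') t * \<bar>x n t\<bar>) \<longlonglongrightarrow> indicator (A N) t * \<bar>x n t\<bar>"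
          using null
        proof eventually_elim
          case (elim t)
          then obtain m where m: "t \<notin> A m" by blast
          have "eventually (\<lambda>N'. indicator (A N - A N') t * \<bar>x n t\<bar> = indicator (A N) t * \<bar>x n t\<bar>) sequentially"
            unfolding eventually_sequentially
          proof (intro exI[of _ m] allI impI)
            fix N' assume "m \<le> N'"
            then have "t \<notin> A N'" using m A_mono by blast
            then show "indicator (A N - A N') t * \<bar>x n t\<bar> = indicator (A N) t * \<bar>x n t\<bar>"
              by (simp add: indicator_def)
          qed
          then show ?case by (rule tendsto_eventually)
        qed
        show "AE t in M. norm (indicator (A N - A N') t * \<bar>x n t\<bar>) \<le> indicator (V J) t * \<bar>x n t\<bar>" for N'
          using AV[of N] by (intro AE_I2) (auto simp: indicator_def)
      qed (use V_int_abs[OF xX] in measurable)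
      from order_tendstoD(1)[OF this n(2)]
      obtain N' where "\<And>k. k \<ge> N' \<Longrightarrow> R N n k" by (auto simp: eventually_sequentially R_def)
      then have "R N n (max N' (Suc n))" by simp
      then show ?thesis using n(1) by (intro exI[of _ n] conjI exI[of _ "max N' (Suc n)"]) auto
    qed
    then obtain N n where sel: "\<And>i. N i \<le> n i" "\<And>i. n i < N (Suc i)" "\<And>i. R (N i) (n i) (N (Suc i))"
      "strict_mono n" "strict_mono N"
      by (rule increasing_selection) blast
    define S where "S i = A (N i) - A (N (Suc i))" for i
    have [measurable]: "S i \<in> sets M" for i unfolding S_def by measurable
    have SV: "S i \<subseteq> V J" for i using AV by (auto simp: S_def)
    define s where "s i t = indicator (S i) t * sgn (x (n i) t)" for i t
    have [measurable]: "s i \<in> borel_measurable M" for i unfolding s_def by measurable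
    have s_le: "\<bar>s i t\<bar> \<le> indicator (S i) t" for i t by (auto simp: s_def indicator_def sgn_real_def)
    note domS = dom[OF _ _ s_le _ SV, simplified]
    \<comment> \<open>Telescoping along the decreasing sets encodes at once that the
      \<open>S i\<close> are disjoint and lie in \<open>A (N 0)\<close>.\<close>
    have S_sum: "(\<Sum>i<m. indicator (S i) t :: real) = indicator (A (N 0)) t - indicator (A (N m)) t" for m t
    proof (induction m)
      case (Suc m)
      have "A (N (Suc m)) \<subseteq> A (N m)" using sel(5) by (intro A_mono) (simp add: strict_mono_less_eq)
      then have "indicator (S m) t = indicator (A (N m)) t - (indicator (A (N (Suc m))) t :: real)"
        by (auto simp: S_def indicator_def)
      then show ?case using Suc by simp
    qed simp
    have "(\<lambda>i. \<integral>t. s i t * x (n i) t \<partial>M) \<longlonglongrightarrow> 0"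
    proof (rule weakly_null_diagonal[OF weakly_null_subseq[OF x sel(4)], where K = "real J"])
      fix i f g assume "f \<in> X" "g \<in> X"
      then show "(\<integral>t. s i t * (f t + g t) \<partial>M) = (\<integral>t. s i t * f t \<partial>M) + (\<integral>t. s i t * g t \<partial>M)"
        using domS(1) by (simp add: distrib_left)
    next
      fix i c f assume "f \<in> X"
      show "(\<integral>t. s i t * (c * f t) \<partial>M) = c * (\<integral>t. s i t * f t \<partial>M)" by (simp add: mult.left_commute)
    next
      fix m f assume f: "f \<in> X"
      have "(\<Sum>i<m. \<bar>\<integral>t. s i t * f t \<partial>M\<bar>) \<le> (\<Sum>i<m. \<integral>t. indicator (S i) t * \<bar>f t\<bar> \<partial>M)"
        by (intro sum_mono domS f)
      also have "\<dots> = (\<integral>t. (\<Sum>i<m. indicator (S i) t * \<bar>f t\<bar>) \<partial>M)"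
        by (rule Bochner_Integration.integral_sum[symmetric]) (rule domS(3)[OF f])
      also have "\<dots> \<le> (\<integral>t. indicator (V J) t * \<bar>f t\<bar> \<partial>M)"
      proof (rule integral_mono)
        show "integrable M (\<lambda>t. \<Sum>i<m. indicator (S i) t * \<bar>f t\<bar>)"
          by (intro Bochner_Integration.integrable_sum domS f)
        show "(\<Sum>i<m. indicator (S i) t * \<bar>f t\<bar>) \<le> indicator (V J) t * \<bar>f t\<bar>" for t
          unfolding sum_distrib_right[symmetric] S_sum
          using AV[of "N 0"] by (intro mult_right_mono) (auto simp: indicator_def)
      qed (rule V_int_abs[OF f])
      also have "\<dots> \<le> real J * Q f" by (rule integral_V_le[OF f])
      finally show "(\<Sum>i<m. \<bar>\<integral>t. s i t * f t \<partial>M\<bar>) \<le> real J * Q f" .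
    qed
    then have "eventually (\<lambda>i. (\<integral>t. s i t * x (n i) t \<partial>M) < e) sequentially"
      by (rule order_tendstoD(2)[OF _ e])
    then obtain i where i: "(\<integral>t. s i t * x (n i) t \<partial>M) < e"
      using eventually_happens'[OF sequentially_bot] by blast
    have "(\<integral>t. s i t * x (n i) t \<partial>M) = (\<integral>t. indicator (S i) t * \<bar>x (n i) t\<bar> \<partial>M)"
      by (intro Bochner_Integration.integral_cong) (auto simp: s_def sgn_real_def)
    then show False using i sel(3)[of i] by (simp add: R_def S_def)
  qed
  then show thesis using that by blast
qed

text \<open>On functions supported in \<open>V J\<close> the seminorm is at most the L1 norm, so
  \<open>L\<close> acts there as a bounded functional on an L1 space of finite measure.\<close>

lemma V_density:
  assumes L: "L \<in> E"
  obtains g where "g \<in> borel_measurable M" "\<And>t. \<bar>g t\<bar> \<le> D L"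
    "\<And>f. f \<in> borel_measurable M \<Longrightarrow> integrable M (\<lambda>t. indicator (V J) t * f t) \<Longrightarrow>
      L (\<lambda>t. indicator (V J) t * f t) = (\<integral>t. indicator (V J) t * (f t * g t) \<partial>M)"
proof -
  \<comment> \<open>A density, unlike a restricted space, keeps the sigma-algebra of
    \<open>M\<close>, so the resulting \<open>g\<close> is measurable for \<open>M\<close>
    itself.\<close>
  define M' where "M' = density M (\<lambda>x. ennreal (indicator (V J) x))"
  have "emeasure M' (space M') = emeasure M (V J)"
    unfolding M'_def by (simp add: emeasure_density ennreal_indicator)
  then have fm: "finite_measure M'" using V_fin[of J] by (intro finite_measureI) simp
  have meas: "f \<in> borel_measurable M" if "integrable M' f" for f :: "'a \<Rightarrow> real"
    using borel_measurable_integrable[OF that] by (simp add: M'_def)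
  have int_iff: "integrable M' f \<longleftrightarrow> integrable M (\<lambda>t. indicator (V J) t * f t)"
    if "f \<in> borel_measurable M" for f :: "'a \<Rightarrow> real"
    unfolding M'_def using that by (subst integrable_density) auto
  have int_eq: "(\<integral>t. f t \<partial>M') = (\<integral>t. indicator (V J) t * f t \<partial>M)"
    if "f \<in> borel_measurable M" for f :: "'a \<Rightarrow> real"
    unfolding M'_def using that by (subst integral_density) auto
  have cX: "(\<lambda>t. indicator (V J) t * f t) \<in> X" if "integrable M' f" for f
    using V_cut_X(1) meas[OF that] int_iff[OF meas[OF that]] that by blast
  obtain g where g: "g \<in> borel_measurable M'" "\<And>t. \<bar>g t\<bar> \<le> D L"
    "\<And>f. integrable M' f \<Longrightarrow> L (\<lambda>t. indicator (V J) t * f t) = (\<integral>t. f t * g t \<partial>M')"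
  proof (rule finite_measure.L1_functional_density[OF fm, of "\<lambda>f. L (\<lambda>t. indicator (V J) t * f t)" "D L"])
    fix f g :: "'a \<Rightarrow> real" assume "integrable M' f" "integrable M' g"
    then show "L (\<lambda>t. indicator (V J) t * (f t + g t)) =
        L (\<lambda>t. indicator (V J) t * f t) + L (\<lambda>t. indicator (V J) t * g t)"
      using dual_add[OF L cX cX] by (simp add: distrib_left)
  next
    fix c and f :: "'a \<Rightarrow> real" assume "integrable M' f"
    then show "L (\<lambda>t. indicator (V J) t * (c * f t)) = c * L (\<lambda>t. indicator (V J) t * f t)"
      using dual_scale[OF L cX] by (simp add: mult.left_commute)
  next
    fix f :: "'a \<Rightarrow> real" assume f: "integrable M' f"
    have "\<bar>L (\<lambda>t. indicator (V J) t * f t)\<bar> \<le> D L * Q (\<lambda>t. indicator (V J) t * f t)"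
      by (rule dual_norm_ge[OF L cX[OF f]])
    also have "\<dots> \<le> D L * (\<integral>t. indicator (V J) t * \<bar>f t\<bar> \<partial>M)"
      using V_cut_X(2) meas[OF f] int_iff[OF meas[OF f]] f dual_norm_nonneg[OF L]
      by (intro mult_left_mono) auto
    finally show "\<bar>L (\<lambda>t. indicator (V J) t * f t)\<bar> \<le> D L * (\<integral>t. \<bar>f t\<bar> \<partial>M')"
      using meas[OF f] by (subst int_eq) auto
  qed (use dual_norm_nonneg[OF L] in \<open>auto intro: that\<close>)
  have gM: "g \<in> borel_measurable M" using g(1) by (simp add: M'_def)
  show thesis
  proof (rule that[OF gM g(2)])
    fix f :: "'a \<Rightarrow> real" assume f: "f \<in> borel_measurable M" "integrable M (\<lambda>t. indicator (V J) t * f t)"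
    have "(\<lambda>t. f t * g t) \<in> borel_measurable M" using f gM by measurable
    then show "L (\<lambda>t. indicator (V J) t * f t) = (\<integral>t. indicator (V J) t * (f t * g t) \<partial>M)"
      using g(3)[of f] int_iff[OF f(1)] f(2) int_eq by simp
  qed
qed

text \<open>Almost every point evaluation is bounded on the span of the densities, hence extends to a
  functional on the whole dual space; this is why a weakly null sequence of functionals
  has densities converging to zero almost everywhere.\<close>

lemma weakly_null_densities_tendsto:
  assumes L: "weakly_null E D L"
    and g: "\<And>n. g n \<in> borel_measurable M" "\<And>n t. \<bar>g n t\<bar> \<le> D (L n)"
    and rep: "\<And>n f. f \<in> borel_measurable M \<Longrightarrow> integrable M (\<lambda>t. indicator (V J) t * f t) \<Longrightarrow>
      L n (\<lambda>t. indicator (V J) t * f t) = (\<integral>t. indicator (V J) t * (f t * g n t) \<partial>M)"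
  shows "AE t in M. t \<in> V J \<longrightarrow> (\<lambda>n. g n t) \<longlonglongrightarrow> 0"
proof -
  have LE: "L n \<in> E" for n using L by (simp add: weakly_null_def)
  note [measurable] = g(1)
  have finV: "emeasure M S < \<infinity>" if "S \<subseteq> V J" "S \<in> sets M" for S
    using emeasure_mono[OF that(1) V_sets] V_fin[of J] by (rule le_less_trans)
  have ind: "integrable M (\<lambda>t. indicator (V J) t * indicator A t :: real)" if "A \<in> sets M" for A
  proof -
    have "integrable M (indicator (V J \<inter> A) :: 'a \<Rightarrow> real)"
      using finV[of "V J \<inter> A"] that by (subst integrable_indicator_iff) auto
    moreover have "indicator (V J \<inter> A) = (\<lambda>t. indicator (V J) t * indicator A t :: real)"
      by (auto simp: indicator_def fun_eq_iff)
    ultimately show ?thesis by simp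
  qed
  have indg: "integrable M (\<lambda>t. indicator (V J) t * (indicator A t * g n t))" if A: "A \<in> sets M" for A n
  proof (rule Bochner_Integration.integrable_bound)
    show "integrable M (\<lambda>t. D (L n) * (indicator (V J) t * indicator A t))" using ind[OF A] by simp
    show "AE t in M. norm (indicator (V J) t * (indicator A t * g n t)) \<le> norm (D (L n) * (indicator (V J) t * indicator A t))"
      using order_trans[OF g(2)[of n] abs_ge_self] by (intro AE_I2) (auto simp: indicator_def)
  qed (use A in measurable)
  \<comment> \<open>The combination of the \<open>g i\<close> is the density of the combined
    functional on \<open>V J\<close>. Its integral over a set \<open>A\<close> is that functional at
    an indicator, whose seminorm is at most the measure of \<open>A\<close>.\<close>
  have bd: "AE t in M. t \<in> V J \<longrightarrow> \<bar>\<Sum>i<length as. of_rat (as ! i) * g i t\<bar> \<le>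
      D (\<lambda>f. \<Sum>i<length as. of_rat (as ! i) * L i f)" for as :: "rat list"
  proof -
    define h where "h t = indicator (V J) t * (\<Sum>i<length as. of_rat (as ! i) * g i t)" for t
    define Lc where "Lc = (\<lambda>f. \<Sum>i<length as. of_rat (as ! i) * L i f)"
    have LcE: "Lc \<in> E" unfolding Lc_def by (intro dual_comb LE)
    define M' where "M' = restrict_space M (V J)"
    have fm: "finite_measure M'"
      unfolding M'_def using V_fin[of J] sets.sets_into_space[OF V_sets]
      by (intro finite_measureI) (simp add: space_restrict_space emeasure_restrict_space Int_absorb2)
    have sM': "A \<in> sets M'  \<longleftrightarrow> A \<in> sets M \<and> A \<subseteq> V J" for A
      unfolding M'_def by (subst sets_restrict_space_iff) auto
    have iM': "integrable M' f \<longleftrightarrow> integrable M (\<lambda>t. indicator (V J) t * f t)"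
      "(\<integral>t. f t \<partial>M') = (\<integral>t. indicator (V J) t * f t \<partial>M)" for f :: "'a \<Rightarrow> real"
      unfolding M'_def by (subst integrable_restrict_space integral_restrict_space; simp)+
    have hA: "integrable M (\<lambda>t. indicator (V J) t * (indicator A t * h t))"
      "(\<integral>t. indicator (V J) t * (indicator A t * h t) \<partial>M) = Lc (\<lambda>t. indicator (V J) t * indicator A t)"
      if A: "A \<in> sets M" for A
    proof -
      have eq: "indicator (V J) t * (indicator A t * h t) =
         (\<Sum>i<length as. of_rat (as ! i) * (indicator (V J) t * (indicator A t * g i t)))" for t
        by (simp add: h_def sum_distrib_left indicator_def algebra_simps)
      show "integrable M (\<lambda>t. indicator (V J) t * (indicator A t * h t))"
        unfolding eq using indg[OF A] by (intro Bochner_Integration.integrable_sum integrable_mult_right) auto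
      have "(\<integral>t. indicator (V J) t * (indicator A t * h t) \<partial>M) =
         (\<Sum>i<length as. \<integral>t. of_rat (as ! i) * (indicator (V J) t * (indicator A t * g i t)) \<partial>M)"
        unfolding eq using indg[OF A] by (intro Bochner_Integration.integral_sum integrable_mult_right) auto
      also have "\<dots> = Lc (\<lambda>t. indicator (V J) t * indicator A t)"
        unfolding Lc_def using A ind[OF A] by (intro sum.cong) (auto simp: rep)
      finally show "(\<integral>t. indicator (V J) t * (indicator A t * h t) \<partial>M) = Lc (\<lambda>t. indicator (V J) t * indicator A t)" .
    qed
    have "AE t in M'. \<bar>h t\<bar> \<le> D Lc"
    proof (rule finite_measure.AE_abs_le_of_set_integral_le[OF fm])
      show "integrable M' h"
        unfolding iM'
      proof (rule Bochner_Integration.integrable_cong[THEN iffD1, OF refl _ hA(1)[OF V_sets[of J]]])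
        show "indicator (V J) t * (indicator (V J) t * h t) = indicator (V J) t * h t" for t
          by (simp add: indicator_def)
      qed
      fix A assume "A \<in> sets M'"
      then have A: "A \<in> sets M" "A \<subseteq> V J" by (auto simp: sM')
      have AX: "(\<lambda>t. indicator (V J) t * indicator A t) \<in> X"
        and AQ: "Q (\<lambda>t. indicator (V J) t * indicator A t) \<le> (\<integral>t. indicator (V J) t * \<bar>indicator A t\<bar> \<partial>M)"
        using V_cut_X[of "indicator A" J] A ind[OF A(1)] by auto
      have "(\<lambda>t. indicator (V J) t * \<bar>indicator A t :: real\<bar>) = indicator A"
        using A(2) by (auto simp: indicator_def fun_eq_iff)
      then have AQ': "Q (\<lambda>t. indicator (V J) t * indicator A t) \<le> measure M' A"
        using AQ A unfolding M'_def by (subst measure_restrict_space) auto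
      have "\<bar>\<integral>t. indicator A t * h t \<partial>M'\<bar> = \<bar>Lc (\<lambda>t. indicator (V J) t * indicator A t)\<bar>"
        unfolding iM' hA(2)[OF A(1)] ..
      also have "\<dots> \<le> D Lc * Q (\<lambda>t. indicator (V J) t * indicator A t)" by (rule dual_norm_ge[OF LcE AX])
      also have "\<dots> \<le> D Lc * measure M' A" using AQ' dual_norm_nonneg[OF LcE] by (rule mult_left_mono)
      finally show "\<bar>\<integral>t. indicator A t * h t \<partial>M'\<bar> \<le> D Lc * measure M' A" .
    qed
    then have "AE t in M. t \<in> V J \<longrightarrow> \<bar>h t\<bar> \<le> D Lc"
      unfolding M'_def by (subst (asm) AE_restrict_space_iff) auto
    then show ?thesis by eventually_elim (simp add: h_def Lc_def)
  qed
  \<comment> \<open>Lists of rationals are countable, so a single null set serves all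
    combinations.\<close>
  have "AE t in M. \<forall>as :: rat list. t \<in> V J \<longrightarrow> \<bar>\<Sum>i<length as. of_rat (as ! i) * g i t\<bar> \<le>
      D (\<lambda>f. \<Sum>i<length as. of_rat (as ! i) * L i f)"
    unfolding AE_all_countable using bd by blast
  then show ?thesis
  proof eventually_elim
    case (elim t)
    show ?case
    proof
      assume "t \<in> V J"
      then obtain \<Phi> where \<Phi>: "bounded_lin_fun E D \<Phi>" "\<And>n. \<Phi> (L n) = g n t"
        using dual_interpolation[of L "\<lambda>n. g n t"] LE elim by blast
      then show "(\<lambda>n. g n t) \<longlonglongrightarrow> 0" using L by (auto simp: weakly_null_def)
    qed
  qed
qed

text \<open>\<open>L n (x n)\<close> splits into the tail beyond \<open>V J\<close>, the part of
  \<open>V J\<close> where some later density exceeds \<open>\<delta>\<close>, and the rest; each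
  contributes at most \<open>r / 4\<close>.\<close>

theorem dunford_pettis_c0_sum_L1: "dunford_pettis X Q"
  unfolding dunford_pettis_def
proof (intro allI impI)
  fix x L assume x: "weakly_null X Q x" and L: "weakly_null E D L"
  have xX: "x n \<in> X" for n using x by (simp add: weakly_null_def)
  have LE: "L n \<in> E" for n using L by (simp add: weakly_null_def)
  obtain B where B: "\<And>n. Q (x n) \<le> B" using weakly_null_X_bounded[OF x] by blast
  obtain K where K: "\<And>n. D (L n) \<le> K" using weakly_null_dual_bounded[OF L] by blast
  have B0: "0 \<le> B" using order_trans[OF Q_nonneg[OF xX] B] .
  have K0: "0 \<le> K" using order_trans[OF dual_norm_nonneg[OF LE] K] .
  show "(\<lambda>n. L n (x n)) \<longlonglongrightarrow> 0"
  proof (rule LIMSEQ_I)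
    fix r :: real assume r: "r > 0"
    obtain J where J: "\<And>n. n \<ge> J \<Longrightarrow> \<bar>L n (x n) - L n (\<lambda>t. indicator (V J) t * x n t)\<bar> \<le> r / 4"
      using dual_tail_small[OF x L, of "r / 4"] r by auto
    define dens where "dens n g \<longleftrightarrow> g \<in> borel_measurable M \<and> (\<forall>t. \<bar>g t\<bar> \<le> D (L n)) \<and>
        (\<forall>f. f \<in> borel_measurable M \<longrightarrow> integrable M (\<lambda>t. indicator (V J) t * f t) \<longrightarrow>
          L n (\<lambda>t. indicator (V J) t * f t) = (\<integral>t. indicator (V J) t * (f t * g t) \<partial>M))" for n g
    have "\<exists>g. dens n g" for n
    proof (rule V_density[OF LE, of n J])
      fix g assume "g \<in> borel_measurable M" "\<And>t. \<bar>g t\<bar> \<le> D (L n)"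
        "\<And>f. f \<in> borel_measurable M \<Longrightarrow> integrable M (\<lambda>t. indicator (V J) t * f t) \<Longrightarrow>
          L n (\<lambda>t. indicator (V J) t * f t) = (\<integral>t. indicator (V J) t * (f t * g t) \<partial>M)"
      then have "dens n g" by (simp add: dens_def)
      then show ?thesis by blast
    qed
    then obtain g where dens: "\<And>n. dens n (g n)" by metis
    have g: "\<And>n. g n \<in> borel_measurable M" "\<And>n t. \<bar>g n t\<bar> \<le> D (L n)"
      "\<And>n f. f \<in> borel_measurable M \<Longrightarrow> integrable M (\<lambda>t. indicator (V J) t * f t) \<Longrightarrow>
        L n (\<lambda>t. indicator (V J) t * f t) = (\<integral>t. indicator (V J) t * (f t * g n t) \<partial>M)"
      using dens by (simp_all add: dens_def)
    note [measurable] = g(1)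
    have g0: "AE t in M. t \<in> V J \<longrightarrow> (\<lambda>n. g n t) \<longlonglongrightarrow> 0"
      using L g by (rule weakly_null_densities_tendsto)
    \<comment> \<open>\<open>real J * B\<close> bounds the integral of
      \<open>\<bar>x n\<bar>\<close> over \<open>V J\<close>, and \<open>K\<close> will bound the
      densities; adding 1 keeps the denominators positive.\<close>
    define \<delta> where "\<delta> = r / (4 * (real J * B + 1))"
    have JB: "0 \<le> real J * B" using B0 by simp
    have \<delta>: "\<delta> > 0" "\<delta> * (real J * B) \<le> r / 4" using r JB by (auto simp: \<delta>_def field_simps)
    define \<epsilon> where "\<epsilon> = r / (4 * (K + 1))"
    have \<epsilon>: "\<epsilon> > 0" "K * \<epsilon> \<le> r / 4" using r K0 by (auto simp: \<epsilon>_def field_simps)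
    \<comment> \<open>The exceptional sets of Egorov's argument: they decrease, and almost
      everywhere convergence of the densities makes their intersection null. The integrals of
      \<open>\<bar>x n\<bar>\<close> over them are small by uniform integrability.\<close>
    define A where "A N = {t \<in> space M. t \<in> V J \<and> (\<exists>m\<in>{N..}. \<delta> < \<bar>g m t\<bar>)}" for N
    have A: "A N \<in> sets M" for N unfolding A_def by measurable
    have "decseq A" unfolding decseq_def A_def by auto
    moreover have "A 0 \<subseteq> V J" by (auto simp: A_def)
    moreover have "AE t in M. t \<notin> (\<Inter>N. A N)"
      using g0
    proof eventually_elim
      case (elim t)
      show ?case
      proof
        assume t: "t \<in> (\<Inter>N. A N)"
        then have "t \<in> V J" by (auto simp: A_def)
        then have "eventually (\<lambda>n. \<bar>g n t\<bar> < \<delta>) sequentially"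
          using elim \<delta>(1) by (intro order_tendstoD(2)[OF tendsto_rabs_zero]) auto
        then obtain N where "\<And>n. n \<ge> N \<Longrightarrow> \<bar>g n t\<bar> < \<delta>" by (auto simp: eventually_sequentially)
        then have "t \<notin> A N" by (auto simp: A_def not_less less_imp_le)
        then show False using t by blast
      qed
    qed
    ultimately obtain N where N: "\<And>n. n \<ge> N \<Longrightarrow> (\<integral>t. indicator (A N) t * \<bar>x n t\<bar> \<partial>M) \<le> \<epsilon>"
      using weakly_null_absolutely_continuous[where A = A and J = J and e = \<epsilon>, OF x A] \<epsilon>(1) by blast
    have "norm (L n (x n) - 0) < r" if n: "n \<ge> max J N" for n
    proof -
      note [measurable] = X_meas[OF xX, of n] A
      have iA: "integrable M (\<lambda>t. indicator (A N) t * \<bar>x n t\<bar>)"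
        by (rule Bochner_Integration.integrable_bound[OF V_int_abs[OF xX, of J n]]) (auto simp: A_def indicator_def)
      have iR: "integrable M (\<lambda>t. K * (indicator (A N) t * \<bar>x n t\<bar>) + \<delta> * (indicator (V J) t * \<bar>x n t\<bar>))"
        using iA V_int_abs[OF xX] by simp
      have b: "\<bar>indicator (V J) t * (x n t * g n t)\<bar> \<le>
          K * (indicator (A N) t * \<bar>x n t\<bar>) + \<delta> * (indicator (V J) t * \<bar>x n t\<bar>)"
        if t: "t \<in> space M" for t
      proof (cases "t \<in> V J")
        case V: True
        show ?thesis
        proof (cases "t \<in> A N")
          case True
          have "\<bar>x n t\<bar> * \<bar>g n t\<bar> \<le> \<bar>x n t\<bar> * K"
            using order_trans[OF g(2) K] by (intro mult_left_mono) auto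
          moreover have "0 \<le> \<delta> * \<bar>x n t\<bar>" using \<delta>(1) by simp
          ultimately show ?thesis using V True by (simp add: abs_mult mult.commute)
        next
          case False
          then have "\<bar>g n t\<bar> \<le> \<delta>" using V t n by (auto simp: A_def not_less)
          then have "\<bar>x n t\<bar> * \<bar>g n t\<bar> \<le> \<bar>x n t\<bar> * \<delta>" by (intro mult_left_mono) auto
          then show ?thesis using V False by (simp add: abs_mult mult.commute)
        qed
      qed (simp add: A_def)
      have iL: "integrable M (\<lambda>t. indicator (V J) t * (x n t * g n t))"
      proof (rule Bochner_Integration.integrable_bound[OF iR])
        show "AE t in M. norm (indicator (V J) t * (x n t * g n t)) \<le>
            norm (K * (indicator (A N) t * \<bar>x n t\<bar>) + \<delta> * (indicator (V J) t * \<bar>x n t\<bar>))"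
          unfolding real_norm_def by (rule AE_I2) (rule order_trans[OF b abs_ge_self])
      qed measurable
      have "\<bar>L n (\<lambda>t. indicator (V J) t * x n t)\<bar> = \<bar>\<integral>t. indicator (V J) t * (x n t * g n t) \<partial>M\<bar>"
        using g(3)[OF _ V_int[OF xX]] X_meas[OF xX] by simp
      also have "\<dots> \<le> (\<integral>t. \<bar>indicator (V J) t * (x n t * g n t)\<bar> \<partial>M)" by (rule integral_abs_bound)
      also have "\<dots> \<le> (\<integral>t. K * (indicator (A N) t * \<bar>x n t\<bar>) + \<delta> * (indicator (V J) t * \<bar>x n t\<bar>) \<partial>M)"
        by (rule integral_mono[OF integrable_abs[OF iL] iR b])
      also have "\<dots> = K * (\<integral>t. indicator (A N) t * \<bar>x n t\<bar> \<partial>M) + \<delta> * (\<integral>t. indicator (V J) t * \<bar>x n t\<bar> \<partial>M)"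
        using iA V_int_abs[OF xX] by simp
      also have "\<dots> \<le> K * \<epsilon> + \<delta> * (real J * B)"
      proof (intro add_mono mult_left_mono)
        show "(\<integral>t. indicator (A N) t * \<bar>x n t\<bar> \<partial>M) \<le> \<epsilon>" using N n by simp
        show "(\<integral>t. indicator (V J) t * \<bar>x n t\<bar> \<partial>M) \<le> real J * B"
          using integral_V_le[OF xX, of J n] mult_left_mono[OF B[of n], of "real J"] by simp
      qed (use K0 \<delta> in auto)
      also have "\<dots> \<le> r / 2" using \<epsilon>(2) \<delta>(2) by simp
      finally have "\<bar>L n (\<lambda>t. indicator (V J) t * x n t)\<bar> \<le> r / 2" .
      moreover have "\<bar>L n (x n) - L n (\<lambda>t. indicator (V J) t * x n t)\<bar> \<le> r / 4" using J n by simp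
      ultimately have "\<bar>L n (x n)\<bar> \<le> r / 2 + r / 4" by linarith
      then show ?thesis using r by simp
    qed
    then show "\<exists>no. \<forall>n\<ge>no. norm (L n (x n) - 0) < r" by blast
  qed
qed

end

section \<open>Weights with dilation index below one\<close>

text \<open>If the dilation function satisfied \<open>phibar \<phi> s = s\<close> for all \<open>s > 1\<close>, the quotient in the
  definition of the index would be constantly 1.\<close>

lemma q_index_less_1_dilation:
  assumes pos: "\<And>t. 0 < t \<Longrightarrow> 0 < \<phi> t"
    and anti: "\<And>u t. 0 < u \<Longrightarrow> u \<le> t \<Longrightarrow> \<phi> t / t \<le> \<phi> u / u"
    and mono: "\<And>u t. 0 < u \<Longrightarrow> u \<le> t \<Longrightarrow> \<phi> u \<le> \<phi> t"
    and q: "q_index \<phi> < 1"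
  obtains s a where "1 < s" "1 \<le> a" "a < s" "\<And>t. 0 < t \<Longrightarrow> \<phi> (s * t) \<le> a * \<phi> t"
proof -
  have le: "\<phi> (s * t) / \<phi> t \<le> s" if "1 < s" "0 < t" for s t
    using anti[of t "s * t"] pos[of t] that by (simp add: field_simps)
  have bdd: "bdd_above ((\<lambda>t. \<phi> (s * t) / \<phi> t) ` {0<..})" if "1 < s" for s
    using le[OF that] by (intro bdd_aboveI2) auto
  \<comment> \<open>One strict improvement over the trivial bound \<open>s\<close> suffices. The
    contradiction evaluates \<open>Lim\<close> only at an eventually constant function, where its
    value is certain.\<close>
  have "\<exists>s>1. phibar \<phi> s < s"
  proof (rule ccontr)
    assume *: "\<not> ?thesis"
    have "phibar \<phi> s = s" if s: "1 < s" for s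
    proof (rule antisym)
      show "phibar \<phi> s \<le> s" unfolding phibar_def using le[OF s] by (intro cSUP_least) auto
      show "s \<le> phibar \<phi> s" using * s by auto
    qed
    then have "eventually (\<lambda>s. ln (phibar \<phi> s) / ln s = 1) at_top"
      by (intro eventually_mono[OF eventually_gt_at_top[of 1]]) simp
    then have "q_index \<phi> = 1"
      unfolding q_index_def by (intro tendsto_Lim tendsto_eventually) auto
    then show False using q by simp
  qed
  then obtain s where s: "1 < s" "phibar \<phi> s < s" by blast
  have up: "\<phi> (s * t) / \<phi> t \<le> phibar \<phi> s" if "0 < t" for t
    unfolding phibar_def using that by (intro cSUP_upper[OF _ bdd[OF s(1)]]) auto
  \<comment> \<open>This lower bound makes the exponent \<open>log s a\<close> nonnegative.\<close>
  have "1 \<le> \<phi> (s * 1) / \<phi> 1" using mono[of 1 s] pos[of 1] s by simp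
  also have "\<dots> \<le> phibar \<phi> s" by (rule up) simp
  finally show thesis
  proof (rule that[OF s(1) _ s(2)])
    fix t :: real assume "0 < t"
    then show "\<phi> (s * t) \<le> phibar \<phi> s * \<phi> t" using up[of t] pos[of t] by (simp add: field_simps)
  qed
qed

text \<open>With \<open>s ^ k \<le> t / u < s ^ Suc k\<close>, iterating the dilation bound gives
  the factor \<open>a ^ Suc k\<close>. Since \<open>a = s powr log s a\<close>, the part
  \<open>a ^ k\<close> is at most the power of \<open>t / u\<close>; the remaining \<open>a\<close>
  is the constant in front.\<close>

lemma dilation_power_bound:
  assumes pos: "\<And>t. 0 < t \<Longrightarrow> 0 < \<phi> t"
    and mono: "\<And>u t. 0 < u \<Longrightarrow> u \<le> t \<Longrightarrow> \<phi> u \<le> \<phi> t"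
    and s: "1 < s" "1 \<le> a" and dil: "\<And>t. 0 < t \<Longrightarrow> \<phi> (s * t) \<le> a * \<phi> t"
    and ut: "0 < u" "u \<le> t"
  shows "\<phi> t \<le> a * (t / u) powr log s a * \<phi> u"
proof -
  have it: "\<phi> (s ^ n * u) \<le> a ^ n * \<phi> u" for n
  proof (induction n)
    case (Suc n)
    have "\<phi> (s * (s ^ n * u)) \<le> a * \<phi> (s ^ n * u)" using s ut by (intro dil) simp
    also have "\<dots> \<le> a * (a ^ n * \<phi> u)" using Suc s by (intro mult_left_mono) auto
    finally show ?case by (simp add: mult.assoc)
  qed simp
  define k where "k = nat \<lfloor>log s (t / u)\<rfloor>"
  have l0: "0 \<le> log s (t / u)" using s ut by (simp add: le_divide_eq)
  then have k: "real k \<le> log s (t / u)" "log s (t / u) < real (Suc k)"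
    unfolding k_def by (auto simp: floor_correct) linarith
  have tu: "s powr log s (t / u) = t / u" using s ut by simp
  have "t / u < s powr real (Suc k)" using k(2) s tu by (metis powr_less_mono)
  then have "t / u < s ^ Suc k" using s powr_realpow[of s "Suc k"] by simp
  then have "t \<le> s ^ Suc k * u" using ut by (simp add: field_simps)
  then have "\<phi> t \<le> a ^ Suc k * \<phi> u" using mono[of t "s ^ Suc k * u"] it[of "Suc k"] ut by simp
  also have "a ^ Suc k \<le> a * (t / u) powr log s a"
  proof -
    have "a ^ k = a powr real k" using s by (simp add: powr_realpow)
    also have "\<dots> = (s powr log s a) powr real k" using s by simp
    also have "\<dots> = (s powr real k) powr log s a" by (simp add: powr_powr mult.commute)
    also have "\<dots> \<le> (t / u) powr log s a"
    proof (rule powr_mono2)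
      show "0 \<le> log s a" using s by simp
      show "s powr real k \<le> t / u" using powr_mono[OF k(1), of s] s tu by simp
    qed simp
    finally show ?thesis using s by simp
  qed
  finally show ?thesis using pos[OF ut(1)] by (simp add: mult_right_mono)
qed

section \<open>Limits along dyadic indices\<close>

lemma id_borel_measurable_lebesgue [measurable]: "(\<lambda>x::real. x) \<in> borel_measurable lebesgue"
  by (rule measurable_completion) simp

text \<open>The blocks of the c0-sum are numbered by naturals, the dyadic intervals by integers.
  Along a bijection, convergence means that exceptional sets are finite, and finite sets of integers
  are bounded on both sides.\<close>

lemma int_tendsto_of_decode:
  fixes b :: "int \<Rightarrow> real"
  assumes "(\<lambda>m. b (int_decode m)) \<longlonglongrightarrow> 0"
  shows "(b \<longlongrightarrow> 0) at_top" "(b \<longlongrightarrow> 0) at_bot"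
proof -
  have fin: "finite {k. \<not> dist (b k) 0 < e}" if "0 < e" for e
  proof -
    have "eventually (\<lambda>m. dist (b (int_decode m)) 0 < e) cofinite"
      unfolding cofinite_eq_sequentially using assms that by (simp add: tendsto_iff)
    then have "finite (int_encode -` {m. \<not> dist (b (int_decode m)) 0 < e})"
      by (intro finite_vimageI inj_int_encode) (simp add: eventually_cofinite)
    then show ?thesis by (simp add: vimage_def)
  qed
  show "(b \<longlongrightarrow> 0) at_top"
    unfolding tendsto_iff
  proof (intro allI impI)
    fix e :: real assume "0 < e"
    then obtain u where u: "\<And>k. \<not> dist (b k) 0 < e \<Longrightarrow> k \<le> u"
      using bdd_above_finite[OF fin] by (auto simp: bdd_above_def)
    show "eventually (\<lambda>k. dist (b k) 0 < e) at_top"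
    proof (rule eventually_mono[OF eventually_gt_at_top[of u]])
      fix k assume "u < k"
      then show "dist (b k) 0 < e" using u[of k] by linarith
    qed
  qed
  show "(b \<longlongrightarrow> 0) at_bot"
    unfolding tendsto_iff
  proof (intro allI impI)
    fix e :: real assume "0 < e"
    then obtain u where u: "\<And>k. \<not> dist (b k) 0 < e \<Longrightarrow> u \<le> k"
      using bdd_below_finite[OF fin] by (auto simp: bdd_below_def)
    show "eventually (\<lambda>k. dist (b k) 0 < e) at_bot"
    proof (rule eventually_mono[OF eventually_le_at_bot[of "u - 1"]])
      fix k assume "k \<le> u - 1"
      then show "dist (b k) 0 < e" using u[of k] by linarith
    qed
  qed
qed

lemma decode_tendsto_of_int:
  fixes b :: "int \<Rightarrow> real"
  assumes "(b \<longlongrightarrow> 0) at_top" "(b \<longlongrightarrow> 0) at_bot"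
  shows "(\<lambda>m. b (int_decode m)) \<longlonglongrightarrow> 0"
  unfolding tendsto_iff
proof (intro allI impI)
  fix e :: real assume e: "0 < e"
  obtain u where u: "\<And>k. u \<le> k \<Longrightarrow> dist (b k) 0 < e"
    using assms(1) e unfolding tendsto_iff eventually_at_top_linorder by blast
  obtain v where v: "\<And>k. k \<le> v \<Longrightarrow> dist (b k) 0 < e"
    using assms(2) e unfolding tendsto_iff eventually_at_bot_linorder by blast
  have "{k. \<not> dist (b k) 0 < e} \<subseteq> {v..u}"
  proof
    fix k assume "k \<in> {k. \<not> dist (b k) 0 < e}"
    then have "\<not> u \<le> k" "\<not> k \<le> v" using u[of k] v[of k] by auto
    then show "k \<in> {v..u}" by simp
  qed
  then have "finite {k. \<not> dist (b k) 0 < e}" by (rule finite_subset) simp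
  then have "finite (int_decode -` {k. \<not> dist (b k) 0 < e})" by (intro finite_vimageI inj_int_decode)
  then show "eventually (\<lambda>m. dist (b (int_decode m)) 0 < e) sequentially"
    unfolding cofinite_eq_sequentially[symmetric] eventually_cofinite by (simp add: vimage_def)
qed

lemma floor_log_at_top: "filterlim (\<lambda>t::real. \<lfloor>log 2 t\<rfloor>) at_top at_top"
  unfolding filterlim_at_top
proof
  fix Z :: int
  show "eventually (\<lambda>t::real. Z \<le> \<lfloor>log 2 t\<rfloor>) at_top"
  proof (rule eventually_mono[OF eventually_ge_at_top[of "2 powr of_int Z"]])
    fix t :: real assume t: "2 powr of_int Z \<le> t"
    have "0 < t" using less_le_trans[OF _ t, of 0] by simp
    then have "of_int Z \<le> log 2 t" using t by (simp add: le_log_iff)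
    then show "Z \<le> \<lfloor>log 2 t\<rfloor>" by (simp add: le_floor_iff)
  qed
qed

lemma floor_log_at_right_0: "filterlim (\<lambda>t::real. \<lfloor>log 2 t\<rfloor>) at_bot (at_right 0)"
  unfolding filterlim_at_bot
proof
  fix Z :: int
  have "eventually (\<lambda>t. t \<in> {0<..<2 powr of_int Z}) (at_right (0::real))"
    by (rule eventually_at_right_real) simp
  then show "eventually (\<lambda>t::real. \<lfloor>log 2 t\<rfloor> \<le> Z) (at_right 0)"
  proof eventually_elim
    case (elim t)
    then have "log 2 t < of_int Z" by (simp add: log_less_iff)
    then show ?case by linarith
  qed
qed

lemma powr_int_at_top: "filterlim (\<lambda>k::int. 2 powr (of_int k + 1) :: real) at_top at_top"
  unfolding filterlim_at_top
proof
  fix Z :: real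
  show "eventually (\<lambda>k::int. Z \<le> 2 powr (of_int k + 1)) at_top"
  proof (rule eventually_mono[OF eventually_ge_at_top[of "\<lceil>log 2 (max 1 Z)\<rceil>"]])
    fix k :: int assume "\<lceil>log 2 (max 1 Z)\<rceil> \<le> k"
    then have "log 2 (max 1 Z) \<le> of_int k + 1" by linarith
    then have "max 1 Z \<le> 2 powr (of_int k + 1)" by (simp add: log_le_iff)
    then show "Z \<le> 2 powr (of_int k + 1)" by simp
  qed
qed

lemma powr_int_at_bot: "filterlim (\<lambda>k::int. 2 powr (of_int k + 1) :: real) (at_right 0) at_bot"
  unfolding filterlim_at
proof (intro conjI)
  show "eventually (\<lambda>k::int. 2 powr (of_int k + 1) \<in> {0::real<..} \<and> 2 powr (of_int k + 1) \<noteq> (0::real)) at_bot"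
    by simp
  show "((\<lambda>k::int. 2 powr (of_int k + 1)) \<longlongrightarrow> (0::real)) at_bot"
    unfolding tendsto_iff
  proof (intro allI impI)
    fix e :: real assume e: "0 < e"
    show "eventually (\<lambda>k::int. dist (2 powr (of_int k + 1)) (0::real) < e) at_bot"
    proof (rule eventually_mono[OF eventually_le_at_bot[of "\<lfloor>log 2 e\<rfloor> - 2"]])
      fix k :: int assume "k \<le> \<lfloor>log 2 e\<rfloor> - 2"
      then have "of_int k + 1 < log 2 e" by linarith
      then have "2 powr (of_int k + 1) < e" using e by (simp add: less_log_iff)
      then show "dist (2 powr (of_int k + 1)) (0::real) < e" by (simp add: dist_real_def)
    qed
  qed
qed

section \<open>Marcinkiewicz norm estimates under a power bound\<close>

locale power_bounded_weight =
  fixes \<phi> :: "real \<Rightarrow> real" and C p :: real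
  assumes pos: "0 < t \<Longrightarrow> 0 < \<phi> t"
    and anti: "0 < u \<Longrightarrow> u \<le> t \<Longrightarrow> \<phi> t / t \<le> \<phi> u / u"
    and mono: "0 < u \<Longrightarrow> u \<le> t \<Longrightarrow> \<phi> u \<le> \<phi> t"
    and lim0: "(\<phi> \<longlongrightarrow> 0) (at_right 0)"
    and C: "1 \<le> C" and p: "0 \<le> p" "p < 1"
    and power_bound: "0 < u \<Longrightarrow> u \<le> t \<Longrightarrow> \<phi> t \<le> C * (t / u) powr p * \<phi> u"
begin

text \<open>The factor \<open>1 / (1 - p)\<close> is the integral of \<open>s powr (- p)\<close>
  from 0 to 1.\<close>

definition hardy :: real where "hardy = C / (1 - p)"

lemma hardy_pos: "0 < hardy" using C p by (simp add: hardy_def)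

text \<open>The power bound with \<open>u = s\<close> reads
  \<open>1 / \<phi> s \<le> C * (t / s) powr p / \<phi> t\<close>, and \<open>s powr (- p)\<close>
  is integrable at 0 because \<open>p < 1\<close>.\<close>

lemma inverse_weight_integral:
  assumes t: "0 < t"
  shows "(\<integral>\<^sup>+s. ennreal (1 / \<phi> s) * indicator {0<..t} s \<partial>lborel) \<le> ennreal (hardy * t / \<phi> t)"
proof -
  define c where "c = C * t powr p / \<phi> t"
  have c0: "0 \<le> c" using C pos[OF t] by (simp add: c_def)
  have le: "1 / \<phi> s \<le> c * s powr (- p)" if "0 < s" "s \<le> t" for s
  proof -
    have "\<phi> t \<le> (C * t powr p * s powr (- p)) * \<phi> s"
      using power_bound[OF that] that t by (simp add: powr_divide powr_minus field_simps)
    then show ?thesis using pos[OF t] pos[OF that(1)] by (simp add: c_def field_simps)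
  qed
  have hi: "((\<lambda>s. s powr (- p)) has_integral (t powr (- p + 1) / (- p + 1))) {0..t}"
    using p t by (intro has_integral_powr_from_0) auto
  have "((\<lambda>s. if s \<in> {0..t} then c * s powr (- p) else 0) has_integral (c * (t powr (- p + 1) / (- p + 1)))) UNIV"
    using has_integral_mult_right[OF hi, of c] by (subst has_integral_restrict_UNIV)
  from nn_integral_has_integral_lborel[OF _ _ this]
  have I: "(\<integral>\<^sup>+s. ennreal (if s \<in> {0..t} then c * s powr (- p) else 0) \<partial>lborel) = ennreal (c * (t powr (- p + 1) / (- p + 1)))"
    using c0 by auto
  have "(\<integral>\<^sup>+s. ennreal (1 / \<phi> s) * indicator {0<..t} s \<partial>lborel) \<le>
      (\<integral>\<^sup>+s. ennreal (if s \<in> {0..t} then c * s powr (- p) else 0) \<partial>lborel)"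
    using le by (intro nn_integral_mono) (auto simp: indicator_def intro!: ennreal_leI)
  also have "\<dots> = ennreal (hardy * t / \<phi> t)"
  proof -
    have "t powr p * t powr (- p + 1) = t" using t by (simp add: powr_add[symmetric])
    then have "c * (t powr (- p + 1) / (- p + 1)) = C * t / \<phi> t / (1 - p)"
      by (simp add: c_def)
    then show ?thesis unfolding I by (simp add: hardy_def mult.commute)
  qed
  finally show ?thesis .
qed

text \<open>The hypothesis \<open>small\<close> is a weak-type bound: the rearrangement at
  \<open>s\<close> is at most \<open>K / \<phi> s\<close>. Integrating \<open>1 / \<phi>\<close>
  turns it into a bound on averages, at the cost of \<open>hardy\<close>.\<close>

lemma marc_norm_le:
  assumes K: "0 \<le> K"
    and small: "\<And>s. 0 < s \<Longrightarrow> emeasure lebesgue {x. 0 \<le> x \<and> ennreal (K / \<phi> s) < ennreal \<bar>f x\<bar>} \<le> ennreal s"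
  shows "marc_norm \<phi> f \<le> ennreal (K * hardy)"
  unfolding marc_norm_def
proof (rule SUP_least)
  fix t :: real assume "t \<in> {0<..}"
  then have t: "0 < t" by simp
  have r: "rearr f s \<le> ennreal (K / \<phi> s)" if "0 < s" for s
    unfolding rearr_def using small[OF that] by (intro Inf_lower) simp
  have "(\<integral>\<^sup>+s. rearr f s * indicator {0..t} s \<partial>lborel) \<le> (\<integral>\<^sup>+s. ennreal K * (ennreal (1 / \<phi> s) * indicator {0<..t} s) \<partial>lborel)"
  proof (rule nn_integral_mono_AE)
    \<comment> \<open>The closed interval in the norm contains 0, where the hypothesis gives no
      bound on the rearrangement.\<close>
    have "AE s in lborel. s \<noteq> (0::real)" by (rule AE_lborel_singleton)
    then show "AE s in lborel. rearr f s * indicator {0..t} s \<le> ennreal K * (ennreal (1 / \<phi> s) * indicator {0<..t} s)"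
    proof eventually_elim
      case (elim s)
      show ?case
      proof (cases "s \<in> {0<..t}")
        case True
        then have "ennreal K * ennreal (1 / \<phi> s) = ennreal (K / \<phi> s)"
          using K pos[of s] by (simp add: ennreal_mult'[symmetric])
        then show ?thesis using r[of s] True by simp
      qed (use elim in \<open>auto simp: indicator_def\<close>)
    qed
  qed
  also have "\<dots> = ennreal K * (\<integral>\<^sup>+s. ennreal (1 / \<phi> s) * indicator {0<..t} s \<partial>lborel)"
  proof (rule nn_integral_cmult)
    \<comment> \<open>Monotonicity of \<open>\<phi>\<close> is known on the positive half-line; the
      extension by 0 is monotone everywhere, hence Borel.\<close>
    have "(\<lambda>s. if 0 < s then \<phi> s else 0) \<in> borel_measurable borel"
      by (intro borel_measurable_mono monoI) (auto simp: mono less_imp_le pos)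
    then have [measurable]: "(\<lambda>s. ennreal (1 / (if 0 < s then \<phi> s else 0)) * indicator {0<..t} s) \<in> borel_measurable borel"
      by measurable
    have "(\<lambda>s. ennreal (1 / \<phi> s) * indicator {0<..t} s) = (\<lambda>s. ennreal (1 / (if 0 < s then \<phi> s else 0)) * indicator {0<..t} s)"
      by (auto simp: indicator_def fun_eq_iff)
    then show "(\<lambda>s. ennreal (1 / \<phi> s) * indicator {0<..t} s) \<in> borel_measurable lborel" by simp
  qed
  also have "\<dots> \<le> ennreal K * ennreal (hardy * t / \<phi> t)"
    by (intro mult_left_mono inverse_weight_integral t) simp
  finally have "ennreal (\<phi> t / t) * (\<integral>\<^sup>+s. rearr f s * indicator {0..t} s \<partial>lborel) \<le>
      ennreal (\<phi> t / t) * (ennreal K * ennreal (hardy * t / \<phi> t))"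
    by (intro mult_left_mono) auto
  also have "\<dots> = ennreal (\<phi> t / t * (K * (hardy * t / \<phi> t)))"
    using pos[OF t] t K hardy_pos by (simp add: ennreal_mult[symmetric])
  also have "\<phi> t / t * (K * (hardy * t / \<phi> t)) = K * hardy"
    using pos[OF t] t by simp
  finally show "ennreal (\<phi> t / t) * (\<integral>\<^sup>+s. rearr f s * indicator {0..t} s \<partial>lborel) \<le> ennreal (K * hardy)" .
qed

text \<open>The interval from \<open>t\<close> to \<open>2 * t\<close> has length \<open>t\<close>,
  so for \<open>s < t\<close> no level below \<open>c\<close> is admissible in the infimum defining
  the rearrangement at \<open>s\<close>.\<close>

lemma marc_norm_ge:
  assumes f: "f \<in> borel_measurable lebesgue" and t: "0 < t" and c: "0 \<le> c"
    and ge: "\<And>x. t \<le> x \<Longrightarrow> x \<le> 2 * t \<Longrightarrow> c \<le> \<bar>f x\<bar>"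
  shows "ennreal (\<phi> t * c) \<le> marc_norm \<phi> f"
proof -
  have r: "ennreal c \<le> rearr f s" if s: "s < t" "0 \<le> s" for s
    unfolding rearr_def
  proof (rule Inf_greatest)
    fix l assume "l \<in> {l. emeasure lebesgue {x. 0 \<le> x \<and> l < ennreal \<bar>f x\<bar>} \<le> ennreal s}"
    then have l: "emeasure lebesgue {x. 0 \<le> x \<and> l < ennreal \<bar>f x\<bar>} \<le> ennreal s" by simp
    show "ennreal c \<le> l"
    proof (rule ccontr)
      assume "\<not> ennreal c \<le> l"
      then have "l < ennreal c" by simp
      then have sub: "{t..2 * t} \<subseteq> {x. 0 \<le> x \<and> l < ennreal \<bar>f x\<bar>}"
        using ge t by (auto intro: less_le_trans ennreal_leI)
      have "{x \<in> space lebesgue. 0 \<le> x \<and> l < ennreal \<bar>f x\<bar>} \<in> sets lebesgue"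
        using f[measurable] by measurable
      then have "emeasure lebesgue {t..2 * t} \<le> emeasure lebesgue {x. 0 \<le> x \<and> l < ennreal \<bar>f x\<bar>}"
        using sub by (intro emeasure_mono) auto
      then have "ennreal t \<le> ennreal s" using l t by simp
      then show False using s t by (simp add: ennreal_le_iff)
    qed
  qed
  have "ennreal (\<phi> t * c) = ennreal (\<phi> t / t) * (ennreal c * ennreal t)"
    using t c pos[OF t] by (simp add: ennreal_mult[symmetric])
  also have "ennreal c * ennreal t = (\<integral>\<^sup>+s. ennreal c * indicator {0..t} s \<partial>lborel)"
    using t by (simp add: nn_integral_cmult)
  also have "\<dots> \<le> (\<integral>\<^sup>+s. rearr f s * indicator {0..t} s \<partial>lborel)"
  proof (rule nn_integral_mono_AE)
    have "AE s in lborel. s \<noteq> t" by (rule AE_lborel_singleton)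
    then show "AE s in lborel. ennreal c * indicator {0..t} s \<le> rearr f s * indicator {0..t} s"
      by eventually_elim (auto simp: indicator_def r)
  qed
  finally have "ennreal (\<phi> t * c) \<le> ennreal (\<phi> t / t) * (\<integral>\<^sup>+s. rearr f s * indicator {0..t} s \<partial>lborel)"
    by (simp add: mult_left_mono)
  also have "\<dots> \<le> marc_norm \<phi> f" unfolding marc_norm_def using t by (intro SUP_upper) simp
  finally show ?thesis .
qed

section \<open>The Cesaro--Marcinkiewicz space as a c0-sum\<close>

definition locally_int :: "(real \<Rightarrow> real) \<Rightarrow> bool" where
  "locally_int f \<longleftrightarrow> (\<forall>x>0. set_integrable lebesgue {0..x} f)"

definition primitive :: "(real \<Rightarrow> real) \<Rightarrow> real \<Rightarrow> real" where
  "primitive f x = (LINT t:{0..x}|lebesgue. \<bar>f t\<bar>)"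

text \<open>This is \<open>\<phi>\<close> times the Cesaro mean of \<open>\<bar>f\<bar>\<close>. Its
  supremum over positive \<open>t\<close> is equivalent to the norm and free of
  rearrangements.\<close>

definition h :: "(real \<Rightarrow> real) \<Rightarrow> real \<Rightarrow> real" where
  "h f t = \<phi> t / t * primitive f t"

lemma primitive_nonneg: "0 \<le> primitive f x"
  unfolding primitive_def set_lebesgue_integral_def by (intro integral_nonneg_AE AE_I2) auto

lemma locally_int_abs: "locally_int f \<Longrightarrow> 0 < x \<Longrightarrow> integrable lebesgue (\<lambda>t. indicator {0..x} t * \<bar>f t\<bar>)"
  using set_integrable_abs[of lebesgue "{0..x}" f] by (simp add: locally_int_def set_integrable_def)

lemma primitive_mono:
  assumes "locally_int f" "0 < x" "x \<le> y" shows "primitive f x \<le> primitive f y"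
  unfolding primitive_def set_lebesgue_integral_def real_scaleR_def
  using assms by (intro integral_mono locally_int_abs) (auto simp: indicator_def)

lemma cesaro_eq: "0 < x \<Longrightarrow> cesaro (\<lambda>t. \<bar>f t\<bar>) x = primitive f x / x"
  by (simp add: cesaro_def primitive_def)

lemma cesaro_nonneg: "0 \<le> cesaro (\<lambda>t. \<bar>f t\<bar>) x"
  using primitive_nonneg[of f x] by (cases "0 < x") (simp_all add: cesaro_eq, simp add: cesaro_def)

lemma h_eq: "0 < t \<Longrightarrow> h f t = \<phi> t * cesaro (\<lambda>t. \<bar>f t\<bar>) t"
  by (simp add: h_def cesaro_eq)

lemma h_nonneg: "0 < t \<Longrightarrow> 0 \<le> h f t"
  using pos[of t] cesaro_nonneg[of f t] by (simp add: h_eq)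

lemma cesaro_measurable:
  assumes "locally_int f" shows "cesaro (\<lambda>t. \<bar>f t\<bar>) \<in> borel_measurable lebesgue"
proof (rule measurable_completion)
  have m: "(\<lambda>x. if 0 < x then primitive f x else 0) \<in> borel_measurable borel"
    using primitive_nonneg primitive_mono[OF assms] by (intro borel_measurable_mono monoI) auto
  have "cesaro (\<lambda>t. \<bar>f t\<bar>) = (\<lambda>x. (if 0 < x then primitive f x else 0) / x)"
    by (auto simp: fun_eq_iff cesaro_eq) (simp add: cesaro_def)
  then show "cesaro (\<lambda>t. \<bar>f t\<bar>) \<in> borel_measurable lborel" using m by simp
qed

text \<open>From \<open>t\<close> to \<open>x\<close> the primitive grows while the denominator at
  most doubles.\<close>

lemma cesaro_half:
  assumes "locally_int f" "0 < t" "t \<le> x" "x \<le> 2 * t"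
  shows "cesaro (\<lambda>t. \<bar>f t\<bar>) t / 2 \<le> cesaro (\<lambda>t. \<bar>f t\<bar>) x"
proof -
  have "primitive f t / (2 * t) \<le> primitive f x / x"
    using assms primitive_mono[OF assms(1-3)] primitive_nonneg[of f t] by (intro frac_le) auto
  then show ?thesis using assms by (simp add: cesaro_eq)
qed

text \<open>A value of the mean at \<open>t\<close> controls it from below on an interval of length
  \<open>t\<close>, which a rearrangement can detect. \<open>A\<close> stays general:
  \<open>UNIV\<close> gives the norm bound, shrinking sets give the limits at 0 and at
  infinity.\<close>

lemma h_le_marc_norm:
  assumes f: "locally_int f" and A: "A \<in> sets lebesgue" "{t..2 * t} \<subseteq> A" and t: "0 < t"
  shows "ennreal (h f t / 2) \<le> marc_norm \<phi> (\<lambda>x. cesaro (\<lambda>t. \<bar>f t\<bar>) x * indicator A x)"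
proof -
  have m: "(\<lambda>x. cesaro (\<lambda>t. \<bar>f t\<bar>) x * indicator A x) \<in> borel_measurable lebesgue"
    using cesaro_measurable[OF f] A(1) by measurable
  have "ennreal (\<phi> t * (cesaro (\<lambda>t. \<bar>f t\<bar>) t / 2)) \<le> marc_norm \<phi> (\<lambda>x. cesaro (\<lambda>t. \<bar>f t\<bar>) x * indicator A x)"
  proof (rule marc_norm_ge[OF m t])
    show "0 \<le> cesaro (\<lambda>t. \<bar>f t\<bar>) t / 2" using cesaro_nonneg by simp
    fix x assume x: "t \<le> x" "x \<le> 2 * t"
    then have "x \<in> A" using A(2) by auto
    then show "cesaro (\<lambda>t. \<bar>f t\<bar>) t / 2 \<le> \<bar>cesaro (\<lambda>t. \<bar>f t\<bar>) x * indicator A x\<bar>"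
      using cesaro_half[OF f t x] by simp
  qed
  then show ?thesis using t by (simp add: h_eq)
qed

text \<open>Order continuity is tested on two sequences: the half-lines from \<open>n\<close>, with
  empty intersection, and the intervals from 0 to \<open>inverse (real (Suc n))\<close>, which
  shrink to a point. They yield the limits of \<open>h f\<close> at infinity and at 0.\<close>

lemma CesM0D:
  assumes f: "f \<in> CesM0 \<phi>"
  shows "locally_int f" "f \<in> borel_measurable lebesgue"
    "0 < t \<Longrightarrow> h f t \<le> 2 * ces_norm \<phi> f"
    "(h f \<longlongrightarrow> 0) at_top" "(h f \<longlongrightarrow> 0) (at_right 0)"
proof -
  show lf: "locally_int f" and "f \<in> borel_measurable lebesgue" using f by (auto simp: CesM0_def locally_int_def)
  let ?G = "cesaro (\<lambda>t. \<bar>f t\<bar>)"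
  have G: "?G \<in> Marc0 \<phi>" using f by (simp add: CesM0_def)
  then have fin: "marc_norm \<phi> ?G < \<infinity>" by (simp add: Marc0_def Marc_def)
  have oc: "((\<lambda>n. marc_norm \<phi> (\<lambda>x. ?G x * indicator (A n) x)) \<longlongrightarrow> 0) sequentially"
    if "\<And>n. A n \<in> sets lebesgue" "\<And>n. A n \<subseteq> {0..}" "decseq A" "emeasure lebesgue (\<Inter>n. A n) = 0" for A :: "nat \<Rightarrow> real set"
    using G that unfolding Marc0_def by blast
  have small: "\<exists>n. \<forall>t. 0 < t \<longrightarrow> {t..2 * t} \<subseteq> A n \<longrightarrow> \<bar>h f t\<bar> < e"
    if A: "\<And>n. A n \<in> sets lebesgue" "\<And>n. A n \<subseteq> {0..}" "decseq A" "emeasure lebesgue (\<Inter>n. A n) = 0"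
      and e: "0 < e" for A :: "nat \<Rightarrow> real set" and e
  proof -
    have "eventually (\<lambda>n. marc_norm \<phi> (\<lambda>x. ?G x * indicator (A n) x) < ennreal (e / 2)) sequentially"
      using e by (intro order_tendstoD(2)[OF oc[OF A]]) simp
    then obtain n where n: "marc_norm \<phi> (\<lambda>x. ?G x * indicator (A n) x) < ennreal (e / 2)"
      using eventually_happens'[OF sequentially_bot] by blast
    have "\<bar>h f t\<bar> < e" if t: "0 < t" "{t..2 * t} \<subseteq> A n" for t
    proof -
      have "ennreal (h f t / 2) < ennreal (e / 2)"
        using h_le_marc_norm[OF lf A(1)[of n] t(2,1)] n by (rule le_less_trans)
      then show ?thesis using h_nonneg[OF t(1), of f] by (simp add: ennreal_less_iff)
    qed
    then show ?thesis by blast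
  qed
  show "h f t \<le> 2 * ces_norm \<phi> f" if t: "0 < t"
  proof -
    have "ennreal (h f t / 2) \<le> marc_norm \<phi> ?G"
      using h_le_marc_norm[OF lf, of UNIV t] t by simp
    also have "\<dots> = ennreal (ces_norm \<phi> f)" using fin by (simp add: ces_norm_def)
    finally show ?thesis by (simp add: ces_norm_def ennreal_le_iff)
  qed
  show "(h f \<longlongrightarrow> 0) at_top"
    unfolding tendsto_iff
  proof (intro allI impI)
    fix e :: real assume e: "0 < e"
    have "(\<Inter>n. {real n..}) = {}"
    proof -
      have "x \<notin> (\<Inter>n. {real n..})" for x
        using reals_Archimedean2[of x] by (auto simp: not_le)
      then show ?thesis by blast
    qed
    then obtain n where n: "\<And>t. 0 < t \<Longrightarrow> {t..2 * t} \<subseteq> {real n..} \<Longrightarrow> \<bar>h f t\<bar> < e"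
      using small[of "\<lambda>n. {real n..}" e] e by (auto simp: decseq_def)
    have "eventually (\<lambda>t. 0 < t \<and> real n \<le> t) at_top"
      by (intro eventually_conj eventually_gt_at_top eventually_ge_at_top)
    then show "eventually (\<lambda>t. dist (h f t) 0 < e) at_top"
      by eventually_elim (use n in \<open>auto simp: dist_real_def\<close>)
  qed
  show "(h f \<longlongrightarrow> 0) (at_right 0)"
    unfolding tendsto_iff
  proof (intro allI impI)
    fix e :: real assume e: "0 < e"
    have "(\<Inter>n. {0..inverse (real (Suc n))}) \<subseteq> {0::real}"
    proof
      fix x assume x: "x \<in> (\<Inter>n. {0..inverse (real (Suc n))})"
      then have "0 \<le> x" "\<And>n. x \<le> inverse (real (Suc n))" by auto
      then show "x \<in> {0}" using reals_Archimedean[of x] by (cases "x = 0") (auto simp: not_less[symmetric])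
    qed
    then have "emeasure lebesgue (\<Inter>n. {0..inverse (real (Suc n))}) \<le> emeasure lebesgue {0::real}"
      by (intro emeasure_mono) auto
    then have null: "emeasure lebesgue (\<Inter>n. {0..inverse (real (Suc n))}) = 0" by simp
    have dec: "decseq (\<lambda>n. {0..inverse (real (Suc n))})"
    proof (rule decseq_SucI)
      show "{0..inverse (real (Suc (Suc n)))} \<subseteq> {0..inverse (real (Suc n))}" for n
        by (auto intro: order_trans simp: field_simps)
    qed
    obtain n where n: "\<And>t. 0 < t \<Longrightarrow> {t..2 * t} \<subseteq> {0..inverse (real (Suc n))} \<Longrightarrow> \<bar>h f t\<bar> < e"
      using small[OF _ _ dec null e] by auto
    have "eventually (\<lambda>t. t \<in> {0<..<inverse (real (Suc n)) / 2}) (at_right 0)"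
      by (rule eventually_at_right_real) simp
    then show "eventually (\<lambda>t. dist (h f t) 0 < e) (at_right 0)"
    proof eventually_elim
      case (elim t)
      then have "\<bar>h f t\<bar> < e" by (intro n) auto
      then show ?case by (simp add: dist_real_def)
    qed
  qed
qed

lemma cesaro_le:
  assumes K: "\<And>t. 0 < t \<Longrightarrow> h f t \<le> K" and "0 < t"
  shows "cesaro (\<lambda>t. \<bar>f t\<bar>) t \<le> K / \<phi> t"
  using K[of t] pos[of t] assms(2) by (simp add: h_eq field_simps)

text \<open>The mean is at most \<open>K / \<phi>\<close>, a decreasing majorant, so it can exceed
  \<open>K / \<phi> s\<close> only at arguments up to \<open>s\<close>; this is the weak-type
  hypothesis.\<close>

lemma cesaro_marc_norm_le:
  assumes K: "\<And>t. 0 < t \<Longrightarrow> h f t \<le> K"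
  shows "marc_norm \<phi> (cesaro (\<lambda>t. \<bar>f t\<bar>)) \<le> ennreal (K * hardy)"
proof (rule marc_norm_le)
  show K0: "0 \<le> K" using order_trans[OF h_nonneg K, of 1] by simp
  fix s :: real assume s: "0 < s"
  have "{x. 0 \<le> x \<and> ennreal (K / \<phi> s) < ennreal \<bar>cesaro (\<lambda>t. \<bar>f t\<bar>) x\<bar>} \<subseteq> {0..s}"
  proof
    fix x assume "x \<in> {x. 0 \<le> x \<and> ennreal (K / \<phi> s) < ennreal \<bar>cesaro (\<lambda>t. \<bar>f t\<bar>) x\<bar>}"
    then have x: "0 \<le> x" "K / \<phi> s < cesaro (\<lambda>t. \<bar>f t\<bar>) x"
      using K0 pos[OF s] cesaro_nonneg[of f x] by (auto simp: ennreal_less_iff)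
    have "x \<le> s"
    proof (rule ccontr)
      assume "\<not> x \<le> s"
      then have "s \<le> x" "0 < x" using s by auto
      then have "K / \<phi> x \<le> K / \<phi> s" using mono[OF s] pos[OF s] K0 by (intro divide_left_mono) (auto intro!: mult_pos_pos pos)
      then show False using cesaro_le[OF K \<open>0 < x\<close>] x(2) by simp
    qed
    then show "x \<in> {0..s}" using x by simp
  qed
  then have "emeasure lebesgue {x. 0 \<le> x \<and> ennreal (K / \<phi> s) < ennreal \<bar>cesaro (\<lambda>t. \<bar>f t\<bar>) x\<bar>} \<le> emeasure lebesgue {0..s}"
    by (intro emeasure_mono) auto
  then show "emeasure lebesgue {x. 0 \<le> x \<and> ennreal (K / \<phi> s) < ennreal \<bar>cesaro (\<lambda>t. \<bar>f t\<bar>) x\<bar>} \<le> ennreal s"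
    using s by simp
qed

text \<open>The weak-type hypothesis is verified with the small constant \<open>e\<close>. Near 0
  and infinity this rests on smallness of \<open>h f\<close>. On the middle interval the mean is
  bounded, so it matters only for \<open>s\<close> at least some \<open>\<sigma>\<close>, and there
  the measure of \<open>A n\<close> eventually falls below \<open>\<sigma> / 2\<close>. Each part
  receives half of the allowed measure \<open>s\<close>.\<close>

lemma cesaro_order_continuous:
  assumes K: "\<And>t. 0 < t \<Longrightarrow> h f t \<le> K"
    and top: "(h f \<longlongrightarrow> 0) at_top" and zero: "(h f \<longlongrightarrow> 0) (at_right 0)"
    and A: "\<And>n. A n \<in> sets lebesgue" "decseq A" "emeasure lebesgue (\<Inter>n. A n) = 0" and e: "0 < e"
  shows "eventually (\<lambda>n. marc_norm \<phi> (\<lambda>x. cesaro (\<lambda>t. \<bar>f t\<bar>) x * indicator (A n) x) \<le> ennreal (e * hardy)) sequentially"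
proof -
  let ?G = "cesaro (\<lambda>t. \<bar>f t\<bar>)"
  have K0: "0 \<le> K" using order_trans[OF h_nonneg K, of 1] by simp
  have "eventually (\<lambda>t. h f t < e / 2) (at_right 0)" using e by (intro order_tendstoD(2)[OF zero]) simp
  then obtain \<delta> where \<delta>: "0 < \<delta>" "\<And>t. 0 < t \<Longrightarrow> t < \<delta> \<Longrightarrow> h f t < e / 2"
    unfolding eventually_at_right_field by blast
  have "eventually (\<lambda>t. h f t < e / 2) at_top" using e by (intro order_tendstoD(2)[OF top]) simp
  then obtain R where R: "\<And>t. R \<le> t \<Longrightarrow> h f t < e / 2"
    unfolding eventually_at_top_linorder by blast
  define K' where "K' = K / \<phi> \<delta> + 1"
  have K': "0 < K'" using K0 pos[OF \<delta>(1)] by (simp add: K'_def add_nonneg_pos)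
  \<comment> \<open>For \<open>s < \<sigma>\<close> the level \<open>e / \<phi> s\<close> exceeds
    \<open>K'\<close>, hence every value of the mean on the middle interval.\<close>
  have "eventually (\<lambda>s. \<phi> s < e / K') (at_right 0)" using e K' by (intro order_tendstoD(2)[OF lim0]) simp
  then obtain \<sigma> where \<sigma>: "0 < \<sigma>" "\<And>s. 0 < s \<Longrightarrow> s < \<sigma> \<Longrightarrow> \<phi> s < e / K'"
    unfolding eventually_at_right_field by blast
  define B where "B n = A n \<inter> {\<delta>..R}" for n
  have Bs: "B n \<in> sets lebesgue" for n unfolding B_def using A(1) by auto
  have "(\<lambda>n. emeasure lebesgue (B n)) \<longlonglongrightarrow> emeasure lebesgue (\<Inter>n. B n)"
  proof (rule Lim_emeasure_decseq)
    show "range B \<subseteq> sets lebesgue" using Bs by auto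
    show "decseq B" using A(2) unfolding B_def decseq_def by blast
    fix n
    have "emeasure lebesgue (B n) \<le> emeasure lebesgue {\<delta>..R}" unfolding B_def by (intro emeasure_mono) auto
    also have "\<dots> < \<infinity>" by (cases "\<delta> \<le> R") auto
    finally show "emeasure lebesgue (B n) \<noteq> \<infinity>" by simp
  qed
  moreover have "emeasure lebesgue (\<Inter>n. B n) = 0"
  proof -
    have "emeasure lebesgue (\<Inter>n. B n) \<le> emeasure lebesgue (\<Inter>n. A n)"
      using A(1) by (intro emeasure_mono sets.countable_INT) (auto simp: B_def)
    then show ?thesis using A(3) by simp
  qed
  ultimately have "eventually (\<lambda>n. emeasure lebesgue (B n) < ennreal (\<sigma> / 2)) sequentially"
    using \<sigma>(1) by (intro order_tendstoD(2)) auto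
  then show ?thesis
  proof eventually_elim
    case (elim n)
    show ?case
    proof (rule marc_norm_le)
      show "0 \<le> e" using e by simp
      fix s :: real assume s: "0 < s"
      let ?S = "{x. 0 \<le> x \<and> ennreal (e / \<phi> s) < ennreal \<bar>?G x * indicator (A n) x\<bar>}"
      have S: "x \<in> {0..s / 2} \<or> (x \<in> B n \<and> \<sigma> \<le> s)" if "x \<in> ?S" for x
      proof -
        have es: "0 < e / \<phi> s" using e pos[OF s] by simp
        have lt: "0 \<le> x" "e / \<phi> s < ?G x * indicator (A n) x"
          using that es cesaro_nonneg[of f x] by (auto simp: ennreal_less_iff)
        then have "x \<in> A n" using es by (cases "x \<in> A n") auto
        then have x: "0 \<le> x" "x \<in> A n" "e / \<phi> s < ?G x" using lt by auto
        show ?thesis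
        proof (cases "x \<in> {\<delta>..R}")
          case True
          then have x0: "0 < x" "\<delta> \<le> x" using \<delta>(1) by auto
          have "?G x \<le> K / \<phi> x" by (rule cesaro_le[OF K x0(1)])
          also have "\<dots> \<le> K / \<phi> \<delta>"
            using mono[OF \<delta>(1) x0(2)] pos[OF \<delta>(1)] pos[OF x0(1)] K0 by (intro divide_left_mono) auto
          also have "\<dots> < K'" by (simp add: K'_def)
          finally have "e / \<phi> s < K'" using x(3) by simp
          then have "e / K' < \<phi> s" using K' pos[OF s] by (simp add: field_simps)
          then have "\<sigma> \<le> s" using \<sigma>(2)[OF s] by (force simp: not_less[symmetric])
          then show ?thesis using True x by (simp add: B_def)
        next
          case False
          show ?thesis
          proof (cases "x = 0")
            case True
            then show ?thesis using s by simp
          next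
            case x1: False
            then have x0: "0 < x" using x by simp
            have "h f x < e / 2" using False \<delta>(2)[OF x0] R[of x] by auto
            \<comment> \<open>The margin in \<open>e / 2\<close> becomes a margin in the argument:
              \<open>\<phi> (2 * x) \<le> 2 * \<phi> x\<close> leads to \<open>2 * x < s\<close>,
              leaving room for the middle part.\<close>
            then have "?G x < e / (2 * \<phi> x)" using pos[OF x0] x0 by (simp add: h_eq field_simps)
            also have "\<dots> \<le> e / \<phi> (2 * x)"
              using anti[of x "2 * x"] x0 pos[of x] pos[of "2 * x"] e by (intro divide_left_mono) (auto simp: field_simps)
            finally have "e / \<phi> s < e / \<phi> (2 * x)" using x(3) by simp
            then have "\<phi> (2 * x) < \<phi> s" using pos[OF s] pos[of "2 * x"] x0 e by (simp add: field_simps)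
            then have "2 * x < s" using mono[OF s, of "2 * x"] by (force simp: not_le[symmetric])
            then show ?thesis using x0 by simp
          qed
        qed
      qed
      show "emeasure lebesgue ?S \<le> ennreal s"
      proof (cases "\<sigma> \<le> s")
        case True
        have "emeasure lebesgue ?S \<le> emeasure lebesgue ({0..s / 2} \<union> B n)"
        proof (rule emeasure_mono)
          show "?S \<subseteq> {0..s / 2} \<union> B n" using S by blast
        qed (use Bs in auto)
        also have "\<dots> \<le> emeasure lebesgue {0..s / 2} + emeasure lebesgue (B n)"
          using Bs by (intro emeasure_subadditive) auto
        also have "\<dots> \<le> ennreal (s / 2) + ennreal (s / 2)"
        proof (rule add_mono)
          show "emeasure lebesgue {0..s / 2} \<le> ennreal (s / 2)" using s by simp
          have "ennreal (\<sigma> / 2) \<le> ennreal (s / 2)" using True by (intro ennreal_leI) simp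
          then show "emeasure lebesgue (B n) \<le> ennreal (s / 2)" using elim by simp
        qed
        also have "\<dots> = ennreal s" using s by (simp add: ennreal_plus[symmetric] del: ennreal_plus)
        finally show ?thesis .
      next
        case False
        have "emeasure lebesgue ?S \<le> emeasure lebesgue {0..s / 2}"
        proof (rule emeasure_mono)
          show "?S \<subseteq> {0..s / 2}" using S False by blast
        qed auto
        also have "\<dots> \<le> ennreal s" using s by (simp add: ennreal_leI)
        finally show ?thesis .
      qed
    qed
  qed
qed

text \<open>Converse of \<open>CesM0D\<close>: boundedness and the two limits of \<open>h f\<close>
  characterise membership, so arbitrary set sequences need no further attention.\<close>

lemma CesM0I:
  assumes f: "f \<in> borel_measurable lebesgue" "locally_int f" and K: "\<And>t. 0 < t \<Longrightarrow> h f t \<le> K"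
    and top: "(h f \<longlongrightarrow> 0) at_top" and zero: "(h f \<longlongrightarrow> 0) (at_right 0)"
  shows "f \<in> CesM0 \<phi>" "ces_norm \<phi> f \<le> K * hardy"
proof -
  let ?G = "cesaro (\<lambda>t. \<bar>f t\<bar>)"
  have K0: "0 \<le> K" using order_trans[OF h_nonneg K, of 1] by simp
  note le = cesaro_marc_norm_le[of f K, OF K]
  then show "ces_norm \<phi> f \<le> K * hardy"
    unfolding ces_norm_def using K0 hardy_pos by (intro enn2real_leI) auto
  have "?G \<in> Marc \<phi>" using cesaro_measurable[OF f(2)] le by (auto simp: Marc_def intro: le_less_trans)
  moreover have "((\<lambda>n. marc_norm \<phi> (\<lambda>x. ?G x * indicator (A n) x)) \<longlongrightarrow> 0) sequentially"
    if A: "\<forall>n. A n \<in> sets lebesgue \<and> A n \<subseteq> {0..}" "decseq A" "emeasure lebesgue (\<Inter>n. A n) = 0" for A :: "nat \<Rightarrow> real set"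
  proof (rule order_tendstoI)
    fix a :: ennreal assume "0 < a"
    then obtain y where y: "0 < y" "y < a" using dense by blast
    define r where "r = enn2real y"
    have "y < top" by (rule order_less_le_trans[OF y(2) top_greatest])
    then have r: "y = ennreal r" "0 < r"
      using y(1) by (simp_all add: r_def enn2real_positive_iff)
    have "eventually (\<lambda>n. marc_norm \<phi> (\<lambda>x. ?G x * indicator (A n) x) \<le> ennreal (r / hardy * hardy)) sequentially"
      using A r(2) hardy_pos by (intro cesaro_order_continuous[OF K top zero]) auto
    then show "eventually (\<lambda>n. marc_norm \<phi> (\<lambda>x. ?G x * indicator (A n) x) < a) sequentially"
      using hardy_pos y(2) r(1) by (auto elim!: eventually_mono)
  qed simp
  ultimately show "f \<in> CesM0 \<phi>" using f unfolding CesM0_def Marc0_def locally_int_def by blast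
qed

section \<open>The weighted measure and its dyadic blocks\<close>

definition w :: "real \<Rightarrow> real" where
  "w x = (if 0 < x then \<phi> x / x else 0)"

lemma w_nonneg: "0 \<le> w x"
  by (cases "0 < x") (simp_all add: w_def less_imp_le pos)

lemma w_pos: "0 < x \<Longrightarrow> 0 < w x"
  using pos[of x] by (simp add: w_def)

lemma w_anti: "0 < u \<Longrightarrow> u \<le> t \<Longrightarrow> w t \<le> w u"
  using anti[of u t] by (simp add: w_def)

lemma w_measurable [measurable]: "w \<in> borel_measurable lebesgue"
proof (rule measurable_completion)
  have m: "(\<lambda>x. if 0 < x then \<phi> x else 0) \<in> borel_measurable borel"
    by (intro borel_measurable_mono monoI) (auto simp: mono less_imp_le pos)
  have "w = (\<lambda>x. (if 0 < x then \<phi> x else 0) / x)" by (auto simp: w_def fun_eq_iff)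
  then show "w \<in> borel_measurable lborel" using m by simp
qed

lemma h_w: "0 < t \<Longrightarrow> h f t = w t * primitive f t"
  by (simp add: h_def w_def)

text \<open>\<open>powr\<close> admits negative exponents, and half-open intervals make membership a
  condition on \<open>\<lfloor>log 2 x\<rfloor>\<close>.\<close>

definition dyad :: "int \<Rightarrow> real set" where
  "dyad k = {2 powr of_int k ..< 2 powr (of_int k + 1)}"

lemma dyad_iff: "x \<in> dyad k \<longleftrightarrow> 0 < x \<and> \<lfloor>log 2 x\<rfloor> = k"
proof (cases "0 < x")
  case True
  then show ?thesis using floor_log_eq_powr_iff[of x 2 k] by (auto simp: dyad_def)
next
  case False
  have "0 < x" if "2 powr of_int k \<le> x" using less_le_trans[OF _ that, of 0] by simp
  then show ?thesis using False by (auto simp: dyad_def)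
qed

lemma dyad_sets [measurable]: "dyad k \<in> sets lebesgue"
  by (simp add: dyad_def)

text \<open>With the weight inside the measure the blocks become plain L1 spaces. As
  \<open>w\<close> vanishes off the positive half-line, negative arguments do not count, in
  agreement with the norm.\<close>

definition M :: "real measure" where
  "M = density lebesgue (\<lambda>x. ennreal (w x))"

lemma sets_M [measurable_cong]: "sets M = sets lebesgue"
  by (simp add: M_def)

lemma borel_measurable_M: "borel_measurable M = borel_measurable lebesgue"
  by (rule measurable_cong_sets) (simp_all add: M_def)

lemma w_dyad_le: "x \<in> dyad k \<Longrightarrow> w x \<le> w (2 powr of_int k)"
  by (rule w_anti) (auto simp: dyad_def)

lemma emeasure_dyad: "emeasure M (dyad k) \<noteq> \<infinity>"
proof -
  have "emeasure M (dyad k) = (\<integral>\<^sup>+x. ennreal (w x) * indicator (dyad k) x \<partial>lebesgue)"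
    unfolding M_def by (subst emeasure_density) auto
  also have "\<dots> \<le> (\<integral>\<^sup>+x. ennreal (w (2 powr of_int k)) * indicator (dyad k) x \<partial>lebesgue)"
    by (intro nn_integral_mono) (auto simp: indicator_def intro!: ennreal_leI w_dyad_le)
  also have "\<dots> = ennreal (w (2 powr of_int k)) * emeasure lebesgue (dyad k)"
    by (simp add: nn_integral_cmult)
  also have "\<dots> < \<infinity>" by (simp add: dyad_def ennreal_mult_less_top)
  finally show ?thesis by simp
qed

sublocale B: c0_sum_L1 M "\<lambda>m. dyad (int_decode m)"
proof
  show "dyad (int_decode k) \<in> sets M" for k by (simp add: sets_M)
  show "disjoint_family (\<lambda>m. dyad (int_decode m))"
    unfolding disjoint_family_on_def
  proof (intro ballI impI)
    fix m n :: nat assume "m \<noteq> n"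
    then have "int_decode m \<noteq> int_decode n" by (simp add: int_decode_eq)
    then show "dyad (int_decode m) \<inter> dyad (int_decode n) = {}" by (auto simp: dyad_iff)
  qed
  show "emeasure M (dyad (int_decode k)) \<noteq> \<infinity>" for k by (rule emeasure_dyad)
qed

text \<open>An integer-indexed copy of the block integral: the enumeration by
  \<open>int_decode\<close> loses the order of the intervals, on which the geometric sum
  depends.\<close>

definition dyadic_block :: "int \<Rightarrow> (real \<Rightarrow> real) \<Rightarrow> real" where
  "dyadic_block k f = (\<integral>x. indicator (dyad k) x * (w x * \<bar>f x\<bar>) \<partial>lebesgue)"

lemma dyadic_block_nonneg: "0 \<le> dyadic_block k f"
  unfolding dyadic_block_def by (intro integral_nonneg_AE AE_I2) (auto simp: w_nonneg)

lemma block_eq_dyadic_block: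
  assumes "f \<in> borel_measurable lebesgue"
  shows "B.block m f = dyadic_block (int_decode m) f"
proof -
  have "B.block m f = (\<integral>x. w x *\<^sub>R (indicator (dyad (int_decode m)) x * \<bar>f x\<bar>) \<partial>lebesgue)"
    unfolding B.block_def unfolding M_def using assms
    by (intro integral_density) (auto simp: w_nonneg)
  then show ?thesis by (simp add: dyadic_block_def mult_ac)
qed

lemma integrable_dyad_iff:
  assumes "f \<in> borel_measurable lebesgue"
  shows "integrable M (\<lambda>x. indicator (dyad k) x * f x) \<longleftrightarrow> integrable lebesgue (\<lambda>x. indicator (dyad k) x * (w x * f x))"
proof -
  have "integrable M (\<lambda>x. indicator (dyad k) x * f x) \<longleftrightarrow> integrable lebesgue (\<lambda>x. w x *\<^sub>R (indicator (dyad k) x * f x))"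
    unfolding M_def using assms by (intro integrable_density) (auto simp: w_nonneg)
  then show ?thesis by (simp add: mult_ac)
qed

text \<open>On a dyadic interval the weight is at most its value at the left end, and monotonicity
  of \<open>\<phi>\<close> bounds this by twice the value at the right end.\<close>

lemma dyadic_block_le_h:
  assumes f: "f \<in> borel_measurable lebesgue" "locally_int f"
  shows "integrable lebesgue (\<lambda>x. indicator (dyad k) x * (w x * f x))"
    "dyadic_block k f \<le> 2 * h f (2 powr (of_int k + 1))"
proof -
  let ?a = "2 powr of_int k :: real" and ?b = "2 powr (of_int k + 1) :: real"
  have b: "?b = 2 * ?a" by (simp add: powr_add)
  have i: "integrable lebesgue (\<lambda>x. w ?a * (indicator {0..?b} x * \<bar>f x\<bar>))"
    using locally_int_abs[OF f(2), of ?b] by simp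
  have le: "\<bar>indicator (dyad k) x * (w x * f x)\<bar> \<le> w ?a * (indicator {0..?b} x * \<bar>f x\<bar>)" for x
  proof (cases "x \<in> dyad k")
    case True
    then have "x \<in> {0..?b}" by (auto simp: dyad_def intro: order_trans[OF powr_ge_zero])
    then show ?thesis using True w_dyad_le[OF True] w_nonneg[of x] by (simp add: abs_mult mult_right_mono)
  qed (simp add: w_nonneg)
  have abs_eq: "indicator (dyad k) x * (w x * \<bar>f x\<bar>) = \<bar>indicator (dyad k) x * (w x * f x)\<bar>" for x
    by (simp add: abs_mult w_nonneg)
  show i2: "integrable lebesgue (\<lambda>x. indicator (dyad k) x * (w x * f x))"
  proof (rule Bochner_Integration.integrable_bound[OF i])
    show "(\<lambda>x. indicator (dyad k) x * (w x * f x)) \<in> borel_measurable lebesgue"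
      using f(1) by measurable
    show "AE x in lebesgue. norm (indicator (dyad k) x * (w x * f x)) \<le> norm (w ?a * (indicator {0..?b} x * \<bar>f x\<bar>))"
      unfolding real_norm_def by (rule AE_I2) (rule order_trans[OF le abs_ge_self])
  qed
  have "dyadic_block k f \<le> (\<integral>x. w ?a * (indicator {0..?b} x * \<bar>f x\<bar>) \<partial>lebesgue)"
    unfolding dyadic_block_def abs_eq by (rule integral_mono[OF integrable_abs[OF i2] i le])
  also have "\<dots> = w ?a * primitive f ?b" by (simp add: primitive_def set_lebesgue_integral_def)
  also have "\<dots> \<le> (2 * w ?b) * primitive f ?b"
  proof (rule mult_right_mono)
    have "\<phi> ?a \<le> \<phi> (2 * ?a)" by (rule mono) auto
    then show "w ?a \<le> 2 * w ?b" unfolding b by (simp add: w_def divide_right_mono)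
  qed (rule primitive_nonneg)
  also have "\<dots> = 2 * h f ?b" by (simp add: h_w)
  finally show "dyadic_block k f \<le> 2 * h f ?b" .
qed

text \<open>The factor gained in the bound on \<open>w t / w x\<close> for each dyadic interval by
  which \<open>x\<close> moves away from \<open>t\<close> to the left.\<close>

definition ratio :: real where "ratio = 2 powr (p - 1)"

lemma ratio_bounds: "0 < ratio" "ratio < 1"
  using p by (auto simp: ratio_def powr_less_one)

text \<open>The power bound gives \<open>w t / w x \<le> C * (x / t) powr (1 - p)\<close>, and
  \<open>x\<close> lies \<open>i\<close> dyadic intervals below \<open>t\<close>.\<close>

lemma w_decay:
  assumes "0 < x" "x \<le> t" and i: "\<lfloor>log 2 x\<rfloor> = \<lfloor>log 2 t\<rfloor> - int i"
  shows "w t \<le> 2 * C * ratio ^ i * w x"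
proof -
  have t: "0 < t" using assms by simp
  \<comment> \<open>Taking floors costs up to one unit of the logarithm; the resulting factor
    \<open>2 powr (1 - p)\<close> is rounded up to 2.\<close>
  have "x / t \<le> 2 powr (1 - real i)"
  proof -
    have "log 2 x < real_of_int \<lfloor>log 2 x\<rfloor> + 1" "real_of_int \<lfloor>log 2 t\<rfloor> \<le> log 2 t" by linarith+
    moreover have "real_of_int \<lfloor>log 2 x\<rfloor> = real_of_int \<lfloor>log 2 t\<rfloor> - real i" using i by simp
    ultimately have "log 2 x - log 2 t \<le> 1 - real i" by linarith
    then have "log 2 (x / t) \<le> 1 - real i" using assms t by (simp add: log_divide)
    then show ?thesis using assms t by (simp add: log_le_iff)
  qed
  then have "(x / t) powr (1 - p) \<le> (2 powr (1 - real i)) powr (1 - p)"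
    using assms t p by (intro powr_mono2) auto
  also have "\<dots> = 2 powr (1 - p) * ratio ^ i"
  proof -
    have "ratio ^ i = 2 powr ((p - 1) * real i)" using ratio_bounds by (simp add: ratio_def powr_powr flip: powr_realpow)
    then show ?thesis by (simp add: powr_powr powr_add[symmetric] algebra_simps)
  qed
  also have "\<dots> \<le> 2 * ratio ^ i"
    using p ratio_bounds powr_mono[of "1 - p" 1 2] by (intro mult_right_mono) auto
  finally have d: "(x / t) powr (1 - p) \<le> 2 * ratio ^ i" .
  have "\<phi> t / t \<le> C * (t / x) powr p * \<phi> x / t"
    using power_bound[OF assms(1,2)] t by (simp add: divide_right_mono)
  also have "\<dots> = C * ((t / x) powr p * (x / t)) * (\<phi> x / x)" using assms t by simp
  also have "(t / x) powr p * (x / t) = (x / t) powr (1 - p)"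
  proof -
    have "(x / t) powr (1 - p) = (x / t) powr 1 / (x / t) powr p" by (rule powr_diff)
    also have "\<dots> = (t / x) powr p * (x / t)" using assms t by (simp add: powr_divide mult.commute)
    finally show ?thesis by simp
  qed
  also have "C * (x / t) powr (1 - p) * (\<phi> x / x) \<le> C * (2 * ratio ^ i) * (\<phi> x / x)"
    using d C pos[OF assms(1)] assms(1) by (intro mult_right_mono mult_left_mono) auto
  finally show ?thesis using t assms(1) by (simp add: w_def mult_ac)
qed

text \<open>Up to the factor \<open>2 * C\<close>, a majorant of \<open>h f t\<close> for
  \<open>t\<close> in interval \<open>k\<close>: block \<open>k\<close> and those to its left,
  discounted by distance.\<close>

definition decay_sum :: "(real \<Rightarrow> real) \<Rightarrow> int \<Rightarrow> real" where
  "decay_sum f k = (\<Sum>i. ratio ^ i * dyadic_block (k - int i) f)"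

lemma decay_sum_summable:
  assumes "\<And>k. dyadic_block k f \<le> K" shows "summable (\<lambda>i. ratio ^ i * dyadic_block (k - int i) f)"
proof (rule summable_comparison_test)
  show "summable (\<lambda>i. ratio ^ i * K)" using ratio_bounds by (intro summable_mult2 summable_geometric) simp
  show "\<exists>N. \<forall>i\<ge>N. norm (ratio ^ i * dyadic_block (k - int i) f) \<le> ratio ^ i * K"
    using ratio_bounds assms dyadic_block_nonneg by (auto simp: abs_mult intro!: mult_left_mono)
qed

lemma decay_sum_le:
  assumes "\<And>k. dyadic_block k f \<le> K" shows "decay_sum f k \<le> K / (1 - ratio)"
proof -
  have "decay_sum f k \<le> (\<Sum>i. ratio ^ i * K)"
    unfolding decay_sum_def using ratio_bounds assms
    by (intro suminf_le decay_sum_summable[OF assms] summable_mult2 summable_geometric) auto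
  also have "\<dots> = K / (1 - ratio)"
    using ratio_bounds by (subst suminf_mult2[symmetric]) (auto simp: suminf_geometric summable_geometric)
  finally show ?thesis .
qed

text \<open>Tannery's theorem with majorant \<open>ratio ^ i * K\<close>; a general filter covers
  both ends of the integers.\<close>

lemma decay_sum_tendsto:
  assumes K: "\<And>k. dyadic_block k f \<le> K" and F: "F \<noteq> bot" and lim: "\<And>i. ((\<lambda>k. dyadic_block (k - int i) f) \<longlongrightarrow> 0) F"
  shows "(decay_sum f \<longlongrightarrow> 0) F"
proof -
  have "((\<lambda>k. \<Sum>i. ratio ^ i * dyadic_block (k - int i) f) \<longlongrightarrow> (\<Sum>i. 0)) F"
  proof (rule tannerys_theorem[THEN conjunct2, THEN conjunct2])
    show "((\<lambda>k. ratio ^ i * dyadic_block (k - int i) f) \<longlongrightarrow> 0) F" for i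
      using tendsto_mult_right_zero[OF lim] .
    show "eventually (\<lambda>(i, k). norm (ratio ^ i * dyadic_block (k - int i) f) \<le> ratio ^ i * K) (at_top \<times>\<^sub>F F)"
      using ratio_bounds K dyadic_block_nonneg by (intro always_eventually) (auto simp: abs_mult intro!: mult_left_mono)
    show "summable (\<lambda>i. ratio ^ i * K)" using ratio_bounds by (intro summable_mult2 summable_geometric) simp
  qed (rule F)
  then show ?thesis by (simp add: decay_sum_def[abs_def])
qed

text \<open>The integral up to \<open>t\<close> is spread over dyadic intervals, and
  \<open>w_decay\<close> trades \<open>w t\<close> for \<open>w x\<close> on each. The estimate runs
  in \<open>ennreal\<close> because integrability of \<open>f\<close> near 0 is itself a
  conclusion.\<close>

lemma h_le_decay_sum:
  assumes f: "f \<in> borel_measurable lebesgue"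
    and i: "\<And>k. integrable lebesgue (\<lambda>x. indicator (dyad k) x * (w x * f x))"
    and K: "\<And>k. dyadic_block k f \<le> K" and t: "0 < t"
  shows "set_integrable lebesgue {0..t} f" "h f t \<le> 2 * C * decay_sum f \<lfloor>log 2 t\<rfloor>"
proof -
  let ?k = "\<lfloor>log 2 t\<rfloor>"
  note [measurable] = f
  have nn: "(\<integral>\<^sup>+x. ennreal (indicator (dyad k) x * (w x * \<bar>f x\<bar>)) \<partial>lebesgue) = ennreal (dyadic_block k f)" for k
    unfolding dyadic_block_def
  proof (rule nn_integral_eq_integral)
    show "integrable lebesgue (\<lambda>x. indicator (dyad k) x * (w x * \<bar>f x\<bar>))"
      using integrable_abs[OF i[of k]] by (simp add: abs_mult w_nonneg)
  qed (auto simp: w_nonneg)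
  have "ennreal (w t) * (\<integral>\<^sup>+x. ennreal (indicator {0..t} x * \<bar>f x\<bar>) \<partial>lebesgue) =
      (\<integral>\<^sup>+x. ennreal (w t) * ennreal (indicator {0..t} x * \<bar>f x\<bar>) \<partial>lebesgue)"
    by (rule nn_integral_cmult[symmetric]) measurable
  also have "\<dots> \<le> (\<integral>\<^sup>+x. (\<Sum>i. ennreal (2 * C * ratio ^ i) * ennreal (indicator (dyad (?k - int i)) x * (w x * \<bar>f x\<bar>))) \<partial>lebesgue)"
  proof (rule nn_integral_mono_AE)
    \<comment> \<open>The point 0 belongs to no dyadic interval.\<close>
    have "AE x in lebesgue. x \<noteq> (0::real)" by (rule AE_completion[OF AE_lborel_singleton])
    then show "AE x in lebesgue. ennreal (w t) * ennreal (indicator {0..t} x * \<bar>f x\<bar>) \<le>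
        (\<Sum>i. ennreal (2 * C * ratio ^ i) * ennreal (indicator (dyad (?k - int i)) x * (w x * \<bar>f x\<bar>)))"
    proof eventually_elim
      case (elim x)
      show ?case
      proof (cases "x \<in> {0..t}")
        case True
        then have x: "0 < x" "x \<le> t" using elim by auto
        have "\<lfloor>log 2 x\<rfloor> \<le> ?k" using x by (intro floor_mono) simp
        then obtain j where j: "\<lfloor>log 2 x\<rfloor> = ?k - int j" by (metis diff_diff_eq2 add_diff_cancel_left' zle_iff_zadd)
        have "ennreal (w t) * ennreal (indicator {0..t} x * \<bar>f x\<bar>) = ennreal (w t * \<bar>f x\<bar>)"
          using True w_nonneg[of t] by (simp add: ennreal_mult)
        also have "\<dots> \<le> ennreal ((2 * C * ratio ^ j * w x) * \<bar>f x\<bar>)"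
          by (intro ennreal_leI mult_right_mono w_decay x j) simp
        also have "\<dots> = ennreal (2 * C * ratio ^ j) * ennreal (indicator (dyad (?k - int j)) x * (w x * \<bar>f x\<bar>))"
          using x j C ratio_bounds w_nonneg[of x] by (simp add: dyad_iff ennreal_mult[symmetric] mult_ac)
        also have "\<dots> \<le> (\<Sum>i. ennreal (2 * C * ratio ^ i) * ennreal (indicator (dyad (?k - int i)) x * (w x * \<bar>f x\<bar>)))"
          using sum_le_suminf[of "\<lambda>i. ennreal (2 * C * ratio ^ i) * ennreal (indicator (dyad (?k - int i)) x * (w x * \<bar>f x\<bar>))" "{j}"]
          by simp
        finally show ?thesis .
      qed simp
    qed
  qed
  also have "\<dots> = (\<Sum>i. \<integral>\<^sup>+x. ennreal (2 * C * ratio ^ i) * ennreal (indicator (dyad (?k - int i)) x * (w x * \<bar>f x\<bar>)) \<partial>lebesgue)"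
    by (rule nn_integral_suminf) measurable
  also have "\<dots> = (\<Sum>i. ennreal (2 * C * ratio ^ i) * ennreal (dyadic_block (?k - int i) f))"
    unfolding nn[symmetric] by (intro suminf_cong nn_integral_cmult) measurable
  also have "\<dots> = (\<Sum>i. ennreal (2 * C * (ratio ^ i * dyadic_block (?k - int i) f)))"
    using C ratio_bounds dyadic_block_nonneg by (simp add: ennreal_mult[symmetric] mult_ac)
  also have "\<dots> = ennreal (\<Sum>i. 2 * C * (ratio ^ i * dyadic_block (?k - int i) f))"
    using C ratio_bounds dyadic_block_nonneg by (intro suminf_ennreal2 summable_mult decay_sum_summable[OF K]) auto
  also have "(\<Sum>i. 2 * C * (ratio ^ i * dyadic_block (?k - int i) f)) = 2 * C * decay_sum f ?k"
    unfolding decay_sum_def by (rule suminf_mult[OF decay_sum_summable[OF K]])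
  finally have main: "ennreal (w t) * (\<integral>\<^sup>+x. ennreal (indicator {0..t} x * \<bar>f x\<bar>) \<partial>lebesgue) \<le> ennreal (2 * C * decay_sum f ?k)" .
  \<comment> \<open>Since \<open>w t > 0\<close>, an infinite integral would make the left side of
    \<open>main\<close> infinite.\<close>
  have fin: "(\<integral>\<^sup>+x. ennreal (indicator {0..t} x * \<bar>f x\<bar>) \<partial>lebesgue) < \<infinity>"
  proof (rule ccontr)
    assume "\<not> ?thesis"
    then have "(\<integral>\<^sup>+x. ennreal (indicator {0..t} x * \<bar>f x\<bar>) \<partial>lebesgue) = top"
      unfolding infinity_ennreal_def less_top[symmetric] by blast
    then show False using main w_pos[OF t] by (simp add: ennreal_mult_top top_unique)
  qed
  have int: "integrable lebesgue (\<lambda>x. indicator {0..t} x * \<bar>f x\<bar>)"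
    by (rule integrableI_nonneg) (use fin in auto)
  show "set_integrable lebesgue {0..t} f"
    unfolding set_integrable_def
    by (rule Bochner_Integration.integrable_bound[OF int]) (auto simp: indicator_def)
  have "(\<integral>\<^sup>+x. ennreal (indicator {0..t} x * \<bar>f x\<bar>) \<partial>lebesgue) = ennreal (primitive f t)"
    unfolding primitive_def set_lebesgue_integral_def real_scaleR_def
    by (rule nn_integral_eq_integral[OF int]) auto
  then have "ennreal (w t * primitive f t) \<le> ennreal (2 * C * decay_sum f ?k)"
    using main w_nonneg[of t] primitive_nonneg[of f t] by (simp add: ennreal_mult)
  moreover have "0 \<le> 2 * C * decay_sum f ?k"
    unfolding decay_sum_def using C ratio_bounds dyadic_block_nonneg by (intro mult_nonneg_nonneg suminf_nonneg decay_sum_summable[OF K]) auto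
  ultimately show "h f t \<le> 2 * C * decay_sum f ?k" using t by (simp add: h_w ennreal_le_iff)
qed

section \<open>Identification of the two spaces\<close>

lemma CesM0_block:
  assumes f: "f \<in> CesM0 \<phi>"
  shows "f \<in> B.X" "B.Q f \<le> 4 * ces_norm \<phi> f"
proof -
  note D = CesM0D[OF f]
  have le: "dyadic_block k f \<le> 2 * h f (2 powr (of_int k + 1))" for k by (rule dyadic_block_le_h[OF D(2,1)])
  have "((\<lambda>k. 2 * h f (2 powr (of_int k + 1))) \<longlongrightarrow> 0) at_top"
    by (rule tendsto_mult_right_zero[OF filterlim_compose[OF D(4) powr_int_at_top]])
  then have 1: "((\<lambda>k. dyadic_block k f) \<longlongrightarrow> 0) at_top"
    by (rule Lim_null_comparison[OF always_eventually, rotated]) (use le dyadic_block_nonneg in simp)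
  have "((\<lambda>k. 2 * h f (2 powr (of_int k + 1))) \<longlongrightarrow> 0) at_bot"
    by (rule tendsto_mult_right_zero[OF filterlim_compose[OF D(5) powr_int_at_bot]])
  then have 2: "((\<lambda>k. dyadic_block k f) \<longlongrightarrow> 0) at_bot"
    by (rule Lim_null_comparison[OF always_eventually, rotated]) (use le dyadic_block_nonneg in simp)
  have "(\<lambda>m. B.block m f) \<longlonglongrightarrow> 0"
    using decode_tendsto_of_int[OF 1 2] by (simp add: block_eq_dyadic_block[OF D(2)])
  then show "f \<in> B.X"
    using D(2) dyadic_block_le_h(1)[OF D(2,1)] by (simp add: B.X_def borel_measurable_M integrable_dyad_iff)
  show "B.Q f \<le> 4 * ces_norm \<phi> f"
  proof (rule B.Q_le)
    \<comment> \<open>One factor 2 compares the block with \<open>h f\<close>, the other compares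
      \<open>h f\<close> with the norm.\<close>
    show "B.block m f \<le> 4 * ces_norm \<phi> f" for m
      using le[of "int_decode m"] D(3)[of "2 powr (of_int (int_decode m) + 1)"]
      by (simp add: block_eq_dyadic_block[OF D(2)])
  qed
qed

text \<open>The discounted block sums inherit boundedness and both limits from the blocks and pass
  them on to \<open>h f\<close>. The constant combines \<open>2 * C\<close> from
  \<open>w_decay\<close>, the geometric series and \<open>hardy\<close>.\<close>

lemma block_CesM0:
  assumes f: "f \<in> B.X"
  shows "f \<in> CesM0 \<phi>" "ces_norm \<phi> f \<le> (2 * C / (1 - ratio) * hardy) * B.Q f"
proof -
  have m: "f \<in> borel_measurable lebesgue" using B.X_meas[OF f] by (simp add: borel_measurable_M)
  have i: "integrable lebesgue (\<lambda>x. indicator (dyad k) x * (w x * f x))" for k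
    using B.X_int[OF f, of "int_encode k"] by (simp add: integrable_dyad_iff[OF m])
  have K: "dyadic_block k f \<le> B.Q f" for k
    using B.block_le_Q[OF f, of "int_encode k"] by (simp add: block_eq_dyadic_block[OF m])
  have hS: "h f t \<le> 2 * C * decay_sum f \<lfloor>log 2 t\<rfloor>" if "0 < t" for t by (rule h_le_decay_sum(2)[OF m i K that])
  have lf: "locally_int f" unfolding locally_int_def using h_le_decay_sum(1)[OF m i K] by blast
  have hK: "h f t \<le> 2 * C / (1 - ratio) * B.Q f" if "0 < t" for t
  proof -
    have "2 * C * decay_sum f \<lfloor>log 2 t\<rfloor> \<le> 2 * C * (B.Q f / (1 - ratio))"
      using C by (intro mult_left_mono decay_sum_le K) auto
    then show ?thesis using hS[OF that] by simp
  qed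
  have b: "(\<lambda>m. dyadic_block (int_decode m) f) \<longlonglongrightarrow> 0" using B.block_tendsto[OF f] by (simp add: block_eq_dyadic_block[OF m])
  have "((\<lambda>k. dyadic_block (k - int i) f) \<longlongrightarrow> 0) at_top" for i
  proof (rule filterlim_compose[OF int_tendsto_of_decode(1)[OF b]])
    show "filterlim (\<lambda>k. k - int i) at_top at_top"
      unfolding filterlim_at_top
    proof
      show "eventually (\<lambda>k. Z \<le> k - int i) at_top" for Z
        by (rule eventually_mono[OF eventually_ge_at_top[of "Z + int i"]]) auto
    qed
  qed
  then have S1: "(decay_sum f \<longlongrightarrow> 0) at_top" by (intro decay_sum_tendsto[OF K]) auto
  have "((\<lambda>k. dyadic_block (k - int i) f) \<longlongrightarrow> 0) at_bot" for i
  proof (rule filterlim_compose[OF int_tendsto_of_decode(2)[OF b]])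
    show "filterlim (\<lambda>k. k - int i) at_bot at_bot"
      unfolding filterlim_at_bot
    proof
      show "eventually (\<lambda>k. k - int i \<le> Z) at_bot" for Z
        by (rule eventually_mono[OF eventually_le_at_bot[of Z]]) auto
    qed
  qed
  then have S2: "(decay_sum f \<longlongrightarrow> 0) at_bot" by (intro decay_sum_tendsto[OF K]) auto
  have top: "(h f \<longlongrightarrow> 0) at_top"
  proof (rule Lim_null_comparison)
    show "eventually (\<lambda>t. norm (h f t) \<le> 2 * C * decay_sum f \<lfloor>log 2 t\<rfloor>) at_top"
      by (rule eventually_mono[OF eventually_gt_at_top[of 0]]) (simp add: hS h_nonneg)
    show "((\<lambda>t. 2 * C * decay_sum f \<lfloor>log 2 t\<rfloor>) \<longlongrightarrow> 0) at_top"
      by (rule tendsto_mult_right_zero[OF filterlim_compose[OF S1 floor_log_at_top]])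
  qed
  have zero: "(h f \<longlongrightarrow> 0) (at_right 0)"
  proof (rule Lim_null_comparison)
    show "eventually (\<lambda>t. norm (h f t) \<le> 2 * C * decay_sum f \<lfloor>log 2 t\<rfloor>) (at_right 0)"
      by (rule eventually_mono[OF eventually_at_right_less]) (simp add: hS h_nonneg)
    show "((\<lambda>t. 2 * C * decay_sum f \<lfloor>log 2 t\<rfloor>) \<longlongrightarrow> 0) (at_right 0)"
      by (rule tendsto_mult_right_zero[OF filterlim_compose[OF S2 floor_log_at_right_0]])
  qed
  show "f \<in> CesM0 \<phi>" by (rule CesM0I(1)[OF m lf hK top zero])
  show "ces_norm \<phi> f \<le> (2 * C / (1 - ratio) * hardy) * B.Q f"
    using CesM0I(2)[OF m lf hK top zero] by (simp add: mult_ac)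
qed

theorem dunford_pettis_CesM0: "dunford_pettis (CesM0 \<phi>) (ces_norm \<phi>)"
proof -
  have eq: "CesM0 \<phi> = B.X" using CesM0_block(1) block_CesM0(1) by blast
  show ?thesis
    unfolding eq
  proof (rule dunford_pettis_equivalent[where Q = B.Q and ?K1.0 = 4 and ?K2.0 = "2 * C / (1 - ratio) * hardy"])
    show "function_seminorm B.X B.Q" by (rule B.function_seminorm_axioms)
    show "0 \<le> ces_norm \<phi> f" for f by (simp add: ces_norm_def)
    show "0 < 2 * C / (1 - ratio) * hardy" using C ratio_bounds hardy_pos by simp
    show "B.Q f \<le> 4 * ces_norm \<phi> f" if "f \<in> B.X" for f using that CesM0_block(2) eq by simp
    show "ces_norm \<phi> f \<le> 2 * C / (1 - ratio) * hardy * B.Q f" if "f \<in> B.X" for f using that by (rule block_CesM0(2))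
    show "dunford_pettis B.X B.Q" by (rule B.dunford_pettis_c0_sum_L1)
  qed simp
qed

end

theorem theorem9:
  fixes \<phi> :: "real \<Rightarrow> real"
  assumes "mono_on {0..} \<phi>"
    and "concave_on {0..} \<phi>"
    and "\<phi> 0 = 0"
    and "\<forall>t>0. 0 < \<phi> t"
    and "(\<phi> \<longlongrightarrow> 0) (at_right 0)"
    and "q_index \<phi> < 1"
  shows "dunford_pettis (CesM0 \<phi>) (ces_norm \<phi>)"
proof -
  have pos: "0 < \<phi> t" if "0 < t" for t using assms(4) that by simp
  have mono: "\<phi> u \<le> \<phi> t" if "0 < u" "u \<le> t" for u t
    using assms(1) that by (auto simp: mono_on_def)
  \<comment> \<open>Concavity between 0 and \<open>t\<close>, where
    \<open>\<phi> 0 = 0\<close>.\<close>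
  have anti: "\<phi> t / t \<le> \<phi> u / u" if ut: "0 < u" "u \<le> t" for u t
  proof -
    have "(1 - u / t) * \<phi> 0 + u / t * \<phi> t \<le> \<phi> ((1 - u / t) *\<^sub>R 0 + (u / t) *\<^sub>R t)"
      using ut by (intro concave_onD[OF assms(2)]) auto
    then have "u / t * \<phi> t \<le> \<phi> u" using ut assms(3) by simp
    then show ?thesis using ut by (simp add: field_simps)
  qed
  obtain s a where sa: "1 < s" "1 \<le> a" "a < s" "\<And>t. 0 < t \<Longrightarrow> \<phi> (s * t) \<le> a * \<phi> t"
    using q_index_less_1_dilation[of \<phi>, OF pos anti mono assms(6)] by blast
  \<comment> \<open>The dilation factor \<open>a\<close> serves as the constant, and
    \<open>a < s\<close> makes the exponent \<open>log s a\<close> less than 1.\<close>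
  have "power_bounded_weight \<phi> a (log s a)"
  proof
    show "0 \<le> log s a" "log s a < 1" using sa by (simp_all add: log_less_iff)
    show "\<phi> t \<le> a * (t / u) powr log s a * \<phi> u" if "0 < u" "u \<le> t" for u t
      by (rule dilation_power_bound[of \<phi>, OF pos mono sa(1,2,4) that])
  qed (fact pos anti mono assms(5) sa(2))+
  then show ?thesis by (rule power_bounded_weight.dunford_pettis_CesM0)
qed

end
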